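(* Let $G$ be a $\mathbf{W}$-object with Madden frame $L$. (a) Conditions (1) and (2) together are equivalent to conditions (3) and (4) together: (1) $G$ contains arbitrarily small positive multiples of $1$; (2) $G^*$ is conditionally pointwise complete; (3) $L$ is boolean; (4) the Madden representation carries $G^*$ onto $\mathcal{R}^*L$. (b) Conditions (1) and ($2_\sigma$) together are equivalent to conditions ($3_\sigma$) and (4) together, where (1) and (4) are as listed in (a) and ($2_\sigma$) $G^*$ is conditionally pointwise $\sigma$-complete; ($3_\sigma$) $L$ is a $P$-frame.
   Context: $\mathbf{W}$ is the category of archimedean lattice-ordered groups $G$ with a designated weak order unit, written $1$ (so $1\ge 0$ and $g \wedge 1 = 0$ with $g \geq 0$ implies $g = 0$); morphisms are lattice-ordered group homomorphisms carrying designated unit to designated unit. $G^*=\{g\in G : |g|\le n\cdot 1\text{ for some } n\in\mathbb{N}\}$ is the bounded part of $G$. A $\mathbf{W}$-kernel of $G$ is the kernel of a $\mathbf{W}$-morphism out of $G$. For $S \subseteq G$, $[S]$ is the smallest $\mathbf{W}$-kernel of $G$ containing $S$. The $\mathbf{W}$-kernels of $G$, ordered by inclusion, form a (regular Lindelöf) frame $L = \mathcal{M}G$, the Madden frame of $G$. All frames are completely regular. $\mathcal{O}\mathbb{R}$ is the frame of open subsets of $\mathbb{R}$, and $\mathcal{R}L$ is the set of frame maps $\mathcal{O}\mathbb{R} \to L$; write $f(r,\infty)$ for $f((r,\infty))$. $\mathcal{R}L$ is a $\mathbf{W}$-object: a continuous operation $w : \mathbb{R}^n \to \mathbb{R}$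 lifts to $\mathcal{R}L$ by $w'(f_1,\dots,f_n)(U) = \bigvee \{ f_1(U_1)\wedge\dots\wedge f_n(U_n) : U_i \in \mathcal{O}\mathbb{R},\ w(U_1\times\dots\times U_n)\subseteq U\}$, a real constant $r$ is the map with $r(U) = \top$ if $r \in U$ and $\bot$ otherwise, the designated unit is the constant $1$, and $f \le g$ iff $f(r,\infty)\le g(r,\infty)$ for all $r \in \mathbb{R}$. $\mathcal{R}^*L$ is the bounded part of $\mathcal{R}L$. The cozero elements of $L$ are those of the form $\operatorname{coz} f = f(\mathbb{R}\smallsetminus\{0\})$, $f\in\mathcal{R}L$. $L$ is boolean if every element is complemented, and a $P$-frame if every cozero element is complemented. The Madden representation $G \to \mathcal{R}L$, $g \mapsto \widehat g$, is the injective $\mathbf{W}$-morphism with $\widehat g(r,\infty) = [(g-r)^+]$. If the constant $r$ is not in $G$ this is read as follows: for rational $r=p/q$, $q>0$, $[(g-r)^+]$ means $[(qg - p\cdot 1)^+]$, and for arbitrary real $r$ it is the join of these over rationals $s>r$. $f_0$ is the pointwise supremum of $F\subseteq G$ if $\widehat{f_0}(r,\infty) = \bigvee_{f\in F}\widehat f(r,\infty)$ in $L$ for all $r\in\mathbb{R}$. $G^*$ is conditionally pointwise complete ($\sigma$-complete) if every nonempty (countable) subset of $G^*$ which is bounded above in $G^*$ has a pointwise supremum lying in $G^*$, where pointwise suprema are taken in the sense just defined, i.e. with respect to the Madden frame $L$ of $G$. *)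

theory Defs
  imports
    Complex_Main
    "HOL-Library.Lattice_Algebras"
    "HOL-Library.Countable_Set"
    "HOL-Library.FuncSet"
    "HOL-Algebra.Complete_Lattice"
    "HOL-Algebra.Coset"
begin

text \<open>
  A lattice-ordered group with a designated unit, with explicit carrier. It extends the monoid
  record, so the group is written multiplicatively: \<open>\<otimes>\<close> is addition, the field \<open>one\<close> (that is,
  \<open>\<one>\<close>) is the zero of the group, and \<open>g [^] n\<close> is the multiple \<open>n g\<close>. The designated weak order
  unit is \<open>wunit\<close>.
\<close>

record 'a lgroup = "'a monoid" +
  neg :: "'a \<Rightarrow> 'a"
  lsup :: "'a \<Rightarrow> 'a \<Rightarrow> 'a"
  linf :: "'a \<Rightarrow> 'a \<Rightarrow> 'a"
  lle :: "'a \<Rightarrow> 'a \<Rightarrow> bool"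
  wunit :: 'a

definition order_of :: "'a lgroup \<Rightarrow> 'a gorder" where
  "order_of G = \<lparr>carrier = carrier G, eq = (=), le = lle G\<rparr>"

definition w_object :: "'a lgroup \<Rightarrow> bool" where
  "w_object G \<longleftrightarrow>
     comm_group G \<and>
     (\<forall>x\<in>carrier G. neg G x = inv\<^bsub>G\<^esub> x) \<and>
     Lattice.lattice (order_of G) \<and>
     (\<forall>x\<in>carrier G. \<forall>y\<in>carrier G.
        lsup G x y = x \<squnion>\<^bsub>order_of G\<^esub> y \<and> linf G x y = x \<sqinter>\<^bsub>order_of G\<^esub> y) \<and>
     (\<forall>x\<in>carrier G. \<forall>y\<in>carrier G. \<forall>z\<in>carrier G.
        lle G x y \<longrightarrow> lle G (x \<otimes>\<^bsub>G\<^esub> z) (y \<otimes>\<^bsub>G\<^esub> z)) \<and>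
     (\<forall>x\<in>carrier G. \<forall>y\<in>carrier G.
        lle G \<one>\<^bsub>G\<^esub> x \<and> lle G \<one>\<^bsub>G\<^esub> y \<and> (\<forall>n::nat. lle G (x [^]\<^bsub>G\<^esub> n) y) \<longrightarrow> x = \<one>\<^bsub>G\<^esub>) \<and>
     wunit G \<in> carrier G \<and>
     lle G \<one>\<^bsub>G\<^esub> (wunit G) \<and>
     (\<forall>g\<in>carrier G. lle G \<one>\<^bsub>G\<^esub> g \<and> linf G g (wunit G) = \<one>\<^bsub>G\<^esub> \<longrightarrow> g = \<one>\<^bsub>G\<^esub>)"

definition w_morphism :: "'a lgroup \<Rightarrow> 'b lgroup \<Rightarrow> ('a \<Rightarrow> 'b) \<Rightarrow> bool" where
  "w_morphism G H h \<longleftrightarrow>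
     h \<in> hom G H \<and>
     (\<forall>x\<in>carrier G. \<forall>y\<in>carrier G.
        h (lsup G x y) = lsup H (h x) (h y) \<and> h (linf G x y) = linf H (h x) (h y)) \<and>
     h (wunit G) = wunit H"

definition bounded_part :: "'a lgroup \<Rightarrow> 'a set" where
  "bounded_part G =
     {g \<in> carrier G. \<exists>n::nat. lle G (lsup G g (neg G g)) (wunit G [^]\<^bsub>G\<^esub> n)}"

text \<open>
  The lattice-ordered group carried by a whole type of class \<^class>\<open>lattice_ab_group_add\<close>, with
  designated unit \<open>u\<close>.
\<close>

definition lgroup_of :: "'a::lattice_ab_group_add \<Rightarrow> 'a lgroup" where
  "lgroup_of u =
     \<lparr>carrier = UNIV, mult = (+), one = 0, neg = uminus,
      lsup = Lattices.sup, linf = Lattices.inf, lle = (\<le>), wunit = u\<rparr>"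

text \<open>
  The image of a morphism is isomorphic to a structure on the set of cosets of the kernel. So
  codomains with elements of type \<open>'a set\<close> yield the kernels of all morphisms out of \<open>G\<close>; see
  \<open>w_kernel_kernel\<close> below.
\<close>

definition w_kernel :: "'a lgroup \<Rightarrow> 'a set \<Rightarrow> bool" where
  "w_kernel G K \<longleftrightarrow>
     (\<exists>(H :: 'a set lgroup) h. w_object H \<and> w_morphism G H h \<and> K = kernel G H h)"

abbreviation kernel_gen :: "'a lgroup \<Rightarrow> 'a set \<Rightarrow> 'a set" where
  "kernel_gen G S \<equiv> w_kernel G hull S"

definition madden_frame :: "'a lgroup \<Rightarrow> 'a set gorder" where
  "madden_frame G = \<lparr>carrier = {K. w_kernel G K}, eq = (=), le = (\<subseteq>)\<rparr>"


text \<open>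
  The frame maps from the open sets of the reals to \<open>L\<close>. They are made extensional, so that
  equality of functions is equality of frame maps.
\<close>

definition frame_maps :: "'l gorder \<Rightarrow> (real set \<Rightarrow> 'l) set" where
  "frame_maps L =
     {f \<in> {U. open U} \<rightarrow>\<^sub>E carrier L.
        f UNIV = \<top>\<^bsub>L\<^esub> \<and>
        (\<forall>U V. open U \<and> open V \<longrightarrow> f (U \<inter> V) = f U \<sqinter>\<^bsub>L\<^esub> f V) \<and>
        (\<forall>\<U>. (\<forall>U\<in>\<U>. open U) \<longrightarrow> f (\<Union>\<U>) = \<Squnion>\<^bsub>L\<^esub> (f ` \<U>))}"

definition rl_const :: "'l gorder \<Rightarrow> real \<Rightarrow> real set \<Rightarrow> 'l" where
  "rl_const L r = (\<lambda>U\<in>{U. open U}. if r \<in> U then \<top>\<^bsub>L\<^esub> else \<bottom>\<^bsub>L\<^esub>)"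

definition rl_lift1 ::
    "'l gorder \<Rightarrow> (real \<Rightarrow> real) \<Rightarrow> (real set \<Rightarrow> 'l) \<Rightarrow> real set \<Rightarrow> 'l" where
  "rl_lift1 L w f =
     (\<lambda>U\<in>{U. open U}. \<Squnion>\<^bsub>L\<^esub> {f V | V. open V \<and> w ` V \<subseteq> U})"

definition rl_lift2 ::
    "'l gorder \<Rightarrow> (real \<Rightarrow> real \<Rightarrow> real) \<Rightarrow>
      (real set \<Rightarrow> 'l) \<Rightarrow> (real set \<Rightarrow> 'l) \<Rightarrow> real set \<Rightarrow> 'l" where
  "rl_lift2 L w f g =
     (\<lambda>U\<in>{U. open U}. \<Squnion>\<^bsub>L\<^esub> {f V \<sqinter>\<^bsub>L\<^esub> g W | V W.
        open V \<and> open W \<and> (\<lambda>(x, y). w x y) ` (V \<times> W) \<subseteq> U})"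

definition RL :: "'l gorder \<Rightarrow> (real set \<Rightarrow> 'l) lgroup" where
  "RL L =
     \<lparr>carrier = frame_maps L, mult = rl_lift2 L (+), one = rl_const L 0,
      neg = rl_lift1 L uminus, lsup = rl_lift2 L max, linf = rl_lift2 L min,
      lle = (\<lambda>f g. \<forall>r. f {r<..} \<sqsubseteq>\<^bsub>L\<^esub> g {r<..}), wunit = rl_const L 1\<rparr>"

definition coz :: "(real set \<Rightarrow> 'l) \<Rightarrow> 'l" where
  "coz f = f (UNIV - {0})"

definition complemented :: "'l gorder \<Rightarrow> 'l \<Rightarrow> bool" where
  "complemented L a \<longleftrightarrow>
     (\<exists>b\<in>carrier L. a \<sqinter>\<^bsub>L\<^esub> b = \<bottom>\<^bsub>L\<^esub> \<and> a \<squnion>\<^bsub>L\<^esub> b = \<top>\<^bsub>L\<^esub>)"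

definition boolean_frame :: "'l gorder \<Rightarrow> bool" where
  "boolean_frame L \<longleftrightarrow> (\<forall>a\<in>carrier L. complemented L a)"

definition P_frame :: "'l gorder \<Rightarrow> bool" where
  "P_frame L \<longleftrightarrow> (\<forall>f\<in>frame_maps L. complemented L (coz f))"


text \<open>
  For \<open>r = p / q\<close> with \<open>q > 0\<close>, the kernel generated by \<open>(q g - p 1)\<^sup>+\<close>.
\<close>

definition madden_ray :: "'a lgroup \<Rightarrow> 'a \<Rightarrow> int \<Rightarrow> nat \<Rightarrow> 'a set" where
  "madden_ray G g p q =
     kernel_gen G
       {lsup G ((g [^]\<^bsub>G\<^esub> q) \<otimes>\<^bsub>G\<^esub> neg G (wunit G [^]\<^bsub>G\<^esub> p)) \<one>\<^bsub>G\<^esub>}"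

text \<open>
  A frame map on the open sets of the reals is determined by its values on the rays \<open>{r<..}\<close>,
  so the description below has at most one solution.
\<close>

definition madden_rep :: "'a lgroup \<Rightarrow> 'a \<Rightarrow> real set \<Rightarrow> 'a set" where
  "madden_rep G g =
     (THE f. f \<in> frame_maps (madden_frame G) \<and>
        (\<forall>p q. 0 < q \<longrightarrow> f {of_int p / of_nat q <..} = madden_ray G g p q) \<and>
        (\<forall>r. f {r<..} =
           \<Squnion>\<^bsub>madden_frame G\<^esub>
             {madden_ray G g p q | p q. 0 < q \<and> r < of_int p / of_nat q}))"

definition pointwise_sup :: "'a lgroup \<Rightarrow> 'a set \<Rightarrow> 'a \<Rightarrow> bool" where
  "pointwise_sup G F f\<^sub>0 \<longleftrightarrow>
     (\<forall>r. madden_rep G f\<^sub>0 {r<..} =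
        \<Squnion>\<^bsub>madden_frame G\<^esub> ((\<lambda>f. madden_rep G f {r<..}) ` F))"

definition cond_pointwise_complete :: "'a lgroup \<Rightarrow> bool" where
  "cond_pointwise_complete G \<longleftrightarrow>
     (\<forall>F. F \<subseteq> bounded_part G \<and> F \<noteq> {} \<and>
          (\<exists>b\<in>bounded_part G. \<forall>f\<in>F. lle G f b) \<longrightarrow>
        (\<exists>f\<^sub>0\<in>bounded_part G. pointwise_sup G F f\<^sub>0))"

definition cond_pointwise_sigma_complete :: "'a lgroup \<Rightarrow> bool" where
  "cond_pointwise_sigma_complete G \<longleftrightarrow>
     (\<forall>F. F \<subseteq> bounded_part G \<and> F \<noteq> {} \<and> countable F \<and>
          (\<exists>b\<in>bounded_part G. \<forall>f\<in>F. lle G f b) \<longrightarrow>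
        (\<exists>f\<^sub>0\<in>bounded_part G. pointwise_sup G F f\<^sub>0))"

text \<open>
  The multiples are by real numbers: \<open>G\<close> contains \<open>r 1\<close> when the constant \<open>r\<close> lies in the image
  of the Madden representation.
\<close>

definition small_unit_multiples :: "'a lgroup \<Rightarrow> bool" where
  "small_unit_multiples G \<longleftrightarrow>
     (\<forall>\<epsilon>>0. \<exists>r. 0 < r \<and> r < \<epsilon> \<and>
        rl_const (madden_frame G) r \<in> madden_rep G ` carrier G)"

definition madden_rep_onto_bounded :: "'a lgroup \<Rightarrow> bool" where
  "madden_rep_onto_bounded G \<longleftrightarrow>
     madden_rep G ` bounded_part G = bounded_part (RL (madden_frame G))"


lemma w_objectI:
  assumes group: "comm_group G"
    and neg: "\<And>x. x \<in> carrier G \<Longrightarrow> neg G x = inv\<^bsub>G\<^esub> x"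
    and refl: "\<And>x. x \<in> carrier G \<Longrightarrow> lle G x x"
    and antisym: "\<And>x y. x \<in> carrier G \<Longrightarrow> y \<in> carrier G \<Longrightarrow> lle G x y \<Longrightarrow> lle G y x \<Longrightarrow> x = y"
    and trans: "\<And>x y z. x \<in> carrier G \<Longrightarrow> y \<in> carrier G \<Longrightarrow> z \<in> carrier G \<Longrightarrow>
      lle G x y \<Longrightarrow> lle G y z \<Longrightarrow> lle G x z"
    and sup: "\<And>x y. x \<in> carrier G \<Longrightarrow> y \<in> carrier G \<Longrightarrow>
      lsup G x y \<in> carrier G \<and> lle G x (lsup G x y) \<and> lle G y (lsup G x y)"
    and sup_least: "\<And>x y z. x \<in> carrier G \<Longrightarrow> y \<in> carrier G \<Longrightarrow> z \<in> carrier G \<Longrightarrow>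
      lle G x z \<Longrightarrow> lle G y z \<Longrightarrow> lle G (lsup G x y) z"
    and inf: "\<And>x y. x \<in> carrier G \<Longrightarrow> y \<in> carrier G \<Longrightarrow>
      linf G x y \<in> carrier G \<and> lle G (linf G x y) x \<and> lle G (linf G x y) y"
    and inf_greatest: "\<And>x y z. x \<in> carrier G \<Longrightarrow> y \<in> carrier G \<Longrightarrow> z \<in> carrier G \<Longrightarrow>
      lle G z x \<Longrightarrow> lle G z y \<Longrightarrow> lle G z (linf G x y)"
    and compat: "\<And>x y z. x \<in> carrier G \<Longrightarrow> y \<in> carrier G \<Longrightarrow> z \<in> carrier G \<Longrightarrow>
      lle G x y \<Longrightarrow> lle G (x \<otimes>\<^bsub>G\<^esub> z) (y \<otimes>\<^bsub>G\<^esub> z)"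
    and arch: "\<And>x y. x \<in> carrier G \<Longrightarrow> y \<in> carrier G \<Longrightarrow> lle G \<one>\<^bsub>G\<^esub> x \<Longrightarrow> lle G \<one>\<^bsub>G\<^esub> y \<Longrightarrow>
      (\<And>n::nat. lle G (x [^]\<^bsub>G\<^esub> n) y) \<Longrightarrow> x = \<one>\<^bsub>G\<^esub>"
    and unit: "wunit G \<in> carrier G" "lle G \<one>\<^bsub>G\<^esub> (wunit G)"
    and weak: "\<And>g. g \<in> carrier G \<Longrightarrow> lle G \<one>\<^bsub>G\<^esub> g \<Longrightarrow> linf G g (wunit G) = \<one>\<^bsub>G\<^esub> \<Longrightarrow> g = \<one>\<^bsub>G\<^esub>"
  shows "w_object G"
proof -
  let ?L = "order_of G"
  have c: "carrier ?L = carrier G" and le: "le ?L = lle G" and eq: "eq ?L = (=)"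
    by (simp_all add: order_of_def)
  have po: "partial_order ?L"
    by unfold_locales (auto simp: order_of_def intro: refl antisym trans)
  then interpret partial_order ?L .
  have lub: "least ?L (lsup G x y) (Upper ?L {x, y})"
    if "x \<in> carrier G" "y \<in> carrier G" for x y
    using sup[OF that] sup_least[OF that] that
    by (auto simp: least_def Upper_def c le)
  have glb: "greatest ?L (linf G x y) (Lower ?L {x, y})"
    if "x \<in> carrier G" "y \<in> carrier G" for x y
    using inf[OF that] inf_greatest[OF that] that
    by (auto simp: greatest_def Lower_def c le)
  have lat: "Lattice.lattice ?L"
    by unfold_locales (use lub glb c in metis)+
  interpret lat: Lattice.lattice ?L by (rule lat)
  have join: "lsup G x y = x \<squnion>\<^bsub>?L\<^esub> y" if "x \<in> carrier G" "y \<in> carrier G" for x y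
    unfolding join_def sup_def
    using someI[of "\<lambda>a. least ?L a (Upper ?L {x, y})", OF lub[OF that]] lub[OF that]
    by (metis least_unique)
  have meet: "linf G x y = x \<sqinter>\<^bsub>?L\<^esub> y" if "x \<in> carrier G" "y \<in> carrier G" for x y
    unfolding meet_def inf_def
    using someI[of "\<lambda>a. greatest ?L a (Lower ?L {x, y})", OF glb[OF that]] glb[OF that]
    by (metis greatest_unique)
  show ?thesis
    unfolding w_object_def
  proof (intro conjI ballI impI)
    fix x y assume "x \<in> carrier G" "y \<in> carrier G"
      and *: "lle G \<one>\<^bsub>G\<^esub> x \<and> lle G \<one>\<^bsub>G\<^esub> y \<and> (\<forall>n::nat. lle G (x [^]\<^bsub>G\<^esub> n) y)"
    then show "x = \<one>\<^bsub>G\<^esub>" using arch by blast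
  next
    fix g assume "g \<in> carrier G" "lle G \<one>\<^bsub>G\<^esub> g \<and> linf G g (wunit G) = \<one>\<^bsub>G\<^esub>"
    then show "g = \<one>\<^bsub>G\<^esub>" using weak by blast
  qed (fact lat group neg compat unit join meet | rule neg compat join meet; assumption)+
qed

lemma w_objectD:
  assumes "w_object G"
  shows "comm_group G"
    and "\<And>x. x \<in> carrier G \<Longrightarrow> neg G x = inv\<^bsub>G\<^esub> x"
    and "\<And>x. x \<in> carrier G \<Longrightarrow> lle G x x"
    and "\<And>x y. x \<in> carrier G \<Longrightarrow> y \<in> carrier G \<Longrightarrow> lle G x y \<Longrightarrow> lle G y x \<Longrightarrow> x = y"
    and "\<And>x y z. x \<in> carrier G \<Longrightarrow> y \<in> carrier G \<Longrightarrow> z \<in> carrier G \<Longrightarrow>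
      lle G x y \<Longrightarrow> lle G y z \<Longrightarrow> lle G x z"
    and "\<And>x y. x \<in> carrier G \<Longrightarrow> y \<in> carrier G \<Longrightarrow>
      lsup G x y \<in> carrier G \<and> lle G x (lsup G x y) \<and> lle G y (lsup G x y)"
    and "\<And>x y z. x \<in> carrier G \<Longrightarrow> y \<in> carrier G \<Longrightarrow> z \<in> carrier G \<Longrightarrow>
      lle G x z \<Longrightarrow> lle G y z \<Longrightarrow> lle G (lsup G x y) z"
    and "\<And>x y. x \<in> carrier G \<Longrightarrow> y \<in> carrier G \<Longrightarrow>
      linf G x y \<in> carrier G \<and> lle G (linf G x y) x \<and> lle G (linf G x y) y"
    and "\<And>x y z. x \<in> carrier G \<Longrightarrow> y \<in> carrier G \<Longrightarrow> z \<in> carrier G \<Longrightarrow>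
      lle G z x \<Longrightarrow> lle G z y \<Longrightarrow> lle G z (linf G x y)"
    and "\<And>x y z. x \<in> carrier G \<Longrightarrow> y \<in> carrier G \<Longrightarrow> z \<in> carrier G \<Longrightarrow>
      lle G x y \<Longrightarrow> lle G (x \<otimes>\<^bsub>G\<^esub> z) (y \<otimes>\<^bsub>G\<^esub> z)"
    and "\<And>x y. x \<in> carrier G \<Longrightarrow> y \<in> carrier G \<Longrightarrow> lle G \<one>\<^bsub>G\<^esub> x \<Longrightarrow> lle G \<one>\<^bsub>G\<^esub> y \<Longrightarrow>
      (\<And>n::nat. lle G (x [^]\<^bsub>G\<^esub> n) y) \<Longrightarrow> x = \<one>\<^bsub>G\<^esub>"
    and "wunit G \<in> carrier G"
    and "lle G \<one>\<^bsub>G\<^esub> (wunit G)"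
    and "\<And>g. g \<in> carrier G \<Longrightarrow> lle G \<one>\<^bsub>G\<^esub> g \<Longrightarrow> linf G g (wunit G) = \<one>\<^bsub>G\<^esub> \<Longrightarrow> g = \<one>\<^bsub>G\<^esub>"
proof -
  let ?L = "order_of G"
  have c: "carrier ?L = carrier G" and le: "le ?L = lle G" and eq: "eq ?L = (=)"
    by (simp_all add: order_of_def)
  interpret Lattice.lattice ?L using assms by (simp add: w_object_def)
  have s: "lsup G x y = x \<squnion>\<^bsub>?L\<^esub> y" "linf G x y = x \<sqinter>\<^bsub>?L\<^esub> y"
    if "x \<in> carrier G" "y \<in> carrier G" for x y
    using assms that by (auto simp: w_object_def)
  show "lle G x x" if "x \<in> carrier G" for x using le_refl that by (simp add: c le)
  show "x = y" if "x \<in> carrier G" "y \<in> carrier G" "lle G x y" "lle G y x" for x y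
    using le_antisym[of x y] that by (simp add: c le)
  show "lle G x z" if "x \<in> carrier G" "y \<in> carrier G" "z \<in> carrier G" "lle G x y" "lle G y z"
    for x y z using le_trans[of x y z] that by (simp add: c le)
  show "lsup G x y \<in> carrier G \<and> lle G x (lsup G x y) \<and> lle G y (lsup G x y)"
    if "x \<in> carrier G" "y \<in> carrier G" for x y
    using join_closed[of x y] join_left[of x y] join_right[of x y] that by (simp add: s c le)
  show "lle G (lsup G x y) z"
    if "x \<in> carrier G" "y \<in> carrier G" "z \<in> carrier G" "lle G x z" "lle G y z" for x y z
    using join_le[of x z y] that by (simp add: s c le)
  show "linf G x y \<in> carrier G \<and> lle G (linf G x y) x \<and> lle G (linf G x y) y"
    if "x \<in> carrier G" "y \<in> carrier G" for x y
    using meet_closed[of x y] meet_left[of x y] meet_right[of x y] that by (simp add: s c le)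
  show "lle G z (linf G x y)"
    if "x \<in> carrier G" "y \<in> carrier G" "z \<in> carrier G" "lle G z x" "lle G z y" for x y z
    using meet_le[of z x y] that by (simp add: s c le)
  show "x = \<one>\<^bsub>G\<^esub>" if "x \<in> carrier G" "y \<in> carrier G" "lle G \<one>\<^bsub>G\<^esub> x" "lle G \<one>\<^bsub>G\<^esub> y"
    "\<And>n::nat. lle G (x [^]\<^bsub>G\<^esub> n) y" for x y
    using assms that unfolding w_object_def by blast
qed (use assms in \<open>auto simp: w_object_def\<close>)

lemma w_kernel_kernel:
  fixes G :: "'a lgroup" and H :: "'b lgroup"
  assumes G: "w_object G" and H: "w_object H" and h: "w_morphism G H h"
  shows "w_kernel G (kernel G H h)"
proof -
  interpret G: comm_group G by (rule w_objectD[OF G])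
  interpret H: comm_group H by (rule w_objectD[OF H])
  note GD = w_objectD[OF G] and HD = w_objectD[OF H]
  have hom: "h \<in> hom G H" using h by (simp add: w_morphism_def)
  interpret gh: group_hom G H h by unfold_locales (rule hom)
  have hlat: "h (lsup G x y) = lsup H (h x) (h y)" "h (linf G x y) = linf H (h x) (h y)"
    if "x \<in> carrier G" "y \<in> carrier G" for x y using h that by (auto simp: w_morphism_def)
  have hu: "h (wunit G) = wunit H" using h by (simp add: w_morphism_def)
  define e where "e y = {g \<in> carrier G. h g = y}" for y
  define d where "d A = h (SOME g. g \<in> A)" for A
  have de: "d (e (h x)) = h x" if "x \<in> carrier G" for x
  proof -
    have "(SOME g. g \<in> e (h x)) \<in> e (h x)" using someI[of "\<lambda>g. g \<in> e (h x)" x] that by (simp add: e_def)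
    then show ?thesis by (simp add: d_def e_def)
  qed
  have inj: "e (h x) = e (h y) \<longleftrightarrow> h x = h y" if "x \<in> carrier G" "y \<in> carrier G" for x y
    using de[OF that(1)] de[OF that(2)] by metis
  define Q where "Q =
    \<lparr>carrier = (\<lambda>x. e (h x)) ` carrier G, mult = (\<lambda>A B. e (d A \<otimes>\<^bsub>H\<^esub> d B)), one = e \<one>\<^bsub>H\<^esub>,
     neg = (\<lambda>A. e (inv\<^bsub>H\<^esub> (d A))), lsup = (\<lambda>A B. e (lsup H (d A) (d B))),
     linf = (\<lambda>A B. e (linf H (d A) (d B))), lle = (\<lambda>A B. lle H (d A) (d B)), wunit = e (wunit H)\<rparr>"
  have Qc: "carrier Q = (\<lambda>x. e (h x)) ` carrier G" by (simp add: Q_def)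
  have Qin: "\<exists>a. a \<in> carrier G \<and> x = e (h a)" if "x \<in> carrier Q" for x using that unfolding Qc by blast
  have eQ: "e (h a) \<in> carrier Q" if "a \<in> carrier G" for a using that unfolding Qc by blast
  have Q1: "\<one>\<^bsub>Q\<^esub> = e (h \<one>\<^bsub>G\<^esub>)" by (simp add: Q_def)
  have Qu: "wunit Q = e (h (wunit G))" by (simp add: Q_def hu)
  have Qm: "e (h x) \<otimes>\<^bsub>Q\<^esub> e (h y) = e (h (x \<otimes>\<^bsub>G\<^esub> y))"
    and Qs: "lsup Q (e (h x)) (e (h y)) = e (h (lsup G x y))"
    and Qi: "linf Q (e (h x)) (e (h y)) = e (h (linf G x y))"
    and Ql: "lle Q (e (h x)) (e (h y)) = lle H (h x) (h y)"
    if "x \<in> carrier G" "y \<in> carrier G" for x y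
    using that by (simp_all add: Q_def de hlat)
  have Qn: "neg Q (e (h x)) = e (h (inv\<^bsub>G\<^esub> x))" if "x \<in> carrier G" for x
    using that by (simp add: Q_def de)
  have Qg: "comm_group Q"
  proof (rule comm_groupI)
    show "\<exists>y\<in>carrier Q. y \<otimes>\<^bsub>Q\<^esub> x = \<one>\<^bsub>Q\<^esub>" if xy: "x \<in> carrier Q" for x
    proof -
      obtain a where a: "a \<in> carrier G" "x = e (h a)" using Qin[OF xy] by blast
      have "e (h (inv\<^bsub>G\<^esub> a)) \<otimes>\<^bsub>Q\<^esub> x = \<one>\<^bsub>Q\<^esub>" unfolding a(2) Q1 Qm[OF G.inv_closed[OF a(1)] a(1)] G.l_inv[OF a(1)] ..
      then show ?thesis using eQ a by blast
    qed
    show "x \<otimes>\<^bsub>Q\<^esub> y \<otimes>\<^bsub>Q\<^esub> z = x \<otimes>\<^bsub>Q\<^esub> (y \<otimes>\<^bsub>Q\<^esub> z)"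
      if xy: "x \<in> carrier Q" "y \<in> carrier Q" "z \<in> carrier Q" for x y z
    proof -
      obtain a b c where "a \<in> carrier G" "x = e (h a)" "b \<in> carrier G" "y = e (h b)"
        "c \<in> carrier G" "z = e (h c)" using Qin[OF xy(1)] Qin[OF xy(2)] Qin[OF xy(3)] by blast
      then show ?thesis by (simp add: Qm G.m_assoc del: gh.hom_mult)
    qed
    show "x \<otimes>\<^bsub>Q\<^esub> y = y \<otimes>\<^bsub>Q\<^esub> x" if xy: "x \<in> carrier Q" "y \<in> carrier Q" for x y
    proof -
      obtain a b where "a \<in> carrier G" "x = e (h a)" "b \<in> carrier G" "y = e (h b)"
        using Qin[OF xy(1)] Qin[OF xy(2)] by blast
      then show ?thesis by (simp add: Qm G.m_comm del: gh.hom_mult)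
    qed
    show "\<one>\<^bsub>Q\<^esub> \<otimes>\<^bsub>Q\<^esub> x = x" if xy: "x \<in> carrier Q" for x
    proof -
      obtain a where a: "a \<in> carrier G" "x = e (h a)" using Qin[OF xy] by blast
      show ?thesis unfolding a(2) Q1 Qm[OF G.one_closed a(1)] G.l_one[OF a(1)] ..
    qed
    show "x \<otimes>\<^bsub>Q\<^esub> y \<in> carrier Q" if xy: "x \<in> carrier Q" "y \<in> carrier Q" for x y
    proof -
      obtain a b where "a \<in> carrier G" "x = e (h a)" "b \<in> carrier G" "y = e (h b)"
        using Qin[OF xy(1)] Qin[OF xy(2)] by blast
      then show ?thesis by (metis Qm eQ G.m_closed)
    qed
  next
    show "\<one>\<^bsub>Q\<^esub> \<in> carrier Q" unfolding Q1 Qc by blast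
  qed
  interpret Q: comm_group Q by (rule Qg)
  have Qp: "e (h x) [^]\<^bsub>Q\<^esub> (n::nat) = e (h (x [^]\<^bsub>G\<^esub> n))" if "x \<in> carrier G" for x n
  proof (induction n)
    case 0 then show ?case by (simp add: Q1)
  next
    case (Suc n)
    show ?case
      unfolding nat_pow_Suc Suc by (rule Qm) (use that in auto)
  qed
  have hp: "h (x [^]\<^bsub>G\<^esub> n) = h x [^]\<^bsub>H\<^esub> n" if "x \<in> carrier G" for x and n :: nat
    using that by (simp add: gh.hom_nat_pow)
  have "w_object Q"
  proof (rule w_objectI[OF Qg], goal_cases)
    case (1 x)
    then obtain a where a: "a \<in> carrier G" "x = e (h a)" using Qin by blast
    have "neg Q x \<otimes>\<^bsub>Q\<^esub> x = \<one>\<^bsub>Q\<^esub>"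
      unfolding a(2) Q1 Qn[OF a(1)] Qm[OF G.inv_closed[OF a(1)] a(1)] G.l_inv[OF a(1)] ..
    moreover have "neg Q x \<in> carrier Q" using a Qn[of a] eQ by (metis G.inv_closed)
    ultimately show ?case using 1 Q.inv_equality by metis
  next
    case (2 x)
    then obtain a where a: "a \<in> carrier G" "x = e (h a)" using Qin by blast
    show ?case unfolding a(2) Ql[OF a(1) a(1)] by (rule HD(3)) (use a in simp)
  next
    case (3 x y)
    then obtain a b where ab: "a \<in> carrier G" "b \<in> carrier G" "x = e (h a)" "y = e (h b)"
      using Qin by metis
    have "h a = h b"
      using HD(4)[of "h a" "h b"] 3(3,4) ab(1,2) unfolding ab(3,4) Ql[OF ab(1,2)] Ql[OF ab(2,1)]
      by simp
    then show ?case using ab by simp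
  next
    case (4 x y z)
    then obtain a b c where ab: "a \<in> carrier G" "x = e (h a)" "b \<in> carrier G" "y = e (h b)"
      "c \<in> carrier G" "z = e (h c)" using Qin by metis
    show ?case using 4(4,5) ab Ql[of a b] Ql[of b c] Ql[of a c] HD(5)[of "h a" "h b" "h c"] by simp
  next
    case (5 x y)
    then obtain a b where ab: "a \<in> carrier G" "x = e (h a)" "b \<in> carrier G" "y = e (h b)"
      using Qin by metis
    have s: "lsup G a b \<in> carrier G" using GD(6) ab by blast
    show ?case using ab s Qs[of a b] Ql[of a "lsup G a b"] Ql[of b "lsup G a b"] eQ[OF s]
        HD(6)[of "h a" "h b"] by (simp add: hlat)
  next
    case (6 x y z)
    then obtain a b c where ab: "a \<in> carrier G" "x = e (h a)" "b \<in> carrier G" "y = e (h b)"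
      "c \<in> carrier G" "z = e (h c)" using Qin by metis
    have s: "lsup G a b \<in> carrier G" using GD(6) ab by blast
    show ?case using 6(4,5) ab s Qs[of a b] Ql[of a c] Ql[of b c] Ql[of "lsup G a b" c]
        HD(7)[of "h a" "h b" "h c"] by (simp add: hlat)
  next
    case (7 x y)
    then obtain a b where ab: "a \<in> carrier G" "x = e (h a)" "b \<in> carrier G" "y = e (h b)"
      using Qin by metis
    have s: "linf G a b \<in> carrier G" using GD(8) ab by blast
    show ?case using ab s Qi[of a b] Ql[of "linf G a b" a] Ql[of "linf G a b" b] eQ[OF s]
        HD(8)[of "h a" "h b"] by (simp add: hlat)
  next
    case (8 x y z)
    then obtain a b c where ab: "a \<in> carrier G" "x = e (h a)" "b \<in> carrier G" "y = e (h b)"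
      "c \<in> carrier G" "z = e (h c)" using Qin by metis
    have s: "linf G a b \<in> carrier G" using GD(8) ab by blast
    show ?case using 8(4,5) ab s Qi[of a b] Ql[of c a] Ql[of c b] Ql[of c "linf G a b"]
        HD(9)[of "h a" "h b" "h c"] by (simp add: hlat)
  next
    case (9 x y z)
    then obtain a b c where ab: "a \<in> carrier G" "x = e (h a)" "b \<in> carrier G" "y = e (h b)"
      "c \<in> carrier G" "z = e (h c)" using Qin by metis
    show ?case using 9(4) ab Qm[of a c] Qm[of b c] Ql[of a b] Ql[of "a \<otimes>\<^bsub>G\<^esub> c" "b \<otimes>\<^bsub>G\<^esub> c"]
        HD(10)[of "h a" "h b" "h c"] by simp
  next
    case (10 x y)
    then obtain a b where ab: "a \<in> carrier G" "x = e (h a)" "b \<in> carrier G" "y = e (h b)"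
      using Qin by metis
    have "h a = \<one>\<^bsub>H\<^esub>"
    proof (rule HD(11)[of "h a" "h b"])
      show "lle H \<one>\<^bsub>H\<^esub> (h a)" "lle H \<one>\<^bsub>H\<^esub> (h b)"
        using 10 ab Ql[of "\<one>\<^bsub>G\<^esub>" a] Ql[of "\<one>\<^bsub>G\<^esub>" b] by (simp_all add: Q1)
      show "lle H (h a [^]\<^bsub>H\<^esub> n) (h b)" for n :: nat
        using 10(5)[of n] ab Ql[of "a [^]\<^bsub>G\<^esub> n" b] by (simp add: Qp hp)
    qed (use ab in auto)
    then show ?case using ab by (simp add: Q1)
  next
    case 11 show ?case using GD(12) eQ by (simp add: Qu)
  next
    case 12 show ?case using GD(12) HD(13) Ql[of "\<one>\<^bsub>G\<^esub>" "wunit G"] by (simp add: Q1 Qu hu)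
  next
    case (13 x)
    then obtain a where a: "a \<in> carrier G" "x = e (h a)" using Qin by blast
    have "e (h (linf G a (wunit G))) = e (h \<one>\<^bsub>G\<^esub>)"
      using 13 a Qi[of a "wunit G"] GD(12) by (simp add: Q1 Qu)
    then have "linf H (h a) (wunit H) = \<one>\<^bsub>H\<^esub>"
      using inj[of "linf G a (wunit G)" "\<one>\<^bsub>G\<^esub>"] GD(8)[of a "wunit G"] GD(12) a
      by (simp add: hlat hu)
    then have "h a = \<one>\<^bsub>H\<^esub>"
      using HD(14)[of "h a"] 13 a Ql[of "\<one>\<^bsub>G\<^esub>" a] by (simp add: Q1)
    then show ?case using a by (simp add: Q1)
  qed
  moreover have "w_morphism G Q (\<lambda>x. e (h x))"
    using eQ by (auto simp: w_morphism_def hom_def Qm Qs Qi Qu simp del: gh.hom_mult)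
  moreover have "kernel G H h = kernel G Q (\<lambda>x. e (h x))"
    using inj[OF _ G.one_closed] by (auto simp: kernel_def Q1)
  ultimately show ?thesis unfolding w_kernel_def by blast
qed

lemma lgroup_of_inv: "inv\<^bsub>lgroup_of u\<^esub> x = - x"
  and comm_group_lgroup_of: "comm_group (lgroup_of u)"
proof -
  show g: "comm_group (lgroup_of u)"
  proof (rule comm_groupI)
    show "\<exists>y\<in>carrier (lgroup_of u). y \<otimes>\<^bsub>lgroup_of u\<^esub> x = \<one>\<^bsub>lgroup_of u\<^esub>" for x
      by (rule bexI[of _ "- x"]) (simp_all add: lgroup_of_def)
  qed (simp_all add: lgroup_of_def ac_simps)
  interpret comm_group "lgroup_of u" by (rule g)
  show "inv\<^bsub>lgroup_of u\<^esub> x = - x"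
    by (rule inv_equality) (simp_all add: lgroup_of_def)
qed

lemma w_object_lgroup_of_iff:
  fixes u :: "'a::lattice_ab_group_add"
  shows "w_object (lgroup_of u) \<longleftrightarrow>
     (\<forall>(x::'a) y. 0 \<le> x \<and> 0 \<le> y \<and> (\<forall>n. ((+) x ^^ n) 0 \<le> y) \<longrightarrow> x = 0) \<and>
     0 \<le> u \<and> (\<forall>g. 0 \<le> g \<and> Lattices.inf g u = 0 \<longrightarrow> g = 0)"
proof -
  interpret comm_group "lgroup_of u" by (rule comm_group_lgroup_of)
  have p: "x [^]\<^bsub>lgroup_of u\<^esub> n = ((+) x ^^ n) 0" for x and n :: nat
  proof (induction n)
    case (Suc n)
    show ?case unfolding nat_pow_Suc Suc by (simp add: lgroup_of_def add.commute[of _ x])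
  next
    case 0
    show ?case unfolding nat_pow_0 by (simp add: lgroup_of_def)
  qed
  show ?thesis (is "_ \<longleftrightarrow> ?R")
  proof
    assume "w_object (lgroup_of u)"
    note D = w_objectD(11,13,14)[OF this]
    show ?R
    proof (intro conjI allI impI)
      show "x = 0" if "0 \<le> x \<and> 0 \<le> y \<and> (\<forall>n. ((+) x ^^ n) 0 \<le> y)" for x y :: 'a
        using D(1)[of x y, unfolded p] that by (simp add: lgroup_of_def)
    qed (use D(2,3) in \<open>auto simp: lgroup_of_def\<close>)
  next
    assume R: ?R
    show "w_object (lgroup_of u)"
    proof (rule w_objectI[OF comm_group_lgroup_of], unfold p lgroup_of_inv)
      show "x = \<one>\<^bsub>lgroup_of u\<^esub>"
        if "lle (lgroup_of u) \<one>\<^bsub>lgroup_of u\<^esub> x" "lle (lgroup_of u) \<one>\<^bsub>lgroup_of u\<^esub> y"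
          "\<And>n. lle (lgroup_of u) (((+) x ^^ n) 0) y" for x y :: 'a
      proof -
        have "0 \<le> x \<and> 0 \<le> y \<and> (\<forall>n. ((+) x ^^ n) 0 \<le> y)"
          using that by (simp add: lgroup_of_def)
        then have "x = 0" using R by blast
        then show ?thesis by (simp add: lgroup_of_def)
      qed
    qed (use R in \<open>auto simp: lgroup_of_def\<close>)
  qed
qed

end

theory Submission
  imports Defs
begin

text \<open>
  A kernel of \<open>G\<close> is a convex \<open>l\<close>-subgroup closed under two rules which say that the quotient is
  archimedean and that the unit remains a weak unit. Relative pseudocomplements of kernels are kernels,
  so kernels form a frame, and since the rules have countably many premises the frame is Lindelof. A
  frame map on \<open>\<O>\<real>\<close> amounts to a suitable descending family of upper rays; the archimedean rule makes
  the rays of \<open>g\<close> such a family, which yields the Madden representation.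

  If \<open>G\<^sup>*\<close> is pointwise (\<open>\<sigma>\<close>-)complete, the supremum of the truncations \<open>n k \<and> 1\<close> over generators \<open>k\<close>
  of a kernel is its characteristic function, so the kernel is complemented; cozero elements are
  countably generated, so countable suprema suffice for them. A bounded frame map \<open>h\<close> is the supremum
  of countably many elements of \<open>G\<^sup>*\<close> built from near-constants \<open>c\<close> and generators of \<open>h(c, \<infinity>)\<close>.
  Conversely, when the joins of the rays \<open>f(r, \<infinity>)\<close>, \<open>f \<in> F\<close>, are complemented they are the rays of a
  bounded frame map, which lies in the image of \<open>G\<^sup>*\<close>.
\<close>

text \<open>Two obstacles shape the proof. First, \<open>G\<close> need not be divisible and need
  not contain constants other than the integer multiples of \<open>u\<close>. So \<open>g\<close> is
  compared with p/q only through \<open>q g - p u\<close>, and denominators are cleared by passing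
  to multiples. Second, a generated kernel \<open>kg S\<close> is given only as a hull, without a
  formula for its elements. It is therefore handled through its universal property:
  \<open>kg S \<subseteq> J\<close> holds once \<open>J\<close> is an ideal containing
  \<open>S\<close>, and residuals are the ideals that make this work below a meet. A kernel is shown
  to be everything by producing \<open>u\<close> in it. The archimedean rule serves throughout as
  the passage to a limit: what holds up to a fixed error for all multiples of \<open>x\<close> holds
  for \<open>x\<close>. Arbitrarily small constants enter as grids of arbitrarily fine mesh, from
  which completeness reassembles a given bounded frame map.\<close>

hide_const (open) Lattice.sup Lattice.inf

section \<open>Integer multiples and positive parts in an abelian lattice-ordered group\<close>

definition mul :: "int \<Rightarrow> 'a::lattice_ab_group_add \<Rightarrow> 'a" where
  "mul p x = x [^]\<^bsub>lgroup_of (0::'a)\<^esub> p"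

text \<open>The power does not look at the designated unit, so one scalar multiplication serves the
  groups \<open>lgroup_of u\<close> for all \<open>u\<close>.\<close>

lemma int_pow_lgroup_of [simp]: "x [^]\<^bsub>lgroup_of u\<^esub> (p::int) = mul p x"
  by (simp add: mul_def int_pow_def2 nat_pow_def lgroup_of_inv) (simp add: lgroup_of_def)

lemma nat_pow_lgroup_of [simp]: "x [^]\<^bsub>lgroup_of u\<^esub> (n::nat) = mul (int n) x"
  using int_pow_int[of "lgroup_of u" x n] by simp

lemma lgroup_of_simps [simp]:
  "carrier (lgroup_of u) = UNIV" "x \<otimes>\<^bsub>lgroup_of u\<^esub> y = x + y" "\<one>\<^bsub>lgroup_of u\<^esub> = 0"
  "neg (lgroup_of u) x = - x" "lsup (lgroup_of u) x y = sup x y" "linf (lgroup_of u) x y = inf x y"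
  "lle (lgroup_of u) x y \<longleftrightarrow> x \<le> y" "wunit (lgroup_of u) = u"
  by (simp_all add: lgroup_of_def)

global_interpretation mul: Modules.module "mul :: int \<Rightarrow> 'a::lattice_ab_group_add \<Rightarrow> 'a"
proof
  interpret comm_group "lgroup_of (0::'a)" by (rule comm_group_lgroup_of)
  show "mul a (x + y) = mul a x + mul a y" for a and x y :: 'a
    using int_pow_mult_distrib[of x y a] m_comm[of x y] by simp
  show "mul (a + b) x = mul a x + mul b x" for a b and x :: 'a
    using int_pow_mult[of x a b] by simp
  show "mul a (mul b x) = mul (a * b) x" for a b and x :: 'a
    using int_pow_pow[of x b a] by (simp add: mult.commute)
  show "mul 1 x = x" for x :: 'a
    using int_pow_1[of x] by simp
qed

lemma mul_nonneg: "0 \<le> p \<Longrightarrow> 0 \<le> x \<Longrightarrow> 0 \<le> mul p x"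
  by (induction p rule: int_ge_induct) (simp_all add: mul.scale_left_distrib)

lemma mul_mono: "0 \<le> p \<Longrightarrow> x \<le> y \<Longrightarrow> mul p x \<le> mul p y"
  using mul_nonneg[of p "y - x"] by (simp add: algebra_simps)

lemma mul_mono_left: "p \<le> q \<Longrightarrow> 0 \<le> x \<Longrightarrow> mul p x \<le> mul q x"
  using mul_nonneg[of "q - p" x] by (simp add: algebra_simps)

text \<open>Expanding \<open>inf x y + inf x z\<close> gives the infimum of \<open>x + x\<close>,
  \<open>x + z\<close>, \<open>y + x\<close> and \<open>y + z\<close>; nonnegativity puts the
  left-hand side below each of them.\<close>

lemma inf_add_le:
  fixes x y z :: "'a::lattice_ab_group_add"
  assumes "0 \<le> x" "0 \<le> y" "0 \<le> z"
  shows "inf x (y + z) \<le> inf x y + inf x z"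
proof -
  have "inf x (y + z) \<le> inf (inf (x + x) (x + z)) (inf (y + x) (y + z))"
    using assms by (simp add: le_infI1 le_infI2 add_increasing add_increasing2)
  also have "\<dots> = inf x y + inf x z"
    by (simp add: add_sup_inf_distribs inf_aci add.commute)
  finally show ?thesis .
qed

lemma inf_mul_le:
  assumes "0 \<le> p" "0 \<le> x" "0 \<le> y"
  shows "inf x (mul p y) \<le> mul p (inf x y)"
  using assms(1)
proof (induction p rule: int_ge_induct)
  case base
  then show ?case by simp
next
  case (step i)
  have "inf x (mul i y + y) \<le> inf x (mul i y) + inf x y"
    using step assms by (intro inf_add_le mul_nonneg)
  also have "\<dots> \<le> mul i (inf x y) + inf x y"
    using step by simp
  finally show ?case by (simp add: mul.scale_left_distrib)
qed

lemma disjoint_mul: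
  assumes "inf x y = 0" "0 \<le> p"
  shows "inf x (mul p y) = 0"
proof -
  have "0 \<le> x" "0 \<le> y" using assms(1) by (metis inf_le1, metis inf_le2)
  then show ?thesis
    using inf_mul_le[of p x y] assms mul_nonneg[of p y] by (simp add: order_antisym)
qed

text \<open>Uniqueness of the decomposition into disjoint parts: for disjoint elements the supremum
  is the sum. The computation of \<open>pprt_mul\<close> rests on it.\<close>

lemma pprt_diff_disjoint:
  fixes x y :: "'a::lattice_ab_group_add"
  assumes "inf x y = 0"
  shows "pprt (x - y) = x"
proof -
  have "pprt (x - y) = sup x y - y"
    by (simp add: pprt_def add_sup_distrib_right[of x y "- y", simplified])
  also have "sup x y = x + y"
    using add_eq_inf_sup[of x y] assms by simp
  finally show ?thesis by simp
qed

lemma pprt_minus_pprt: "pprt x - pprt (- x) = (x::'a::lattice_ab_group_add)"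
  using prts[of x] by (simp add: pprt_neg)

lemma disjoint_pprt: "inf (pprt x) (pprt (- x)) = (0::'a::lattice_ab_group_add)"
proof -
  have "inf (pprt x) (pprt x - x) = pprt x + inf 0 (- x)"
    by (simp add: add_inf_distrib_left)
  also have "inf 0 (- x) = - pprt x"
    by (simp add: pprt_def inf_commute)
  finally have "inf (pprt x) (pprt x - x) = 0" by simp
  moreover have "pprt x - x = pprt (- x)"
    using pprt_minus_pprt[of x] by (simp add: algebra_simps)
  ultimately show ?thesis by simp
qed

text \<open>Multiples of the disjoint elements \<open>pprt x\<close> and \<open>pprt (- x)\<close>
  stay disjoint, and their difference is \<open>mul p x\<close>.\<close>

lemma pprt_mul:
  assumes "0 \<le> p"
  shows "pprt (mul p x) = mul p (pprt x)"
proof -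
  have "inf (mul p (pprt x)) (mul p (pprt (- x))) = 0"
    using disjoint_mul[OF _ assms, of "mul p (pprt x)" "pprt (- x)"]
      disjoint_mul[OF _ assms, of "pprt (- x)" "pprt x"] disjoint_pprt[of x]
    by (simp add: inf_commute)
  from pprt_diff_disjoint[OF this] show ?thesis
    using pprt_minus_pprt[of x] by (simp flip: mul.scale_right_diff_distrib)
qed

lemma inf_eq_diff_pprt: "inf x y = x - pprt (x - (y::'a::lattice_ab_group_add))"
  by (simp add: pprt_def add_inf_distrib_left inf_commute)

lemma mul_inf: "0 \<le> p \<Longrightarrow> mul p (inf x y) = inf (mul p x) (mul p y)"
  by (simp only: inf_eq_diff_pprt mul.scale_right_diff_distrib flip: pprt_mul)

lemma pprt_le_iff: "pprt x \<le> y \<longleftrightarrow> x \<le> y \<and> 0 \<le> (y::'a::lattice_ab_group_add)"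
  by (auto simp: pprt_def)

lemma le_pprt: "x \<le> pprt (x::'a::lattice_ab_group_add)"
  by (simp add: pprt_def)

lemma pprt_inf: "pprt (inf x y) = inf (pprt x) (pprt (y::'a::lattice_ab_group_add))"
proof (rule order_antisym)
  have "inf (pprt x) (pprt y) - pprt (inf x y) \<le> 0"
  proof -
    \<comment> \<open>Subtracting \<open>inf x y\<close> makes the two elements disjoint, which is
      what cancels the excess in the final infimum.\<close>
    define a b where "a = x - inf x y" and "b = y - inf x y"
    have ab: "inf a b = 0"
      using add_inf_distrib_right[of x y "- inf x y"]
      by (simp only: a_def b_def diff_conv_add_uminus right_minus)
    have nn: "0 \<le> a" "0 \<le> b" using ab by (metis inf_le1, metis inf_le2)
    have "x = inf x y + a" "y = inf x y + b" 
      unfolding a_def b_def by (metis add.commute diff_add_cancel)+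
    then have "x \<le> pprt (inf x y) + a" "y \<le> pprt (inf x y) + b"
      using add_right_mono[OF le_pprt[of "inf x y"], of a] add_right_mono[OF le_pprt[of "inf x y"], of b]
      by simp_all
    then have "pprt x \<le> pprt (inf x y) + a" "pprt y \<le> pprt (inf x y) + b"
      using nn by (simp_all add: pprt_le_iff)
    then have "inf (pprt x) (pprt y) \<le> inf (pprt (inf x y) + a) (pprt (inf x y) + b)"
      by (simp add: le_infI1 le_infI2)
    also have "\<dots> = pprt (inf x y)" using ab by (simp flip: add_inf_distrib_left)
    finally show ?thesis by simp
  qed
  then show "inf (pprt x) (pprt y) \<le> pprt (inf x y)" by simp
qed simp

text \<open>Where \<open>x\<close> is negative, \<open>x - y\<close> is negative as well, so
  truncating at 0 beforehand changes nothing.\<close>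

lemma pprt_pprt_diff:
  fixes x y :: "'a::lattice_ab_group_add"
  assumes "0 \<le> y"
  shows "pprt (pprt x - y) = pprt (x - y)"
proof (rule order_antisym)
  have "x \<le> pprt (x - y) + y" using le_pprt[of "x - y"] by (simp only: diff_le_eq)
  then have "pprt x - y \<le> pprt (x - y)"
    using assms by (simp only: diff_le_eq pprt_le_iff add_nonneg_nonneg zero_le_pprt)
  then show "pprt (pprt x - y) \<le> pprt (x - y)"
    by (simp only: pprt_le_iff zero_le_pprt)
  show "pprt (x - y) \<le> pprt (pprt x - y)"
    by (intro pprt_mono diff_right_mono le_pprt)
qed

section \<open>Absolute values and ideals\<close>

definition labs :: "'a::lattice_ab_group_add \<Rightarrow> 'a" where
  "labs x = sup x (- x)"

lemma labs_ge: "x \<le> labs x" "- x \<le> labs x"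
  by (simp_all add: labs_def)

lemma labs_nonneg [simp]: "0 \<le> labs x"
  using add_mono[OF labs_ge, of x x] by simp

lemma labs_of_nonneg [simp]: "0 \<le> x \<Longrightarrow> labs x = x"
  by (simp add: labs_def sup_absorb1 order_trans[of "- x" 0 x])

lemma labs_minus [simp]: "labs (- x) = labs x"
  by (simp add: labs_def sup_commute)

lemma labs_le_iff: "labs x \<le> y \<longleftrightarrow> x \<le> y \<and> - x \<le> y"
  by (simp add: labs_def)

lemma labs_add_le: "labs (x + y) \<le> labs x + labs y"
  using add_mono[OF labs_ge(1)[of x] labs_ge(1)[of y]]
    add_mono[OF labs_ge(2)[of x] labs_ge(2)[of y]]
  by (simp add: labs_le_iff)

lemma labs_eq_0_iff [simp]: "labs x = 0 \<longleftrightarrow> x = 0"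
  by (simp add: labs_def)

text \<open>Membership of \<open>pprt (x - y)\<close> in \<open>K\<close> expresses that
  \<open>x\<close> lies below \<open>y\<close> in the quotient, so the archimedean property of the
  quotient can be stated inside the group. The \<open>labs\<close> clause combines convexity with
  closure under negation.\<close>

definition w_ideal :: "'a::lattice_ab_group_add \<Rightarrow> 'a set \<Rightarrow> bool" where
  "w_ideal u K \<longleftrightarrow>
     0 \<in> K \<and> (\<forall>x\<in>K. \<forall>y\<in>K. x + y \<in> K) \<and> (\<forall>x\<in>K. \<forall>y. labs y \<le> labs x \<longrightarrow> y \<in> K) \<and>
     (\<forall>x y. 0 \<le> x \<and> 0 \<le> y \<and> (\<forall>n. pprt (mul (int n) x - y) \<in> K) \<longrightarrow> x \<in> K) \<and>
     (\<forall>g\<ge>0. inf g u \<in> K \<longrightarrow> g \<in> K)"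

lemma w_idealI:
  assumes "0 \<in> K" "\<And>x y. x \<in> K \<Longrightarrow> y \<in> K \<Longrightarrow> x + y \<in> K"
    "\<And>x y. x \<in> K \<Longrightarrow> labs y \<le> labs x \<Longrightarrow> y \<in> K"
    "\<And>x y. 0 \<le> x \<Longrightarrow> 0 \<le> y \<Longrightarrow> (\<And>n. pprt (mul (int n) x - y) \<in> K) \<Longrightarrow> x \<in> K"
    "\<And>g. 0 \<le> g \<Longrightarrow> inf g u \<in> K \<Longrightarrow> g \<in> K"
  shows "w_ideal u K"
  unfolding w_ideal_def
proof (intro conjI allI impI ballI)
  show "x \<in> K" if "0 \<le> x \<and> 0 \<le> y \<and> (\<forall>n. pprt (mul (int n) x - y) \<in> K)" for x y
    using assms(4)[of x y] that by simp
qed (use assms(1,2,3,5) in metis)+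

lemma w_idealD:
  assumes "w_ideal u K"
  shows "0 \<in> K" "\<And>x y. x \<in> K \<Longrightarrow> y \<in> K \<Longrightarrow> x + y \<in> K"
    "\<And>x y. x \<in> K \<Longrightarrow> labs y \<le> labs x \<Longrightarrow> y \<in> K"
    "\<And>x y. 0 \<le> x \<Longrightarrow> 0 \<le> y \<Longrightarrow> (\<And>n. pprt (mul (int n) x - y) \<in> K) \<Longrightarrow> x \<in> K"
    "\<And>g. 0 \<le> g \<Longrightarrow> inf g u \<in> K \<Longrightarrow> g \<in> K"
proof -
  note * = assms[unfolded w_ideal_def, THEN conjunct2]
  show "0 \<in> K" by (rule assms[unfolded w_ideal_def, THEN conjunct1])
  show "x + y \<in> K" if "x \<in> K" "y \<in> K" for x y
    using *[THEN conjunct1] that by blast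
  show "y \<in> K" if "x \<in> K" "labs y \<le> labs x" for x y
    using *[THEN conjunct2, THEN conjunct1] that by blast
  show "x \<in> K" if "0 \<le> x" "0 \<le> y" "\<And>n. pprt (mul (int n) x - y) \<in> K" for x y
    using *[THEN conjunct2, THEN conjunct2, THEN conjunct1] that by blast
  show "g \<in> K" if "0 \<le> g" "inf g u \<in> K" for g
    using *[THEN conjunct2, THEN conjunct2, THEN conjunct2] that by blast
qed

lemma w_ideal_minus: "w_ideal u K \<Longrightarrow> x \<in> K \<Longrightarrow> - x \<in> K"
  by (rule w_idealD(3)[of u K x]) auto

lemma w_ideal_diff: "w_ideal u K \<Longrightarrow> x \<in> K \<Longrightarrow> y \<in> K \<Longrightarrow> x - y \<in> K"
  using w_idealD(2)[of u K x "- y"] w_ideal_minus[of u K y] by simp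

lemma w_ideal_le: "w_ideal u K \<Longrightarrow> x \<in> K \<Longrightarrow> 0 \<le> y \<Longrightarrow> y \<le> x \<Longrightarrow> y \<in> K"
  by (rule w_idealD(3)[of u K x]) auto

lemma w_ideal_labs: "w_ideal u K \<Longrightarrow> labs x \<in> K \<longleftrightarrow> x \<in> K"
  using w_idealD(3)[of u K x "labs x"] w_idealD(3)[of u K "labs x" x] by auto

lemma w_ideal_mul: "w_ideal u K \<Longrightarrow> x \<in> K \<Longrightarrow> mul (int n) x \<in> K"
  by (induction n) (simp_all add: mul.scale_left_distrib w_idealD)

text \<open>The infimum of \<open>labs x\<close> and \<open>u\<close> lies below \<open>u\<close>,
  so the unit rule puts every \<open>labs x\<close> into \<open>K\<close>. This is the test for the
  top kernel used below.\<close>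

lemma w_ideal_unit:
  assumes "w_ideal u K" "u \<in> K" "0 \<le> u"
  shows "K = UNIV"
proof -
  have "labs x \<in> K" for x
    using w_idealD(5)[OF assms(1), of "labs x"] w_ideal_le[OF assms(1,2), of "inf (labs x) u"] assms(3) by simp
  then show ?thesis using w_ideal_labs[OF assms(1)] by blast
qed

lemma w_ideal_Inter: "(\<And>K. K \<in> \<K> \<Longrightarrow> w_ideal u K) \<Longrightarrow> w_ideal u (\<Inter>\<K>)"
  by (rule w_idealI) (simp_all, (metis w_idealD(1) w_idealD(2) w_idealD(3) w_idealD(4) w_idealD(5))+)

lemma w_ideal_UNIV: "w_ideal u UNIV"
  by (simp add: w_ideal_def)

text \<open>The relative pseudocomplement, which makes the lattice of kernels a frame.\<close>

lemma w_ideal_residual: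
  assumes J: "w_ideal u J" and "0 \<le> u"
  shows "w_ideal u {g. \<forall>k\<in>K. inf (labs g) (labs k) \<in> J}"
proof (rule w_idealI)
  show "x + y \<in> {g. \<forall>k\<in>K. inf (labs g) (labs k) \<in> J}"
    if "x \<in> {g. \<forall>k\<in>K. inf (labs g) (labs k) \<in> J}" "y \<in> {g. \<forall>k\<in>K. inf (labs g) (labs k) \<in> J}" for x y
  proof safe
    fix k assume k: "k \<in> K"
    have "inf (labs (x + y)) (labs k) \<le> inf (labs k) (labs x + labs y)"
      using labs_add_le[of x y] by (simp add: le_infI1)
    also have "\<dots> \<le> inf (labs k) (labs x) + inf (labs k) (labs y)"
      by (simp add: inf_add_le)
    finally have "inf (labs (x + y)) (labs k) \<le> inf (labs x) (labs k) + inf (labs y) (labs k)"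
      by (simp add: inf_commute)
    moreover have "inf (labs x) (labs k) + inf (labs y) (labs k) \<in> J"
      using that k w_idealD(2)[OF J] by simp
    ultimately show "inf (labs (x + y)) (labs k) \<in> J"
      using w_ideal_le[OF J] by simp
  qed
next
  fix x y
  assume x: "x \<in> {g. \<forall>k\<in>K. inf (labs g) (labs k) \<in> J}" and y: "labs y \<le> labs x"
  show "y \<in> {g. \<forall>k\<in>K. inf (labs g) (labs k) \<in> J}"
  proof safe
    fix k assume "k \<in> K"
    then have "inf (labs x) (labs k) \<in> J" using x by simp
    then show "inf (labs y) (labs k) \<in> J"
      by (rule w_ideal_le[OF J _ _ inf_mono[OF y order_refl]]) simp
  qed
next
  fix x y :: 'a
  assume xy: "0 \<le> x" "0 \<le> y"
    and n: "\<And>n. pprt (mul (int n) x - y) \<in> {g. \<forall>k\<in>K. inf (labs g) (labs k) \<in> J}"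
  show "x \<in> {g. \<forall>k\<in>K. inf (labs g) (labs k) \<in> J}"
  proof safe
    fix k assume k: "k \<in> K"
    \<comment> \<open>The truncated element is bounded by the positive part of
      \<open>n x - y\<close> and by \<open>n\<close> times \<open>labs k\<close>, hence by
      \<open>n\<close> times the infimum of that positive part with \<open>labs k\<close>, which
      lies in \<open>J\<close> by hypothesis.\<close>
    have "pprt (mul (int n) (inf x (labs k)) - y) \<in> J" for n
    proof (rule w_ideal_le[OF J])
      show "mul (int n) (inf (pprt (mul (int n) x - y)) (labs k)) \<in> J"
        using n[of n] k by (simp add: w_ideal_mul[OF J])
      have "pprt (mul (int n) (inf x (labs k)) - y) \<le> pprt (mul (int n) x - y)"
        by (simp add: mul_mono)
      moreover have "pprt (mul (int n) (inf x (labs k)) - y) \<le> mul (int n) (labs k)"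
      proof -
        have "mul (int n) (inf x (labs k)) \<le> mul (int n) (labs k)" by (simp add: mul_mono)
        then show ?thesis using xy mul_nonneg[of "int n" "labs k"]
          by (simp add: pprt_le_iff diff_le_eq add_increasing2)
      qed
      ultimately have "pprt (mul (int n) (inf x (labs k)) - y)
          \<le> inf (pprt (mul (int n) x - y)) (mul (int n) (labs k))" by simp
      also have "\<dots> \<le> mul (int n) (inf (pprt (mul (int n) x - y)) (labs k))"
        by (rule inf_mul_le) auto
      finally show "pprt (mul (int n) (inf x (labs k)) - y)
          \<le> mul (int n) (inf (pprt (mul (int n) x - y)) (labs k))" .
    qed simp
    then show "inf (labs x) (labs k) \<in> J"
      using w_idealD(4)[OF J, of "inf x (labs k)" y] xy by simp
  qed
next
  fix g assume g: "0 \<le> g" "inf g u \<in> {g. \<forall>k\<in>K. inf (labs g) (labs k) \<in> J}"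
  show "g \<in> {g. \<forall>k\<in>K. inf (labs g) (labs k) \<in> J}"
  proof safe
    fix k assume "k \<in> K"
    then have "inf (inf g (labs k)) u \<in> J" using g assms(2) by (simp add: inf_aci)
    then show "inf (labs g) (labs k) \<in> J" using g by (simp add: w_idealD(5)[OF J])
  qed
qed (use w_idealD(1)[OF J] in \<open>simp add: inf_absorb1\<close>)

subsection \<open>Kernels of a W-object\<close>

declare diff_inf_eq_sup [simp del] diff_sup_eq_inf [simp del]

locale w_group =
  fixes u :: "'a::lattice_ab_group_add"
  assumes w_object: "w_object (lgroup_of u)"
begin

abbreviation "G \<equiv> lgroup_of u"
abbreviation "L \<equiv> madden_frame G"

lemma unit_nonneg: "0 \<le> u"
  using w_objectD(13)[OF w_object] by simp

lemma archimedean: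
  fixes x y :: 'a
  assumes "0 \<le> x" "0 \<le> y" "\<And>n. mul (int n) x \<le> y"
  shows "x = 0"
  using w_objectD(11)[OF w_object, of x y] assms by simp

lemma weak_unit: "0 \<le> g \<Longrightarrow> inf g u = 0 \<Longrightarrow> g = 0" for g :: 'a
  using w_objectD(14)[OF w_object, of g] by simp

lemma w_ideal_kernel:
  fixes H :: "'b lgroup"
  assumes H: "w_object H" and h: "w_morphism G H h"
  shows "w_ideal u (kernel G H h)"
proof -
  note HD = w_objectD[OF H]
  interpret H: comm_group H by (rule HD(1))
  interpret G: comm_group G by (rule comm_group_lgroup_of)
  have hom: "h \<in> hom G H" using h by (simp add: w_morphism_def)
  interpret gh: group_hom G H h by unfold_locales (rule hom)
  have c: "h x \<in> carrier H" for x using gh.hom_closed[of x] by simp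
  have h0: "h 0 = \<one>\<^bsub>H\<^esub>" using gh.hom_one by simp
  have hadd: "h (x + y) = h x \<otimes>\<^bsub>H\<^esub> h y" for x y using gh.hom_mult[of x y] by simp
  have hneg: "h (- x) = inv\<^bsub>H\<^esub> (h x)" for x using gh.hom_inv[of x] by (simp add: lgroup_of_inv)
  have hsup: "h (sup x y) = lsup H (h x) (h y)" for x y using h by (simp add: w_morphism_def)
  have hinf: "h (inf x y) = linf H (h x) (h y)" for x y using h by (simp add: w_morphism_def)
  have hu: "h u = wunit H" using h by (simp add: w_morphism_def)
  have hmul: "h (mul (int n) x) = h x [^]\<^bsub>H\<^esub> n" for n x
    using gh.hom_nat_pow[of x n] by simp
  have mono: "lle H (h x) (h y)" if "x \<le> y" for x y
    using HD(6)[OF c c, of x y] that hsup[of x y] by (simp add: sup_absorb2)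
  \<comment> \<open>Since \<open>x\<close> lies below \<open>pprt (x - y) + y\<close>, a killed
    positive part becomes an inequality in \<open>H\<close>. This turns the premise of the
    archimedean rule into that of the archimedean axiom.\<close>
  have pprt: "lle H (h x) (h y)" if "h (pprt (x - y)) = \<one>\<^bsub>H\<^esub>" for x y
  proof -
    have "x \<le> pprt (x - y) + y" using le_pprt[of "x - y"] by (simp only: diff_le_eq)
    from mono[OF this] show ?thesis using that c by (simp add: hadd)
  qed
  have ker: "x \<in> kernel G H h \<longleftrightarrow> h x = \<one>\<^bsub>H\<^esub>" for x by (simp add: kernel_def)
  show ?thesis
  proof (rule w_idealI, unfold ker)
    show "h (x + y) = \<one>\<^bsub>H\<^esub>" if "h x = \<one>\<^bsub>H\<^esub>" "h y = \<one>\<^bsub>H\<^esub>" for x y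
      using that by (simp add: hadd)
    show "h y = \<one>\<^bsub>H\<^esub>" if x: "h x = \<one>\<^bsub>H\<^esub>" and y: "labs y \<le> labs x" for x y
    proof -
      have "h (labs x) = \<one>\<^bsub>H\<^esub>"
        using x HD(4)[OF _ H.one_closed, of "lsup H \<one>\<^bsub>H\<^esub> \<one>\<^bsub>H\<^esub>"] HD(6)[OF H.one_closed H.one_closed]
          HD(7)[OF H.one_closed H.one_closed H.one_closed] HD(3)[OF H.one_closed]
        by (simp add: labs_def hsup hneg)
      then have "lle H (h y) \<one>\<^bsub>H\<^esub>" "lle H (h (- y)) \<one>\<^bsub>H\<^esub>"
        using mono[of y "labs x"] mono[of "- y" "labs x"] labs_ge[of y] y
        by (auto intro: order_trans)
      then have "lle H (h y) \<one>\<^bsub>H\<^esub>" "lle H \<one>\<^bsub>H\<^esub> (h y)"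
        using HD(10)[OF c H.one_closed c, of "- y" y] c by (simp_all add: hneg)
      then show ?thesis using HD(4)[OF c H.one_closed] by simp
    qed
    show "h x = \<one>\<^bsub>H\<^esub>" if "0 \<le> x" "0 \<le> y" "\<And>n. h (pprt (mul (int n) x - y)) = \<one>\<^bsub>H\<^esub>" for x y
    proof (rule HD(11)[OF c c])
      show "lle H \<one>\<^bsub>H\<^esub> (h x)" "lle H \<one>\<^bsub>H\<^esub> (h y)"
        using mono[OF that(1)] mono[OF that(2)] by (simp_all add: h0)
      show "lle H (h x [^]\<^bsub>H\<^esub> n) (h y)" for n :: nat
        using pprt[OF that(3)[of n]] by (simp add: hmul)
    qed
    show "h g = \<one>\<^bsub>H\<^esub>" if "0 \<le> g" "h (inf g u) = \<one>\<^bsub>H\<^esub>" for g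
      using HD(14)[OF c, of g] mono[OF that(1)] that(2) by (simp add: h0 hinf hu)
  qed (fact h0)
qed

text \<open>The quotient by \<open>K\<close> is realised on chosen coset representatives, hence
  inside the type of \<open>G\<close>; \<open>w_kernel_kernel\<close> then moves it to the type of
  codomains that \<open>w_kernel\<close> asks for.\<close>

lemma w_kernel_if_w_ideal:
  assumes K: "w_ideal u K"
  shows "w_kernel G K"
proof -
  \<comment> \<open>The predicate under \<open>SOME\<close> depends only on the coset of
    \<open>x\<close>, so congruent elements receive the same representative.\<close>
  define c where "c x = (SOME y. y - x \<in> K)" for x
  have cK: "c x - x \<in> K" for x
    unfolding c_def by (rule someI[of _ x]) (simp add: w_idealD(1)[OF K])
  have cI: "c x = c y" if "x - y \<in> K" for x y
  proof -
    have "z - x \<in> K \<longleftrightarrow> z - y \<in> K" for z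
      using w_idealD(2)[OF K, of "z - x" "x - y"] w_ideal_diff[OF K, of "z - y" "x - y"] that by auto
    then show ?thesis by (simp add: c_def)
  qed
  have c_iff: "c x = c y \<longleftrightarrow> x - y \<in> K" for x y
    using cI[of x y] w_ideal_diff[OF K cK[of y] cK[of x]] by auto
  have cc: "c (c x) = c x" for x by (rule cI[OF cK])
  define H :: "'a lgroup" where "H = \<lparr>carrier = range c, mult = (\<lambda>x y. c (x + y)), one = c 0,
    neg = (\<lambda>x. c (- x)), lsup = (\<lambda>x y. c (sup x y)), linf = (\<lambda>x y. c (inf x y)),
    lle = (\<lambda>x y. pprt (x - y) \<in> K), wunit = c u\<rparr>"
  have cadd: "c (c x + c y) = c (x + y)" for x y
    unfolding c_iff using w_idealD(2)[OF K cK[of x] cK[of y]] by (simp add: algebra_simps)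
  have solid: "y \<in> K" if "x \<in> K" "y \<le> labs x" "- y \<le> labs x" for x y
    by (rule w_idealD(3)[OF K that(1)]) (use that(2,3) in \<open>simp add: labs_le_iff\<close>)
  have pp: "pprt x \<in> K" if "x - y \<in> K" "pprt y \<in> K" for x y
  proof (rule w_ideal_le[OF K])
    show "labs (x - y) + pprt y \<in> K" using that K by (simp add: w_idealD(2) w_ideal_labs)
    have "x \<le> labs (x - y) + pprt y"
      using add_mono[OF labs_ge(1)[of "x - y"] le_pprt[of y]] by simp
    then show "pprt x \<le> labs (x - y) + pprt y"
      by (simp add: pprt_le_iff)
  qed simp
  have le_iff: "lle H (c x) (c y) \<longleftrightarrow> pprt (x - y) \<in> K" for x y
  proof -
    have "(c x - c y) - (x - y) \<in> K" "(x - y) - (c x - c y) \<in> K"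
      using w_ideal_diff[OF K cK[of x] cK[of y]] w_ideal_diff[OF K cK[of y] cK[of x]]
      by (simp_all add: algebra_simps)
    then show ?thesis using pp by (auto simp: H_def)
  qed
  have le_c: "lle H (c x) (c y)" if "x \<le> y" for x y
    using that w_idealD(1)[OF K] by (simp add: le_iff)
  have le_E: "\<exists>k\<in>K. 0 \<le> k \<and> x \<le> y + k" if "lle H (c x) (c y)" for x y
    using that le_pprt[of "x - y"] by (auto simp: le_iff algebra_simps intro!: bexI[of _ "pprt (x - y)"])
  have le_I: "lle H (c x) (c y)" if "k \<in> K" "0 \<le> k" "x \<le> y + k" for x y k
    unfolding le_iff
    by (rule w_ideal_le[OF K that(1)]) (use that in \<open>simp_all add: pprt_le_iff algebra_simps\<close>)
  have csup: "c (sup (c x) (c y)) = c (sup x y)" for x y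
    unfolding c_iff
  proof (rule w_idealD(3)[OF K])
    show k: "labs (c x - x) + labs (c y - y) \<in> K"
      using K cK by (simp add: w_idealD(2) w_ideal_labs)
    \<comment> \<open>The supremum is nonexpansive for the absolute value, which makes it compatible
      with congruence modulo \<open>K\<close>.\<close>
    have le: "sup a b - sup a' b' \<le> labs (a - a') + labs (b - b')" for a b a' b'
    proof -
      have "a \<le> a' + labs (a - a')" "b \<le> b' + labs (b - b')"
        using labs_ge(1)[of "a - a'"] labs_ge(1)[of "b - b'"] by (simp_all add: algebra_simps)
      moreover have "a' + labs (a - a') \<le> sup a' b' + (labs (a - a') + labs (b - b'))"
        by (intro add_mono) (simp_all add: add_increasing2)
      moreover have "b' + labs (b - b') \<le> sup a' b' + (labs (a - a') + labs (b - b'))"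
        by (intro add_mono) (simp_all add: add_increasing)
      ultimately have "sup a b \<le> sup a' b' + (labs (a - a') + labs (b - b'))"
        by (meson order_trans le_supI)
      then show ?thesis by (simp only: diff_le_eq add.commute)
    qed
    have "labs (sup (c x) (c y) - sup x y) \<le> labs (c x - x) + labs (c y - y)"
      using le[of "c x" "c y" x y] le[of x y "c x" "c y"] labs_minus[of "c x - x"] labs_minus[of "c y - y"]
      by (simp only: labs_le_iff minus_diff_eq simp_thms)
    then show "labs (sup (c x) (c y) - sup x y) \<le> labs (labs (c x - x) + labs (c y - y))"
      using labs_ge(1) order_trans by blast
  qed
  \<comment> \<open>The infimum inherits compatibility from the supremum through the identity
    \<open>a + b - sup a b = inf a b\<close>.\<close>
  have cinf: "c (inf (c x) (c y)) = c (inf x y)" for x y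
  proof -
    have "(a + b - e) - (a' + b' - e') = ((a - a') + (b - b')) - (e - e')" for a b e a' b' e' :: 'a
      by (simp add: algebra_simps)
    from this[of "c x" "c y" "sup (c x) (c y)" x y "sup x y"]
    have "(c x + c y - sup (c x) (c y)) - (x + y - sup x y) \<in> K"
      using w_ideal_diff[OF K w_idealD(2)[OF K cK[of x] cK[of y]], of "sup (c x) (c y) - sup x y"] csup[of x y]
      by (simp only: c_iff)
    moreover have "a + b - sup a b = inf a b" for a b :: 'a
      using add_eq_inf_sup[of a b] by (simp only: add_diff_cancel_left')
    ultimately show ?thesis by (simp only: c_iff)
  qed
  have Hs: "carrier H = range c" "c x \<otimes>\<^bsub>H\<^esub> c y = c (x + y)" "\<one>\<^bsub>H\<^esub> = c 0" "neg H (c x) = c (- x)"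
    "lsup H (c x) (c y) = c (sup x y)" "linf H (c x) (c y) = c (inf x y)" "wunit H = c u" for x y
    by (simp_all add: H_def cadd csup cinf)
      (simp add: c_iff, use w_ideal_minus[OF K cK[of x]] in simp)
  have "comm_group H"
  proof (rule comm_groupI)
    fix x y z assume "x \<in> carrier H" "y \<in> carrier H" "z \<in> carrier H"
    then obtain a b d where [simp]: "x = c a" "y = c b" "z = c d" by (auto simp: Hs)
    show "x \<otimes>\<^bsub>H\<^esub> y \<in> carrier H" "x \<otimes>\<^bsub>H\<^esub> y \<otimes>\<^bsub>H\<^esub> z = x \<otimes>\<^bsub>H\<^esub> (y \<otimes>\<^bsub>H\<^esub> z)"
      "x \<otimes>\<^bsub>H\<^esub> y = y \<otimes>\<^bsub>H\<^esub> x" "\<one>\<^bsub>H\<^esub> \<otimes>\<^bsub>H\<^esub> x = x"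
      by (simp_all add: Hs ac_simps)
    show "\<exists>y\<in>carrier H. y \<otimes>\<^bsub>H\<^esub> x = \<one>\<^bsub>H\<^esub>"
      by (rule bexI[of _ "c (- a)"]) (simp_all add: Hs)
  qed (auto simp: Hs)
  interpret H: comm_group H by fact
  have Hpow: "c x [^]\<^bsub>H\<^esub> n = c (mul (int n) x)" for x and n :: nat
    by (induction n) (simp_all add: Hs algebra_simps)
  have "w_object H"
  proof (rule w_objectI[OF \<open>comm_group H\<close>], unfold Hs(1))
    fix x assume "x \<in> range c"
    then obtain a where [simp]: "x = c a" by auto
    show "neg H x = inv\<^bsub>H\<^esub> x"
      by (rule H.inv_equality[symmetric]) (simp_all add: Hs)
    show "lle H x x" using le_c by simp
    show "x = \<one>\<^bsub>H\<^esub>" if le: "lle H \<one>\<^bsub>H\<^esub> x" "linf H x (wunit H) = \<one>\<^bsub>H\<^esub>"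
    proof -
      \<comment> \<open>Positivity of the coset of \<open>a\<close> only says that \<open>a\<close>
        is nonnegative up to an element of \<open>K\<close>; the congruent element
        \<open>a + k\<close> is truly nonnegative, as the ideal rule requires.\<close>
      obtain k where k: "k \<in> K" "0 \<le> k" "0 \<le> a + k" using le_E[of 0 a] le(1) by (auto simp: Hs)
      have "c (inf a u) = c 0" using that(2) by (simp add: Hs)
      moreover have "c (inf (a + k) u) = c (inf a u)"
        using k(1) cinf[of a u] cinf[of "a + k" u] cI[of "a + k" a] by simp
      ultimately have "c (inf (a + k) u) = c 0" by simp
      then have "inf (a + k) u \<in> K" by (simp add: c_iff)
      then have "a + k \<in> K" using w_idealD(5)[OF K k(3)] by simp
      then show ?thesis using w_ideal_diff[OF K _ k(1), of "a + k"] by (simp add: Hs c_iff)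
    qed
    fix y assume "y \<in> range c"
    then obtain b where [simp]: "y = c b" by auto
    show "x = y" if le: "lle H x y" "lle H y x"
    proof -
      have "pprt (a - b) \<in> K" "pprt (- (a - b)) \<in> K" using that by (simp_all add: le_iff)
      then have "a - b \<in> K" using w_ideal_diff[OF K] pprt_minus_pprt[of "a - b"] by metis
      then show ?thesis by (simp add: c_iff)
    qed
    show "lsup H x y \<in> range c \<and> lle H x (lsup H x y) \<and> lle H y (lsup H x y)"
      by (simp add: Hs le_c)
    show "linf H x y \<in> range c \<and> lle H (linf H x y) x \<and> lle H (linf H x y) y"
      by (simp add: Hs le_c)
    show "x = \<one>\<^bsub>H\<^esub>" if le: "lle H \<one>\<^bsub>H\<^esub> x" "lle H \<one>\<^bsub>H\<^esub> y" "\<And>n::nat. lle H (x [^]\<^bsub>H\<^esub> n) y"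
    proof -
      obtain k where k: "k \<in> K" "0 \<le> k" "0 \<le> a + k" using le_E[of 0 a] le(1) by (auto simp: Hs)
      obtain l where l: "l \<in> K" "0 \<le> l" "0 \<le> b + l" using le_E[of 0 b] le(2) by (auto simp: Hs)
      have "pprt (mul (int n) (a + k) - (b + l)) \<in> K" for n
      proof (rule pp)
        show "(mul (int n) (a + k) - (b + l)) - (mul (int n) a - b) \<in> K"
          using w_ideal_diff[OF K w_ideal_mul[OF K k(1), of n] l(1)] by (simp add: algebra_simps)
        show "pprt (mul (int n) a - b) \<in> K"
          using that(3)[of n] by (simp add: Hpow le_iff)
      qed
      then have "a + k \<in> K" using w_idealD(4)[OF K k(3) l(3)] by simp
      then show ?thesis using w_ideal_diff[OF K _ k(1), of "a + k"] by (simp add: Hs c_iff)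
    qed
    fix z assume "z \<in> range c"
    then obtain d where [simp]: "z = c d" by auto
    show "lle H x z" if le: "lle H x y" "lle H y z"
    proof -
      obtain k where k: "k \<in> K" "0 \<le> k" "a \<le> b + k" using le_E[of a b] le(1) by auto
      obtain l where l: "l \<in> K" "0 \<le> l" "b \<le> d + l" using le_E[of b d] le(2) by auto
      have "a \<le> d + (l + k)"
        using order_trans[OF k(3) add_right_mono[OF l(3), of k]] by (simp add: add.assoc)
      then show ?thesis using le_I[of "l + k" a d] k l w_idealD(2)[OF K] by simp
    qed
    show "lle H (x \<otimes>\<^bsub>H\<^esub> z) (y \<otimes>\<^bsub>H\<^esub> z)" if le: "lle H x y"
      using that by (simp add: Hs le_iff)
    show "lle H (lsup H x y) z" if le: "lle H x z" "lle H y z"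
    proof -
      obtain k where k: "k \<in> K" "0 \<le> k" "a \<le> d + k" using le_E[of a d] le(1) by auto
      obtain l where l: "l \<in> K" "0 \<le> l" "b \<le> d + l" using le_E[of b d] le(2) by auto
      have "sup a b \<le> d + (k + l)"
        using order_trans[OF k(3), of "d + (k + l)"] order_trans[OF l(3), of "d + (k + l)"] k l by simp
      then show ?thesis using le_I[of "k + l" "sup a b" d] k l w_idealD(2)[OF K] by (simp add: Hs)
    qed
    show "lle H z (linf H x y)" if le: "lle H z x" "lle H z y"
    proof -
      obtain k where k: "k \<in> K" "0 \<le> k" "d \<le> a + k" using le_E[of d a] le(1) by auto
      obtain l where l: "l \<in> K" "0 \<le> l" "d \<le> b + l" using le_E[of d b] le(2) by auto
      have "d \<le> inf a b + (k + l)"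
        using order_trans[OF k(3), of "a + (k + l)"] order_trans[OF l(3), of "b + (k + l)"] k l
        by (simp add: add_inf_distrib_right)
      then show ?thesis using le_I[of "k + l" d "inf a b"] k l w_idealD(2)[OF K] by (simp add: Hs)
    qed
  next
    show "wunit H \<in> range c" "lle H \<one>\<^bsub>H\<^esub> (wunit H)"
      using le_c[OF unit_nonneg] by (simp_all add: Hs)
  qed
  moreover have "w_morphism G H c"
    by (auto simp: w_morphism_def hom_def Hs)
  moreover have "kernel G H c = K"
    by (auto simp: kernel_def Hs c_iff)
  ultimately show ?thesis using w_kernel_kernel[OF w_object] by blast
qed

lemma w_kernel_iff: "w_kernel G K \<longleftrightarrow> w_ideal u K"
  using w_kernel_if_w_ideal w_ideal_kernel unfolding w_kernel_def by blast

subsection \<open>The frame of kernels\<close>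

abbreviation "kg S \<equiv> kernel_gen G S"

lemma w_ideal_kg [simp]: "w_ideal u (kg S)"
  unfolding hull_def by (rule w_ideal_Inter) (simp add: w_kernel_iff)

lemma kg_least: "S \<subseteq> K \<Longrightarrow> w_ideal u K \<Longrightarrow> kg S \<subseteq> K"
  by (rule hull_minimal) (simp_all add: w_kernel_iff)

lemma kg_same: "w_ideal u K \<Longrightarrow> kg K = K"
  by (rule hull_same) (simp add: w_kernel_iff)

lemma kg_le_kg: "S \<subseteq> kg T \<Longrightarrow> kg S \<subseteq> kg T"
  by (rule kg_least) simp_all

text \<open>For the zero ideal the two closure rules are the archimedean property and the weakness
  of the unit of \<open>G\<close> itself.\<close>

lemma w_ideal_zero: "w_ideal u {0}"
proof (rule w_idealI)
  show "x \<in> {0}" if "0 \<le> x" "0 \<le> y" "\<And>n. pprt (mul (int n) x - y) \<in> {0}" for x y :: 'a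
  proof -
    have "mul (int n) x \<le> y" for n
      using that(3)[of n] by (simp flip: le_zero_iff_zero_pprt)
    then show ?thesis using archimedean[OF that(1,2)] by simp
  qed
  show "y \<in> {0}" if "x \<in> {0}" "labs y \<le> labs x" for x y :: 'a
  proof -
    have "labs y = 0" using that labs_nonneg[of y] by (intro order_antisym) simp_all
    then show ?thesis by simp
  qed
qed (use weak_unit in auto)

lemma kg_eq_UNIV: "u \<in> kg S \<Longrightarrow> kg S = UNIV"
  by (rule w_ideal_unit[OF w_ideal_kg _ unit_nonneg])

text \<open>This is frame distributivity. Every \<open>X\<close> in \<open>F\<close> lies in the
  residual of \<open>K\<close> into \<open>J\<close>, and as the residual is an ideal it absorbs the
  generated kernel too. An element \<open>g\<close> of both sides then has
  \<open>inf (labs g) (labs g)\<close> in \<open>J\<close>.\<close>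

lemma Int_kg_subset:
  assumes K: "w_ideal u K" and F: "\<And>X. X \<in> F \<Longrightarrow> w_ideal u X" and J: "w_ideal u J"
    and sub: "\<And>X. X \<in> F \<Longrightarrow> K \<inter> X \<subseteq> J"
  shows "K \<inter> kg (\<Union>F) \<subseteq> J"
proof
  fix g assume g: "g \<in> K \<inter> kg (\<Union>F)"
  let ?R = "{g. \<forall>k\<in>K. inf (labs g) (labs k) \<in> J}"
  have "\<Union>F \<subseteq> ?R"
  proof (intro subsetI CollectI ballI)
    fix x k assume "x \<in> \<Union>F" and k: "k \<in> K"
    then obtain X where X: "X \<in> F" "x \<in> X" by auto
    have "inf (labs x) (labs k) \<in> X"
      by (rule w_ideal_le[OF F[OF X(1)], of "labs x"]) (simp_all add: w_ideal_labs[OF F[OF X(1)]] X)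
    moreover have "inf (labs x) (labs k) \<in> K"
      by (rule w_ideal_le[OF K, of "labs k"]) (simp_all add: w_ideal_labs[OF K] k)
    ultimately show "inf (labs x) (labs k) \<in> J" using sub[OF X(1)] by blast
  qed
  then have "kg (\<Union>F) \<subseteq> ?R"
    by (rule kg_least) (rule w_ideal_residual[OF J unit_nonneg])
  then have "inf (labs g) (labs g) \<in> J" using g by blast
  then show "g \<in> J" by (simp add: w_ideal_labs[OF J])
qed

lemma Int_kg_Un_subset:
  assumes "w_ideal u K" "w_ideal u X" "w_ideal u Y" "w_ideal u J" "K \<inter> X \<subseteq> J" "K \<inter> Y \<subseteq> J"
  shows "K \<inter> kg (X \<union> Y) \<subseteq> J"
  using Int_kg_subset[of K "{X, Y}" J] assms by auto

lemma kg_Int_kg_subset: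
  assumes "\<And>X. X \<in> F \<Longrightarrow> w_ideal u X" "\<And>Y. Y \<in> F' \<Longrightarrow> w_ideal u Y" "w_ideal u J"
    and "\<And>X Y. X \<in> F \<Longrightarrow> Y \<in> F' \<Longrightarrow> X \<inter> Y \<subseteq> J"
  shows "kg (\<Union>F) \<inter> kg (\<Union>F') \<subseteq> J"
proof (rule Int_kg_subset)
  fix Y assume Y: "Y \<in> F'"
  have "Y \<inter> kg (\<Union>F) \<subseteq> J"
    using assms Y by (intro Int_kg_subset) (simp_all add: Int_commute)
  then show "kg (\<Union>F) \<inter> Y \<subseteq> J" by (simp add: Int_commute)
qed (use assms in auto)

text \<open>The inclusion from right to left residuates twice into the kernel of
  \<open>inf a b\<close>: first against the single element \<open>b\<close>, then against the whole
  kernel of \<open>a\<close>.\<close>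

lemma kg_inf:
  assumes "0 \<le> a" "0 \<le> b"
  shows "kg {inf a b} = kg {a} \<inter> kg {b}"
proof
  have "a \<in> kg {a}" "b \<in> kg {b}" by (simp_all add: hull_inc)
  then have "inf a b \<in> kg {a}" "inf a b \<in> kg {b}"
    using w_ideal_le[OF w_ideal_kg, of a "{a}" "inf a b"] w_ideal_le[OF w_ideal_kg, of b "{b}" "inf a b"] assms by auto
  then show "kg {inf a b} \<subseteq> kg {a} \<inter> kg {b}"
    by (intro Int_greatest kg_least) simp_all
  let ?J = "kg {inf a b}"
  have J: "inf a b \<in> ?J" by (simp add: hull_inc)
  have "kg {a} \<subseteq> {g. \<forall>k\<in>{b}. inf (labs g) (labs k) \<in> ?J}"
    using assms J by (intro kg_least w_ideal_residual[OF w_ideal_kg unit_nonneg]) simp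
  then have "kg {b} \<subseteq> {g. \<forall>k\<in>kg {a}. inf (labs g) (labs k) \<in> ?J}"
    using assms by (intro kg_least w_ideal_residual[OF w_ideal_kg unit_nonneg]) (auto simp: inf_commute)
  then have "inf (labs g) (labs g) \<in> ?J" if "g \<in> kg {a}" "g \<in> kg {b}" for g
    using that by blast
  then show "kg {a} \<inter> kg {b} \<subseteq> ?J"
    by (auto simp: w_ideal_labs[OF w_ideal_kg])
qed

text \<open>The polar of \<open>K\<close>, that is, its residual into the zero ideal; for an ideal
  it is the pseudocomplement in the frame.\<close>

definition pcomp :: "'a set \<Rightarrow> 'a set" where
  "pcomp K = {g. \<forall>k\<in>K. inf (labs g) (labs k) = 0}"

lemma w_ideal_pcomp [simp]: "w_ideal u (pcomp K)"
  using w_ideal_residual[OF w_ideal_zero unit_nonneg, of K] by (simp add: pcomp_def)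

lemma pcomp_antimono: "K \<subseteq> K' \<Longrightarrow> pcomp K' \<subseteq> pcomp K"
  by (auto simp: pcomp_def)

lemma Int_pcomp: "w_ideal u K \<Longrightarrow> K \<inter> pcomp K = {0}"
proof -
  assume K: "w_ideal u K"
  have "x = 0" if "x \<in> K" "x \<in> pcomp K" for x
  proof -
    have "inf (labs x) (labs x) = 0" using that unfolding pcomp_def by blast
    then show ?thesis by simp
  qed
  then show ?thesis using w_idealD(1)[OF K] w_idealD(1)[OF w_ideal_pcomp[of K]] by blast
qed

lemma subset_pcomp_iff:
  assumes "w_ideal u K" "w_ideal u K'"
  shows "K \<subseteq> pcomp K' \<longleftrightarrow> K \<inter> K' = {0}"
proof
  assume "K \<subseteq> pcomp K'"
  then have "K \<inter> K' \<subseteq> K' \<inter> pcomp K'" by auto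
  then have "K \<inter> K' \<subseteq> {0}" by (simp only: Int_pcomp[OF assms(2)])
  then show "K \<inter> K' = {0}"
    using w_idealD(1)[OF assms(1)] w_idealD(1)[OF assms(2)] by (intro equalityI) simp_all
next
  assume *: "K \<inter> K' = {0}"
  show "K \<subseteq> pcomp K'"
    unfolding pcomp_def
  proof (intro subsetI CollectI ballI)
    fix x k assume "x \<in> K" "k \<in> K'"
    then have "inf (labs x) (labs k) \<in> K" "inf (labs x) (labs k) \<in> K'"
      using w_ideal_le[OF assms(1), of "labs x" "inf (labs x) (labs k)"]
        w_ideal_le[OF assms(2), of "labs k" "inf (labs x) (labs k)"]
      by (simp_all add: w_ideal_labs[OF assms(1)] w_ideal_labs[OF assms(2)])
    then have "inf (labs x) (labs k) \<in> K \<inter> K'" by (rule IntI)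
    then show "inf (labs x) (labs k) = 0" by (simp only: * singleton_iff)
  qed
qed

lemma kg_subset_pcomp:
  assumes "0 \<le> a" "0 \<le> b" "inf a b = 0"
  shows "kg {a} \<subseteq> pcomp (kg {b})"
  using kg_inf[of a b] assms kg_same[OF w_ideal_zero] by (simp add: subset_pcomp_iff)

section \<open>Frame operations as set operations\<close>

lemma carrier_L: "carrier L = {K. w_ideal u K}"
  by (simp add: madden_frame_def w_kernel_iff)

lemma le_L [simp]: "K \<sqsubseteq>\<^bsub>L\<^esub> K' \<longleftrightarrow> K \<subseteq> K'"
  by (simp add: madden_frame_def)

lemma least_L_unique: "least L a S \<Longrightarrow> (SOME x. least L x S) = a"
  by (rule some_equality) (auto simp: least_def)

lemma greatest_L_unique: "greatest L a S \<Longrightarrow> (SOME x. greatest L x S) = a"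
  by (rule some_equality) (auto simp: greatest_def)

lemma Sup_L:
  assumes "\<And>X. X \<in> F \<Longrightarrow> w_ideal u X"
  shows "\<Squnion>\<^bsub>L\<^esub> F = kg (\<Union>F)"
proof -
  have "Upper L F = {K. \<Union>F \<subseteq> K \<and> w_ideal u K}"
    using assms by (auto simp: Upper_def carrier_L)
  moreover have "least L (kg (\<Union>F)) {K. \<Union>F \<subseteq> K \<and> w_ideal u K}"
    by (simp add: least_def carrier_L hull_subset kg_least Collect_mono_iff)
  ultimately show ?thesis
    unfolding Lattice.sup_def by (simp add: least_L_unique)
qed

lemma join_L: "w_ideal u X \<Longrightarrow> w_ideal u Y \<Longrightarrow> X \<squnion>\<^bsub>L\<^esub> Y = kg (X \<union> Y)"
  using Sup_L[of "{X, Y}"] by (auto simp: join_def)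

lemma meet_L: "w_ideal u X \<Longrightarrow> w_ideal u Y \<Longrightarrow> X \<sqinter>\<^bsub>L\<^esub> Y = X \<inter> Y"
  unfolding meet_def Lattice.inf_def
  using w_ideal_Inter[of "{X, Y}" u]
  by (intro greatest_L_unique) (auto simp: greatest_def Lower_def carrier_L)

lemma top_L: "\<top>\<^bsub>L\<^esub> = UNIV"
proof -
  have "greatest L UNIV (carrier L)"
    by (simp add: greatest_def carrier_L w_ideal_UNIV)
  then show ?thesis
    unfolding Order.top_def by (simp add: greatest_L_unique)
qed

lemma bot_L: "\<bottom>\<^bsub>L\<^esub> = {0}"
proof -
  have "least L {0} (carrier L)"
    by (simp add: least_def carrier_L w_ideal_zero w_idealD(1))
  then show ?thesis
    unfolding Order.bottom_def by (simp add: least_L_unique)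
qed

text \<open>Any complement lies below the pseudocomplement, so only the latter has to be tested for
  covering.\<close>

lemma complemented_iff:
  assumes "w_ideal u K"
  shows "complemented L K \<longleftrightarrow> kg (K \<union> pcomp K) = UNIV"
proof
  assume "complemented L K"
  then obtain K' where K': "w_ideal u K'" "K \<inter> K' = {0}" "kg (K \<union> K') = UNIV"
    using assms by (auto simp: complemented_def carrier_L meet_L join_L top_L bot_L)
  then have "K' \<subseteq> pcomp K" using assms by (auto simp: subset_pcomp_iff)
  then have "kg (K \<union> K') \<subseteq> kg (K \<union> pcomp K)" by (intro hull_mono) auto
  then show "kg (K \<union> pcomp K) = UNIV" using K' by auto
next
  assume "kg (K \<union> pcomp K) = UNIV"
  then show "complemented L K"
    using assms Int_pcomp[OF assms] unfolding complemented_def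
    by (intro bexI[of _ "pcomp K"]) (simp_all add: carrier_L meet_L join_L top_L bot_L)
qed

text \<open>The frame of kernels is Lindelof.\<close>

lemma kg_countable:
  assumes "x \<in> kg S"
  obtains C where "countable C" "C \<subseteq> S" "x \<in> kg C"
proof -
  let ?K = "{x. \<exists>C. countable C \<and> C \<subseteq> S \<and> x \<in> kg C}"
  have "w_ideal u ?K"
  proof (rule w_idealI)
    show "0 \<in> ?K"
      using w_idealD(1)[OF w_ideal_kg] by blast
    show "x + y \<in> ?K" if xy: "x \<in> ?K" "y \<in> ?K" for x y
    proof -
      obtain C D where C: "countable C" "C \<subseteq> S" "x \<in> kg C" and D: "countable D" "D \<subseteq> S" "y \<in> kg D"
        using xy by blast
      have "kg C \<subseteq> kg (C \<union> D)" "kg D \<subseteq> kg (C \<union> D)" by (simp_all add: hull_mono)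
      then have "x + y \<in> kg (C \<union> D)" using C D by (intro w_idealD(2)[OF w_ideal_kg]) auto
      then show ?thesis using C D by (intro CollectI exI[of _ "C \<union> D"]) simp
    qed
    show "y \<in> ?K" if "x \<in> ?K" "labs y \<le> labs x" for x y
      using that w_idealD(3)[OF w_ideal_kg, of x _ y] by blast
    show "x \<in> ?K" if "0 \<le> x" "0 \<le> y" "\<And>n. pprt (mul (int n) x - y) \<in> ?K" for x y
    proof -
      have "\<forall>n. \<exists>C. countable C \<and> C \<subseteq> S \<and> pprt (mul (int n) x - y) \<in> kg C"
        using that(3) by simp
      then obtain C where C: "\<And>n. countable (C n) \<and> C n \<subseteq> S \<and> pprt (mul (int n) x - y) \<in> kg (C n)"
        by metis
      have "kg (C n) \<subseteq> kg (\<Union>n. C n)" for n by (rule hull_mono) auto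
      then have "x \<in> kg (\<Union>n. C n)"
        using C by (intro w_idealD(4)[OF w_ideal_kg that(1,2)]) blast
      moreover have "countable (\<Union>n. C n)" "(\<Union>n. C n) \<subseteq> S" using C by auto
      ultimately show ?thesis by blast
    qed
    show "g \<in> ?K" if "0 \<le> g" "inf g u \<in> ?K" for g
      using that w_idealD(5)[OF w_ideal_kg that(1)] by blast
  qed
  moreover have "S \<subseteq> ?K"
  proof
    fix x assume "x \<in> S"
    then show "x \<in> ?K" by (intro CollectI exI[of _ "{x}"]) (simp add: hull_inc)
  qed
  ultimately have "kg S \<subseteq> ?K" by (intro kg_least)
  then show ?thesis using assms that by blast
qed

subsection \<open>Frame maps on the reals\<close>

lemma frame_maps_iff:
  "f \<in> frame_maps L \<longleftrightarrow>
     f \<in> extensional {U. open U} \<and> (\<forall>U. open U \<longrightarrow> w_ideal u (f U)) \<and> f UNIV = UNIV \<and>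
     (\<forall>U V. open U \<and> open V \<longrightarrow> f (U \<inter> V) = f U \<inter> f V) \<and>
     (\<forall>\<U>. (\<forall>U\<in>\<U>. open U) \<longrightarrow> f (\<Union>\<U>) = kg (\<Union>(f ` \<U>)))" (is "_ \<longleftrightarrow> ?R")
proof -
  have funcset: "f \<in> {U. open U} \<rightarrow>\<^sub>E carrier L \<longleftrightarrow>
      f \<in> extensional {U. open U} \<and> (\<forall>U. open U \<longrightarrow> w_ideal u (f U))"
    by (auto simp: PiE_def carrier_L)
  show ?thesis
  proof (cases "\<forall>U. open U \<longrightarrow> w_ideal u (f U)")
    case True
    have "\<Squnion>\<^bsub>L\<^esub> (f ` \<U>) = kg (\<Union>(f ` \<U>))" if "\<forall>U\<in>\<U>. open U" for \<U>
      using that True by (intro Sup_L) auto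
    then show ?thesis
      using True by (simp add: frame_maps_def funcset meet_L top_L cong: conj_cong imp_cong)
  next
    case False
    then show ?thesis by (simp only: frame_maps_def mem_Collect_eq funcset) blast
  qed
qed

lemma frame_mapsD:
  assumes "f \<in> frame_maps L"
  shows "f \<in> extensional {U. open U}"
    and "\<And>U. open U \<Longrightarrow> w_ideal u (f U)"
    and "f UNIV = UNIV"
    and "\<And>U V. open U \<Longrightarrow> open V \<Longrightarrow> f (U \<inter> V) = f U \<inter> f V"
    and "\<And>\<U>. (\<And>U. U \<in> \<U> \<Longrightarrow> open U) \<Longrightarrow> f (\<Union>\<U>) = kg (\<Union>(f ` \<U>))"
  using assms by (auto simp: frame_maps_iff)

lemma frame_map_mono:
  assumes f: "f \<in> frame_maps L" and "open U" "open V" "U \<subseteq> V"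
  shows "f U \<subseteq> f V"
  using frame_mapsD(4)[OF f assms(2,3)] assms(4) by (simp add: Int_absorb2 le_iff_inf)

lemma frame_map_UN:
  assumes f: "f \<in> frame_maps L" and "\<And>i. i \<in> I \<Longrightarrow> open (U i)"
  shows "f (\<Union>i\<in>I. U i) = kg (\<Union>i\<in>I. f (U i))"
  using frame_mapsD(5)[OF f, of "U ` I"] assms(2) by (auto simp: image_image)

lemma frame_map_Un:
  assumes f: "f \<in> frame_maps L" and "open U" "open V"
  shows "f (U \<union> V) = kg (f U \<union> f V)"
  using frame_mapsD(5)[OF f, of "{U, V}"] assms(2,3) by auto

lemma frame_map_empty: "f \<in> frame_maps L \<Longrightarrow> f {} = {0}"
  using frame_mapsD(5)[of f "{}"] kg_least[OF _ w_ideal_zero, of "{}"] w_idealD(1)[OF w_ideal_kg, of "{}"]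
  by auto

lemma frame_map_disjoint:
  assumes "f \<in> frame_maps L" "open U" "open V" "U \<inter> V = {}"
  shows "f U \<inter> f V = {0}"
  using frame_mapsD(4)[OF assms(1-3)] frame_map_empty[OF assms(1)] assms(4) by simp

lemma frame_map_cover:
  assumes "f \<in> frame_maps L" "open U" "open V" "U \<union> V = UNIV"
  shows "kg (f U \<union> f V) = UNIV"
  using frame_map_Un[OF assms(1-3)] frame_mapsD(3)[OF assms(1)] assms(4) by simp

text \<open>By distributivity \<open>K\<close> is the join of its parts below \<open>X\<close> and
  below \<open>Y\<close>; this replaces case distinctions at points.\<close>

lemma subset_if_cover:
  assumes "w_ideal u K" "w_ideal u X" "w_ideal u Y" "w_ideal u J" "kg (X \<union> Y) = UNIV" "K \<inter> X \<subseteq> J" "K \<inter> Y \<subseteq> J"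
  shows "K \<subseteq> J"
  using Int_kg_Un_subset[OF assms(1,2,3,4,6,7)] assms(5) by simp

lemma frame_map_pcomp:
  assumes f: "f \<in> frame_maps L" and "open U" "open V" "U \<union> V = UNIV"
  shows "pcomp (f U) \<subseteq> f V"
proof (rule subset_if_cover[OF _ _ _ _ frame_map_cover[OF assms]])
  show "pcomp (f U) \<inter> f U \<subseteq> f V"
    using Int_pcomp[OF frame_mapsD(2)[OF f assms(2)]] w_idealD(1)[OF frame_mapsD(2)[OF f assms(3)]]
    by (simp add: Int_commute)
qed (use assms frame_mapsD(2)[OF f] in auto)

lemma frame_map_subset_pcomp:
  assumes f: "f \<in> frame_maps L" and "open U" "open V" "U \<inter> V = {}"
  shows "f U \<subseteq> pcomp (f V)"
  using frame_map_disjoint[OF assms] frame_mapsD(2)[OF f] assms by (simp add: subset_pcomp_iff)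

lemma frame_map_ray:
  assumes f: "f \<in> frame_maps L"
  shows "f {r<..} = kg (\<Union>s\<in>{r<..}. f {s<..})"
proof -
  have "{r<..} = (\<Union>s\<in>{r<..}. {s<..})"
    using dense by (auto simp: Bex_def)
  then show ?thesis using frame_map_UN[OF f, of "{r<..}" "\<lambda>s. {s<..}"] by simp
qed

text \<open>Pseudocomplements of upper rays interleave with lower rays:
  \<open>f {..<r} \<subseteq> pcomp (f {r<..}) \<subseteq> f {..<s}\<close> for
  \<open>r < s\<close>. A single pseudocomplement need not be a lower ray, whence the join.\<close>

lemma frame_map_lower_ray:
  assumes f: "f \<in> frame_maps L"
  shows "f {..<s} = kg (\<Union>r\<in>{..<s}. pcomp (f {r<..}))"
proof
  have "{..<s} = (\<Union>r\<in>{..<s}. {..<r})"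
    using dense by (auto simp: Bex_def)
  then have "f {..<s} = kg (\<Union>r\<in>{..<s}. f {..<r})"
    using frame_map_UN[OF f, of "{..<s}" "\<lambda>r. {..<r}"] by simp
  also have "\<dots> \<subseteq> kg (\<Union>r\<in>{..<s}. pcomp (f {r<..}))"
    by (intro hull_mono UN_mono frame_map_subset_pcomp f) auto
  finally show "f {..<s} \<subseteq> kg (\<Union>r\<in>{..<s}. pcomp (f {r<..}))" .
  show "kg (\<Union>r\<in>{..<s}. pcomp (f {r<..})) \<subseteq> f {..<s}"
    by (intro kg_least UN_least frame_map_pcomp[OF f] frame_mapsD(2)[OF f]) auto
qed

text \<open>By \<open>frame_map_lower_ray\<close> the upper rays fix the lower rays; meets of the
  two fix the values on bounded open intervals, and these intervals generate every open set.\<close>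

lemma frame_map_eqI:
  assumes f: "f \<in> frame_maps L" and g: "g \<in> frame_maps L"
    and eq: "\<And>r. f {r<..} = g {r<..}"
  shows "f = g"
proof (rule extensionalityI[OF frame_mapsD(1)[OF f] frame_mapsD(1)[OF g]])
  fix U :: "real set" assume "U \<in> {U. open U}"
  then have U: "open U" by simp
  have int: "f {r<..<s} = g {r<..<s}" for r s
    using frame_mapsD(4)[OF f, of "{r<..}" "{..<s}"] frame_mapsD(4)[OF g, of "{r<..}" "{..<s}"]
    by (simp add: eq frame_map_lower_ray[OF f] frame_map_lower_ray[OF g] greaterThanLessThan_eq)
  have "U = (\<Union>i\<in>{(r, s). {r<..<s} \<subseteq> U}. {fst i<..<snd i})"
  proof (intro equalityI subsetI)
    fix x assume "x \<in> U"
    then obtain e where e: "0 < e" "\<And>y. dist y x < e \<Longrightarrow> y \<in> U"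
      using U by (meson open_dist)
    have "{x - e<..<x + e} \<subseteq> U"
      by (auto intro!: e(2) simp: dist_real_def abs_less_iff)
    then show "x \<in> (\<Union>i\<in>{(r, s). {r<..<s} \<subseteq> U}. {fst i<..<snd i})"
      using e(1) by (intro UN_I[of "(x - e, x + e)"]) auto
  qed auto
  then show "f U = g U"
    using frame_map_UN[OF f, of "{(r, s). {r<..<s} \<subseteq> U}" "\<lambda>i. {fst i<..<snd i}"]
      frame_map_UN[OF g, of "{(r, s). {r<..<s} \<subseteq> U}" "\<lambda>i. {fst i<..<snd i}"]
    by (simp add: int)
qed

text \<open>
  The lower ray at \<open>s\<close> is the join \<open>B s\<close> of the pseudocomplements of the upper rays at \<open>r < s\<close>, and
  \<open>f U\<close> is the join of the \<open>A r \<and> B s\<close> with \<open>[r, s] \<subseteq> U\<close>; compactness of \<open>[r, s]\<close> makes \<open>f\<close> preserve joins.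
\<close>

lemma frame_map_exists:
  fixes A :: "real \<Rightarrow> 'a set"
  assumes w_ideal: "\<And>r. w_ideal u (A r)" and mono: "\<And>r s. r \<le> s \<Longrightarrow> A s \<subseteq> A r"
    and cont: "\<And>r. A r \<subseteq> kg (\<Union>s\<in>{r<..}. A s)"
    and top: "kg (\<Union>r. A r) = UNIV" and bot: "kg (\<Union>r. pcomp (A r)) = UNIV"
    and sep: "\<And>r s. r < s \<Longrightarrow> kg (A r \<union> pcomp (A s)) = UNIV"
  obtains f where "f \<in> frame_maps L" "\<And>r. f {r<..} = A r"
proof -
  define B where "B s = kg (\<Union>r\<in>{..<s}. pcomp (A r))" for s
  have wkB: "w_ideal u (B s)" for s by (simp add: B_def)
  have monoB: "B r \<subseteq> B s" if "r \<le> s" for r s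
    unfolding B_def using that by (intro hull_mono UN_mono) auto
  have pcomp_B: "pcomp (A r) \<subseteq> B s" if "r < s" for r s
    unfolding B_def using that by (intro order_trans[OF _ hull_subset]) auto
  have AB: "A r \<inter> B s \<subseteq> {0}" if "s \<le> r" for r s
    unfolding B_def
  proof (rule Int_kg_subset)
    fix X assume "X \<in> (\<lambda>r. pcomp (A r)) ` {..<s}"
    then obtain t where t: "t < s" "X = pcomp (A t)" by auto
    then have "A r \<inter> X \<subseteq> A t \<inter> pcomp (A t)" using mono[of t r] that by auto
    then show "A r \<inter> X \<subseteq> {0}" using Int_pcomp[OF w_ideal[of t]] by simp
  qed (auto simp: w_ideal w_ideal_zero)
  have cover: "kg (A r \<union> B s) = UNIV" if rs: "r < s" for r s
  proof -
    obtain t where t: "r < t" "t < s" using dense[OF rs] by auto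
    have "kg (A r \<union> pcomp (A t)) \<subseteq> kg (A r \<union> B s)"
      using pcomp_B[OF t(2)] by (intro hull_mono) auto
    then show ?thesis using sep[OF t(1)] by auto
  qed
  have topB: "kg (\<Union>s. B s) = UNIV"
  proof -
    have "pcomp (A r) \<subseteq> B (r + 1)" for r by (rule pcomp_B) simp
    then have "(\<Union>r. pcomp (A r)) \<subseteq> (\<Union>s. B s)" by blast
    then have "kg (\<Union>r. pcomp (A r)) \<subseteq> kg (\<Union>s. B s)" by (rule hull_mono)
    then show ?thesis using bot by auto
  qed
  define S where "S U = {A r \<inter> B s | r s. {r..s} \<subseteq> U}" for U
  have SI: "A r \<inter> B s \<in> S U" if "{r..s} \<subseteq> U" for r s U
    unfolding S_def using that by blast
  define f where "f = (\<lambda>U\<in>{U. open U}. kg (\<Union>(S U)))"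
  have f: "f U = kg (\<Union>(S U))" if "open U" for U using that by (simp add: f_def)
  have wkAB: "w_ideal u (A r \<inter> B s)" for r s
    using w_ideal_Inter[of "{A r, B s}" u] w_ideal wkB by auto
  have wkS: "w_ideal u X" if "X \<in> S U" for X U using that wkAB by (auto simp: S_def)
  have S_sub: "X \<subseteq> f U" if "X \<in> S U" "open U" for X U
    unfolding f[OF that(2)] using that(1) by (intro order_trans[OF _ hull_subset]) auto
  have f_mono: "f U \<subseteq> f V" if "open U" "open V" "U \<subseteq> V" for U V
    unfolding f[OF that(1)] f[OF that(2)] using that(3) by (intro hull_mono Union_mono) (unfold S_def, blast)
  have wkf: "w_ideal u (f U)" if "open U" for U by (simp add: f that)
  have "f \<in> frame_maps L"
    unfolding frame_maps_iff
  proof (intro conjI allI impI)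
    show "f \<in> extensional {U. open U}" by (simp add: f_def)
    show "w_ideal u (f U)" if "open U" for U by (rule wkf[OF that])
    have "kg (\<Union>(range A)) \<inter> kg (\<Union>(range B)) \<subseteq> f UNIV"
    proof (rule kg_Int_kg_subset)
      show "X \<inter> Y \<subseteq> f UNIV" if "X \<in> range A" "Y \<in> range B" for X Y
        using that by (intro S_sub) (auto simp: S_def)
    qed (auto simp: w_ideal wkB wkf)
    then show "f UNIV = UNIV" using top topB by auto
    show "f (U \<inter> V) = f U \<inter> f V" if UV: "open U \<and> open V" for U V
    proof
      show "f (U \<inter> V) \<subseteq> f U \<inter> f V" using UV by (intro Int_greatest f_mono) auto
      have "kg (\<Union>(S U)) \<inter> kg (\<Union>(S V)) \<subseteq> f (U \<inter> V)"
      proof (rule kg_Int_kg_subset)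
        fix X Y assume "X \<in> S U" "Y \<in> S V"
        then obtain r s r' s' where *: "X = A r \<inter> B s" "{r..s} \<subseteq> U" "Y = A r' \<inter> B s'" "{r'..s'} \<subseteq> V"
          by (auto simp: S_def)
        have "X \<inter> Y \<subseteq> A (max r r') \<inter> B (min s s')"
          unfolding * by (auto simp: max_def min_def)
        also have "\<dots> \<subseteq> f (U \<inter> V)"
          using * UV by (intro S_sub SI) auto
        finally show "X \<inter> Y \<subseteq> f (U \<inter> V)" .
      qed (use UV wkS wkf[OF open_Int] in auto)
      then show "f U \<inter> f V \<subseteq> f (U \<inter> V)" using UV by (simp add: f)
    qed
    fix \<U> :: "real set set" assume \<U>: "\<forall>U\<in>\<U>. open U"
    let ?J = "kg (\<Union>(f ` \<U>))"
    show "f (\<Union>\<U>) = ?J"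
    proof
      show "?J \<subseteq> f (\<Union>\<U>)"
        using \<U> by (intro kg_least UN_least f_mono wkf) auto
      have "A r \<inter> B s \<subseteq> ?J" if rs: "{r..s} \<subseteq> \<Union>\<U>" for r s
      proof (cases "r \<le> s")
        case False
        then show ?thesis using AB[of s r] w_idealD(1)[OF w_ideal_kg] by fastforce
      next
        case True
        \<comment> \<open>The margin \<open>e\<close> makes the property additive over adjacent
          intervals: the enlarged intervals overlap, and the overlap supplies a cover.\<close>
        define P where "P x y \<longleftrightarrow> {x..y} \<subseteq> {r..s} \<longrightarrow> (\<exists>e>0. A (x - e) \<inter> B (y + e) \<subseteq> ?J)" for x y
        have "P r s"
          using True
        proof (induction rule: Bolzano)
          case (trans a b c)
          show ?case
            unfolding P_def
          proof
            assume ac: "{a..c} \<subseteq> {r..s}"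
            then have "{a..b} \<subseteq> {r..s}" "{b..c} \<subseteq> {r..s}" using trans(3,4) by auto
            then obtain d e where d: "0 < d" "A (a - d) \<inter> B (b + d) \<subseteq> ?J"
              and e: "0 < e" "A (b - e) \<inter> B (c + e) \<subseteq> ?J"
              using trans(1,2) by (auto simp: P_def)
            define m where "m = min d e"
            have "A (a - m) \<inter> B (c + m) \<subseteq> ?J"
            \<comment> \<open>Cut at \<open>b\<close>: the part in \<open>A (b - m)\<close> is
              settled by the interval from \<open>b\<close> to \<open>c\<close>, the part in
              \<open>B (b + m)\<close> by the interval from \<open>a\<close> to
              \<open>b\<close>.\<close>
            proof (rule subset_if_cover)
              show "kg (A (b - m) \<union> B (b + m)) = UNIV" using d(1) e(1) by (intro cover) (simp add: m_def min_def)
              have "B (c + m) \<subseteq> B (c + e)" "A (b - m) \<subseteq> A (b - e)"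
                by (auto intro!: monoB mono simp: m_def)
              then show "A (a - m) \<inter> B (c + m) \<inter> A (b - m) \<subseteq> ?J" using e(2) by blast
              have "A (a - m) \<subseteq> A (a - d)" "B (b + m) \<subseteq> B (b + d)"
                by (auto intro!: monoB mono simp: m_def)
              then show "A (a - m) \<inter> B (c + m) \<inter> B (b + m) \<subseteq> ?J" using d(2) by blast
            qed (simp_all add: w_ideal wkB wkAB)
            then show "\<exists>e>0. A (a - e) \<inter> B (c + e) \<subseteq> ?J"
              using d(1) e(1) by (intro exI[of _ m]) (simp add: m_def)
          qed
        next
          case (local x)
          then obtain U where U: "U \<in> \<U>" "x \<in> U" using rs by (meson UnionE atLeastAtMost_iff subsetD)
          then obtain e where e: "0 < e" "\<And>y. dist y x < e \<Longrightarrow> y \<in> U"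
            using \<U> by (meson open_dist)
          have "P a b" if ab: "a \<le> x" "x \<le> b" "b - a < e / 2" for a b
          proof -
            \<comment> \<open>Half of the radius is spent on the length of the interval, half on the
              margin.\<close>
            have "{a - e / 2..b + e / 2} \<subseteq> U"
              using ab by (auto intro!: e(2) simp: dist_real_def abs_less_iff)
            then have "A (a - e / 2) \<inter> B (b + e / 2) \<subseteq> f U"
              using U \<U> by (intro S_sub) (auto simp: S_def)
            also have "\<dots> \<subseteq> ?J"
              using U by (intro order_trans[OF _ hull_subset]) auto
            finally show ?thesis using e(1) unfolding P_def by (intro impI exI[of _ "e / 2"]) simp
          qed
          then show ?case using e(1) by (intro exI[of _ "e / 2"]) simp
        qed
        then obtain e where e: "0 < e" "A (r - e) \<inter> B (s + e) \<subseteq> ?J" by (auto simp: P_def)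
        have "A r \<subseteq> A (r - e)" "B s \<subseteq> B (s + e)" using e(1) by (auto intro!: mono monoB)
        then show ?thesis using e(2) by blast
      qed
      then show "f (\<Union>\<U>) \<subseteq> ?J"
        using \<U> by (subst f) (auto intro!: kg_le_kg simp: S_def)
    qed
  qed
  moreover have "f {r<..} = A r" for r
  proof
    have "A t \<inter> B s \<subseteq> A r" if "{t..s} \<subseteq> {r<..}" for t s
    proof (cases "t \<le> s")
      case True
      then have "r \<le> t" using that by auto
      then show ?thesis using mono by blast
    next
      case False
      then show ?thesis using AB[of s t] w_idealD(1)[OF w_ideal[of r]] by fastforce
    qed
    then have "\<Union>(S {r<..}) \<subseteq> A r"
      unfolding S_def by blast
    then show "f {r<..} \<subseteq> A r"
      by (simp add: f kg_least w_ideal)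
    have "A t \<subseteq> f {r<..}" if "r < t" for t
    proof -
      have "A t \<inter> kg (\<Union>(range B)) \<subseteq> f {r<..}"
      proof (rule Int_kg_subset)
        fix X assume "X \<in> range B"
        then obtain s where X: "X = B s" by auto
        show "A t \<inter> X \<subseteq> f {r<..}"
          unfolding X using that by (intro S_sub SI) auto
      qed (auto simp: w_ideal wkB wkf)
      then show ?thesis using topB by simp
    qed
    then have "kg (\<Union>s\<in>{r<..}. A s) \<subseteq> f {r<..}"
      by (intro kg_least wkf) auto
    then show "A r \<subseteq> f {r<..}" using cont[of r] by auto
  qed
  ultimately show ?thesis using that by blast
qed

subsection \<open>The Madden representation\<close>

definition ray :: "'a \<Rightarrow> int \<Rightarrow> int \<Rightarrow> 'a set" where
  "ray g p q = kg {pprt (mul q g - mul p u)}"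

lemma madden_ray: "madden_ray G g p q = ray g p (int q)"
  by (simp add: madden_ray_def ray_def pprt_def)

lemma w_ideal_ray [simp]: "w_ideal u (ray g p q)"
  by (simp add: ray_def)

lemma ray_mem: "pprt (mul q g - mul p u) \<in> ray g p q"
  by (simp add: ray_def hull_inc)

lemma ray_subset_iff: "w_ideal u K \<Longrightarrow> ray g p q \<subseteq> K \<longleftrightarrow> pprt (mul q g - mul p u) \<in> K"
  using kg_least[of "{pprt (mul q g - mul p u)}" K] ray_mem[of q g p] by (auto simp: ray_def)

text \<open>\<open>pprt x\<close> lies below \<open>pprt (mul n x)\<close>, which is a multiple of
  it; so denominators can be cleared without changing membership.\<close>

lemma pprt_mul_mem: "w_ideal u K \<Longrightarrow> 0 < n \<Longrightarrow> pprt (mul n x) \<in> K \<longleftrightarrow> pprt x \<in> K"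
proof
  assume K: "w_ideal u K" and n: "0 < n" and *: "pprt (mul n x) \<in> K"
  have "mul 1 (pprt x) \<le> mul n (pprt x)" using n by (intro mul_mono_left) auto
  then show "pprt x \<in> K" using w_ideal_le[OF K *, of "pprt x"] n by (simp add: pprt_mul)
next
  assume K: "w_ideal u K" and n: "0 < n" and *: "pprt x \<in> K"
  show "pprt (mul n x) \<in> K" using w_ideal_mul[OF K *, of "nat n"] n by (simp add: pprt_mul)
qed

lemma pprt_mem_antimono: "w_ideal u K \<Longrightarrow> x \<le> y \<Longrightarrow> pprt y \<in> K \<Longrightarrow> pprt x \<in> K"
  by (rule w_ideal_le[OF _ _ zero_le_pprt pprt_mono])

lemma ray_antimono:
  assumes "0 < q" "0 < q'" "p * q' \<le> p' * q"
  shows "ray g p' q' \<subseteq> ray g p q"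
proof -
  have "mul q (mul q' g - mul p' u) \<le> mul q' (mul q g - mul p u)"
    using mul_mono_left[OF assms(3) unit_nonneg] by (simp add: algebra_simps)
  moreover have "pprt (mul q' (mul q g - mul p u)) \<in> ray g p q"
    using ray_mem assms(2) by (simp add: pprt_mul_mem)
  ultimately have "pprt (mul q (mul q' g - mul p' u)) \<in> ray g p q"
    by (rule pprt_mem_antimono[OF w_ideal_ray])
  then show ?thesis using assms(1) by (simp add: ray_subset_iff pprt_mul_mem)
qed

definition upper :: "'a \<Rightarrow> real \<Rightarrow> 'a set" where
  "upper g r = kg (\<Union>{ray g p (int q) | p q. 0 < q \<and> r < of_int p / of_nat q})"

lemma w_ideal_upper [simp]: "w_ideal u (upper g r)"
  by (simp add: upper_def)

lemma ray_subset_upper: "0 < q \<Longrightarrow> r < of_int p / of_nat q \<Longrightarrow> ray g p (int q) \<subseteq> upper g r"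
  unfolding upper_def by (rule order_trans[OF _ hull_subset]) blast

lemma upper_least:
  assumes "w_ideal u K" "\<And>p q. 0 < q \<Longrightarrow> r < of_int p / of_nat q \<Longrightarrow> ray g p (int q) \<subseteq> K"
  shows "upper g r \<subseteq> K"
  unfolding upper_def using assms by (intro kg_least) blast+

lemma upper_antimono: "r \<le> s \<Longrightarrow> upper g s \<subseteq> upper g r"
  by (rule upper_least[OF w_ideal_upper ray_subset_upper]) simp_all

text \<open>Continuity from the right comes from the archimedean rule. With
  \<open>x = q g - p u\<close>, the positive part of \<open>n pprt x - u\<close> lies in the ray at
  \<open>(n p + 1) / (n q)\<close>, which exceeds \<open>p / q\<close>; letting \<open>n\<close>
  vary in the rule recovers \<open>pprt x\<close>.\<close>

lemma upper_rational:
  assumes q: "0 < q"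
  shows "upper g (of_int p / of_nat q) = ray g p (int q)"
proof
  show "upper g (of_int p / of_nat q) \<subseteq> ray g p (int q)"
  proof (rule upper_least)
    fix p' q' assume *: "0 < q'" "of_int p / of_nat q < (of_int p' / of_nat q' :: real)"
    then have "of_int p * of_nat q' \<le> (of_int p' * of_nat q :: real)"
      using q by (simp add: field_simps)
    then have "p * int q' \<le> p' * int q"
      by (metis (mono_tags, lifting) of_int_le_iff of_int_mult of_int_of_nat_eq)
    then show "ray g p' (int q') \<subseteq> ray g p (int q)" using q * by (intro ray_antimono) auto
  qed simp
  let ?x = "mul (int q) g - mul p u"
  have "pprt (mul (int n) (pprt ?x) - u) \<in> upper g (of_int p / of_nat q)" for n
  proof (cases "n = 0")
    case True
    then show ?thesis using unit_nonneg w_idealD(1)[OF w_ideal_upper] by simp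
  next
    case False
    have "mul (int n) (pprt ?x) - u = pprt (mul (int n) ?x) - u" by (simp add: pprt_mul)
    then have "pprt (mul (int n) (pprt ?x) - u) = pprt (mul (int n) ?x - u)"
      using pprt_pprt_diff[OF unit_nonneg] by simp
    also have "mul (int n) ?x - u = mul (int (n * q)) g - mul (int n * p + 1) u"
      by (simp add: algebra_simps)
    finally have "pprt (mul (int n) (pprt ?x) - u) \<in> ray g (int n * p + 1) (int (n * q))"
      using ray_mem by simp
    moreover have "of_int p / of_nat q < (of_int (int n * p + 1) / of_nat (n * q) :: real)"
      using q False by (simp add: field_simps)
    ultimately show ?thesis
      using ray_subset_upper[of "n * q" "of_int p / of_nat q" "int n * p + 1" g] q False by auto
  qed
  then have "pprt ?x \<in> upper g (of_int p / of_nat q)"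
    by (rule w_idealD(4)[OF w_ideal_upper zero_le_pprt unit_nonneg])
  then show "ray g p (int q) \<subseteq> upper g (of_int p / of_nat q)"
    by (simp add: ray_subset_iff)
qed

lemma rational_between:
  fixes r s :: real
  assumes "r < s"
  obtains p q where "0 < q" "r < of_int p / of_nat q" "of_int p / of_nat q < s"
proof -
  obtain x where x: "r < of_rat x" "of_rat x < s" using of_rat_dense[OF assms] by blast
  obtain p q where "x = Rat.Fract p q" "0 < q" by (cases x) auto
  then show ?thesis
    using x by (intro that[of "nat q" p]) (simp_all add: of_rat_rat)
qed

text \<open>Certifies covers: \<open>x\<close> and \<open>y\<close> play the roles of
  \<open>g - r\<close> and \<open>s - g\<close> with \<open>r < s\<close> on a common denominator,
  so their sum is a positive constant.\<close>

lemma unit_mem_if_diff: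
  assumes K: "w_ideal u K" and "0 < n" "pprt x \<in> K" "pprt y \<in> K" "x + y = mul n u"
  shows "u \<in> K"
proof (rule w_ideal_le[OF K w_idealD(2)[OF K assms(3,4)] unit_nonneg])
  have "mul 1 u \<le> mul n u" using assms(2) unit_nonneg by (intro mul_mono_left) auto
  then show "u \<le> pprt x + pprt y"
    using add_mono[OF le_pprt[of x] le_pprt[of y]] assms(5) by simp
qed

text \<open>Modulo \<open>K\<close> every multiple of \<open>u\<close> lies below \<open>y\<close>,
  so the archimedean rule applies to \<open>u\<close>. This shows that the rays of an element
  exhaust the frame at both ends.\<close>

lemma unit_mem_if_multiples:
  assumes K: "w_ideal u K" and "0 \<le> y" "\<And>n. pprt (x + mul (int n) u) \<in> K"  "- x \<le> y"
  shows "u \<in> K"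
proof (rule w_idealD(4)[OF K unit_nonneg assms(2)])
  fix n
  have "mul (int n) u - y \<le> x + mul (int n) u"
    using add_right_mono[OF assms(4), of "mul (int n) u"] by (simp add: algebra_simps)
  then show "pprt (mul (int n) u - y) \<in> K"
    by (rule pprt_mem_antimono[OF K _ assms(3)])
qed

text \<open>The element is positive only where \<open>g < p' / q'\<close>, while the ray lives where
  \<open>g > p / q\<close>. Scaling to a common denominator compares the two with the disjoint
  positive and negative parts of one element.\<close>

lemma ray_disjoint:
  assumes "p' * q \<le> p * q'" "0 < q" "0 < q'"
  shows "pprt (mul p' u - mul q' g) \<in> pcomp (ray g p q)"
proof -
  let ?x = "mul q g - mul p u" and ?y = "mul p' u - mul q' g"
  have "inf (pprt (mul q' ?x)) (pprt (mul q ?y)) \<le> inf (pprt (mul q' ?x)) (pprt (- mul q' ?x))"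
    using mul_mono_left[OF assms(1) unit_nonneg]
    by (intro inf_mono pprt_mono) (simp_all add: algebra_simps)
  then have "inf (pprt (mul q' ?x)) (pprt (mul q ?y)) \<le> 0"
    by (simp only: disjoint_pprt)
  then have "inf (mul q' (pprt ?x)) (mul q (pprt ?y)) \<le> 0"
    using assms by (simp only: pprt_mul less_imp_le)
  moreover have "pprt ?x \<le> mul q' (pprt ?x)" "pprt ?y \<le> mul q (pprt ?y)"
    using mul_mono_left[of 1 q' "pprt ?x"] mul_mono_left[of 1 q "pprt ?y"] assms(2,3) by simp_all
  ultimately have "inf (pprt ?x) (pprt ?y) \<le> 0"
    using inf_mono order_trans by blast
  then have "inf (pprt ?y) (pprt ?x) = 0" by (intro order_antisym) (simp_all add: inf_commute)
  then show ?thesis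
    using kg_subset_pcomp[of "pprt ?y" "pprt ?x"] by (auto simp: ray_def hull_inc)
qed

lemma upper_frame_map:
  obtains f where "f \<in> frame_maps L" "\<And>r. f {r<..} = upper g r"
proof (rule frame_map_exists[of "upper g"])
  have neg: "- g \<le> labs g" "- (- g) \<le> labs g" by (simp_all add: labs_ge)
  show "kg (\<Union>r. upper g r) = UNIV"
  proof (rule kg_eq_UNIV, rule unit_mem_if_multiples[OF w_ideal_kg labs_nonneg _ neg(1)])
    fix n
    have "pprt (g + mul (int n) u) \<in> upper g (of_int (- int n) / of_nat 1)"
      using ray_mem[of 1 g "- int n"] by (subst upper_rational) simp_all
    then show "pprt (g + mul (int n) u) \<in> kg (\<Union>r. upper g r)" by (intro hull_inc) blast
  qed
  show "kg (\<Union>r. pcomp (upper g r)) = UNIV"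
  proof (rule kg_eq_UNIV, rule unit_mem_if_multiples[OF w_ideal_kg labs_nonneg _ neg(2)])
    fix n
    have "pprt (- g + mul (int n) u) \<in> pcomp (upper g (of_int (int n) / of_nat 1))"
      using ray_disjoint[of "int n" 1 "int n" 1 g] by (subst upper_rational) simp_all
    then show "pprt (- g + mul (int n) u) \<in> kg (\<Union>r. pcomp (upper g r))" by (intro hull_inc) blast
  qed
  show "upper g r \<subseteq> kg (\<Union>s\<in>{r<..}. upper g s)" for r
  proof (rule upper_least)
    fix p q assume *: "0 < q" "r < of_int p / of_nat q"
    then have "upper g (of_int p / of_nat q) \<subseteq> (\<Union>s\<in>{r<..}. upper g s)" by blast
    then show "ray g p (int q) \<subseteq> kg (\<Union>s\<in>{r<..}. upper g s)"
      using * by (simp add: upper_rational) (meson hull_subset order_trans)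
  qed simp
  show "kg (upper g r \<union> pcomp (upper g s)) = UNIV" if rs: "r < s" for r s
  proof -
    \<comment> \<open>Two rationals are needed: the first serves the ray of \<open>r\<close>, the
      second the pseudocomplement of the ray of \<open>s\<close>. After clearing denominators the
      witnesses add up to \<open>p' q - p q'\<close> times \<open>u\<close>, a positive
      multiple.\<close>
    obtain p q where pq: "0 < q" "r < of_int p / of_nat q" "of_int p / of_nat q < s"
      using rational_between[OF rs] .
    obtain p' q' where pq': "0 < q'" "of_int p / of_nat q < (of_int p' / of_nat q' :: real)"
      "of_int p' / of_nat q' < s"
      using rational_between[OF pq(3)] .
    have "pprt (mul (int q) g - mul p u) \<in> upper g r"
      using ray_subset_upper[OF pq(1,2)] ray_mem by blast
    then have 1: "pprt (mul (int q') (mul (int q) g - mul p u)) \<in> kg (upper g r \<union> pcomp (upper g s))"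
      using pq' by (simp add: pprt_mul_mem hull_inc)
    have "upper g s \<subseteq> ray g p' (int q')"
      using upper_antimono[of "of_int p' / of_nat q'" s g] pq' upper_rational[of q' g p'] by simp
    moreover have "pprt (mul p' u - mul (int q') g) \<in> pcomp (ray g p' (int q'))"
      using pq' by (intro ray_disjoint) auto
    ultimately have "pprt (mul p' u - mul (int q') g) \<in> pcomp (upper g s)"
      using pcomp_antimono by blast
    then have 2: "pprt (mul (int q) (mul p' u - mul (int q') g)) \<in> kg (upper g r \<union> pcomp (upper g s))"
      using pq by (simp add: pprt_mul_mem hull_inc)
    have "of_int p * of_nat q' < (of_int p' * of_nat q :: real)"
      using pq(1) pq'(1,2) by (simp add: field_simps)
    then have "p * int q' < p' * int q"
      by (metis (mono_tags, lifting) of_int_less_iff of_int_mult of_int_of_nat_eq)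
    then show ?thesis
      by (intro kg_eq_UNIV unit_mem_if_diff[OF w_ideal_kg _ 1 2, of "p' * int q - p * int q'"])
        (simp_all add: algebra_simps)
  qed
qed (auto simp: upper_antimono)

lemma madden_rep:
  shows madden_rep_frame_map: "madden_rep G g \<in> frame_maps L"
    and madden_rep_upper: "madden_rep G g {r<..} = upper g r"
proof -
  obtain f where f: "f \<in> frame_maps L" "\<And>r. f {r<..} = upper g r"
    using upper_frame_map[of g] by blast
  have Sup: "\<Squnion>\<^bsub>L\<^esub> {madden_ray G g p q | p q. 0 < q \<and> r < of_int p / of_nat q} = upper g r" for r
    unfolding upper_def by (subst Sup_L) (auto simp: madden_ray)
  have "madden_rep G g = f"
    unfolding madden_rep_def
  proof (rule the_equality)
    show "f \<in> frame_maps L \<and> (\<forall>p q. 0 < q \<longrightarrow> f {of_int p / of_nat q<..} = madden_ray G g p q) \<and>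
        (\<forall>r. f {r<..} = \<Squnion>\<^bsub>L\<^esub> {madden_ray G g p q | p q. 0 < q \<and> r < of_int p / of_nat q})"
      by (simp only: Sup f) (simp add: upper_rational madden_ray)
    fix f' assume f': "f' \<in> frame_maps L \<and> (\<forall>p q. 0 < q \<longrightarrow> f' {of_int p / of_nat q<..} = madden_ray G g p q) \<and>
        (\<forall>r. f' {r<..} = \<Squnion>\<^bsub>L\<^esub> {madden_ray G g p q | p q. 0 < q \<and> r < of_int p / of_nat q})"
    then have "f' {r<..} = upper g r" for r by (simp only: Sup)
    then show "f' = f" using f f' by (intro frame_map_eqI) auto
  qed
  then show "madden_rep G g \<in> frame_maps L" "madden_rep G g {r<..} = upper g r"
    using f by auto
qed

subsection \<open>The bounded part of the frame maps\<close>

lemma mem_bounded_part: "g \<in> bounded_part G \<longleftrightarrow> (\<exists>n. labs g \<le> mul (int n) u)"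
  by (simp add: bounded_part_def labs_def)

lemma rl_const_apply: "open U \<Longrightarrow> rl_const L r U = (if r \<in> U then UNIV else {0})"
  by (simp add: rl_const_def top_L bot_L)

lemma rl_const_frame_map: "rl_const L r \<in> frame_maps L"
  unfolding frame_maps_iff
proof (intro conjI allI impI)
  show "rl_const L r \<in> extensional {U. open U}" by (simp add: rl_const_def)
  fix \<U> :: "real set set" assume *: "\<forall>U\<in>\<U>. open U"
  show "rl_const L r (\<Union>\<U>) = kg (\<Union>(rl_const L r ` \<U>))"
  proof (cases "r \<in> \<Union>\<U>")
    case True
    then obtain U where "U \<in> \<U>" "r \<in> U" by auto
    then have "\<Union>(rl_const L r ` \<U>) = UNIV" using * by (auto simp: rl_const_apply)
    then show ?thesis using True * by (simp add: rl_const_apply open_Union)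
  next
    case False
    then have "\<Union>(rl_const L r ` \<U>) \<subseteq> {0}" using * by (auto simp: rl_const_apply)
    then have "kg (\<Union>(rl_const L r ` \<U>)) = {0}"
      using kg_least[OF _ w_ideal_zero] w_idealD(1)[OF w_ideal_kg] by blast
    moreover have "rl_const L r (\<Union>\<U>) = {0}"
      using False * by (simp add: rl_const_apply open_Union)
    ultimately show ?thesis by (simp only:)
  qed
qed (auto simp: rl_const_apply open_Int w_ideal_UNIV w_ideal_zero)

lemma rl_lift2_apply:
  assumes "\<And>V. open V \<Longrightarrow> w_ideal u (f V)" "\<And>V. open V \<Longrightarrow> w_ideal u (g V)" "open U"
  shows "rl_lift2 L w f g U =
    kg (\<Union>{f V \<inter> g W | V W. open V \<and> open W \<and> (\<lambda>(x, y). w x y) ` (V \<times> W) \<subseteq> U})"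
proof -
  let ?S = "{f V \<inter> g W | V W. open V \<and> open W \<and> (\<lambda>(x, y). w x y) ` (V \<times> W) \<subseteq> U}"
  have "{f V \<sqinter>\<^bsub>L\<^esub> g W | V W. open V \<and> open W \<and> (\<lambda>(x, y). w x y) ` (V \<times> W) \<subseteq> U} = ?S"
    using assms(1,2) by (metis (no_types, lifting) meet_L)
  then have "rl_lift2 L w f g U = \<Squnion>\<^bsub>L\<^esub> ?S"
    using assms(3) by (simp only: rl_lift2_def restrict_apply mem_Collect_eq if_True)
  also have "\<dots> = kg (\<Union>?S)"
  proof (rule Sup_L)
    fix X assume "X \<in> ?S"
    then obtain V W where "X = f V \<inter> g W" "open V" "open W" by blast
    then show "w_ideal u X" using w_ideal_Inter[of "{f V, g W}" u] assms(1,2) by auto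
  qed
  finally show ?thesis .
qed

lemma rl_lift1_apply:
  assumes "\<And>V. open V \<Longrightarrow> w_ideal u (f V)" "open U"
  shows "rl_lift1 L w f U = kg (\<Union>{f V | V. open V \<and> w ` V \<subseteq> U})"
  using assms by (auto simp: rl_lift1_def intro!: Sup_L)

lemma rl_const_add: "rl_lift2 L (+) (rl_const L r) (rl_const L s) = rl_const L (r + s)"
proof (rule extensionalityI[of _ "{U. open U}"])
  fix U :: "real set" assume "U \<in> {U. open U}"
  then have U: "open U" by simp
  let ?S = "{rl_const L r V \<inter> rl_const L s W | V W. open V \<and> open W \<and> (\<lambda>(x, y). x + y) ` (V \<times> W) \<subseteq> U}"
  have lift: "rl_lift2 L (+) (rl_const L r) (rl_const L s) U = kg (\<Union>?S)"
    using U frame_mapsD(2)[OF rl_const_frame_map] by (intro rl_lift2_apply) auto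
  show "rl_lift2 L (+) (rl_const L r) (rl_const L s) U = rl_const L (r + s) U"
  proof (cases "r + s \<in> U")
    case True
    then obtain e where e: "0 < e" "\<And>y. dist y (r + s) < e \<Longrightarrow> y \<in> U"
      using U by (meson open_dist)
    let ?V = "{r - e / 2<..<r + e / 2}" and ?W = "{s - e / 2<..<s + e / 2}"
    have "(\<lambda>(x, y). x + y) ` (?V \<times> ?W) \<subseteq> U"
      by (auto intro!: e(2) simp: dist_real_def abs_less_iff)
    then have "rl_const L r ?V \<inter> rl_const L s ?W \<in> ?S" using open_greaterThanLessThan by blast
    then have "\<Union>?S = UNIV" using e(1) by (auto simp: rl_const_apply)
    then show ?thesis using True U by (simp add: lift rl_const_apply)
  next
    case False
    have "X \<subseteq> {0}" if X: "X \<in> ?S" for X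
    proof -
      obtain V W where VW: "X = rl_const L r V \<inter> rl_const L s W" "open V" "open W"
        "(\<lambda>(x, y). x + y) ` (V \<times> W) \<subseteq> U" using X by blast
      then have "\<not> (r \<in> V \<and> s \<in> W)" using False by blast
      then show ?thesis using VW(1-3) by (auto simp: rl_const_apply)
    qed
    then have "kg (\<Union>?S) = {0}"
      using kg_least[OF Sup_least w_ideal_zero, of ?S] w_idealD(1)[OF w_ideal_kg] by blast
    then show ?thesis using False U by (simp add: lift rl_const_apply)
  qed
qed (auto simp: rl_lift2_def rl_const_def)

lemma RL_unit_power: "wunit (RL L) [^]\<^bsub>RL L\<^esub> (n::nat) = rl_const L (real n)"
proof (induction n)
  case 0
  show ?case by (simp add: nat_pow_def RL_def)
next
  case (Suc n)
  have "wunit (RL L) [^]\<^bsub>RL L\<^esub> Suc n = wunit (RL L) [^]\<^bsub>RL L\<^esub> n \<otimes>\<^bsub>RL L\<^esub> wunit (RL L)"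
    by (simp add: nat_pow_def)
  also have "\<dots> = rl_lift2 L (+) (rl_const L (real n)) (rl_const L 1)"
    by (simp add: Suc) (simp add: RL_def)
  finally show ?case by (simp add: rl_const_add add.commute)
qed

text \<open>The ray of the absolute value of \<open>f\<close> above \<open>n\<close> joins the parts
  of \<open>f\<close> above \<open>n\<close> and below \<open>- n\<close>, while the constant
  \<open>n\<close> has full rays below \<open>n\<close> and trivial rays from \<open>n\<close>
  on.\<close>

lemma mem_bounded_part_RL:
  "f \<in> bounded_part (RL L) \<longleftrightarrow>
     f \<in> frame_maps L \<and> (\<exists>n::nat. f {real n<..} = {0} \<and> f {..<- real n} = {0})"
proof (cases "f \<in> frame_maps L")
  case False
  then show ?thesis by (simp add: bounded_part_def RL_def)
next
  case True
  note D = frame_mapsD[OF True]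
  define m where "m = rl_lift1 L uminus f"
  define M where "M = rl_lift2 L max f m"
  have m: "m W = kg (\<Union>{f V | V. open V \<and> uminus ` V \<subseteq> W})" if "open W" for W
    unfolding m_def using D(2) that by (intro rl_lift1_apply) auto
  have wkm: "w_ideal u (m W)" if "open W" for W by (simp add: m[OF that])
  have f_le_m: "f V \<subseteq> m W" if "open V" "open W" "uminus ` V \<subseteq> W" for V W
    unfolding m[OF that(2)] using that by (intro order_trans[OF _ hull_subset]) blast
  have M: "M U = kg (\<Union>{f V \<inter> m W | V W. open V \<and> open W \<and> (\<lambda>(x, y). max x y) ` (V \<times> W) \<subseteq> U})"
    if "open U" for U
    unfolding M_def using D(2) wkm that by (intro rl_lift2_apply) auto
  have le_M: "f V \<inter> m W \<subseteq> M U" if "open V" "open W" "open U" "(\<lambda>(x, y). max x y) ` (V \<times> W) \<subseteq> U" for U V W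
    unfolding M[OF that(3)] using that by (intro order_trans[OF _ hull_subset]) blast
  have "(\<forall>r. M {r<..} \<subseteq> rl_const L (real n) {r<..}) \<longleftrightarrow> f {real n<..} = {0} \<and> f {..<- real n} = {0}"
    (is "?A \<longleftrightarrow> ?B") for n
  proof
    assume ?A
    then have "M {real n<..} \<subseteq> rl_const L (real n) {real n<..}" by (rule spec)
    then have M0: "M {real n<..} \<subseteq> {0}" by (simp add: rl_const_apply)
    have max: "(\<lambda>(x, y). max x y) ` ({real n<..} \<times> UNIV) \<subseteq> {real n<..}"
      "(\<lambda>(x, y). max x y) ` (UNIV \<times> {real n<..}) \<subseteq> {real n<..}"
      by (auto simp: less_max_iff_disj)
    have "m UNIV = UNIV" using f_le_m[of UNIV UNIV] D(3) by auto
    then have "f {real n<..} \<subseteq> M {real n<..}"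
      using le_M[OF _ _ _ max(1)] by simp
    moreover have "f {..<- real n} \<subseteq> m {real n<..}"
      by (rule f_le_m) auto
    then have "f {..<- real n} \<subseteq> M {real n<..}"
      using le_M[OF _ _ _ max(2)] D(3) by auto
    ultimately show ?B
      using M0 w_idealD(1)[OF D(2), of "{real n<..}"] w_idealD(1)[OF D(2), of "{..<- real n}"] by auto
  next
    assume B: ?B
    have "M {r<..} \<subseteq> {0}" if r: "real n \<le> r" for r
    proof -
      have "f V \<inter> m W \<subseteq> {0}"
        if VW: "open V" "open W" "(\<lambda>(x, y). max x y) ` (V \<times> W) \<subseteq> {r<..}" for V W
      \<comment> \<open>A rectangle on which the maximum exceeds \<open>r\<close> has one side
        entirely above \<open>r\<close>: a point of \<open>V\<close> that is at most
        \<open>r\<close> forces all of \<open>W\<close> above \<open>r\<close>.\<close>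
      proof (cases "V \<subseteq> {r<..}")
        case True
        then have "V \<subseteq> {real n<..}" using r by auto
        then have "f V \<subseteq> f {real n<..}" using VW(1) by (intro frame_map_mono \<open>f \<in> frame_maps L\<close>) auto
        then show ?thesis using B by auto
      next
        case False
        then obtain x where x: "x \<in> V" "x \<le> r" by (meson greaterThan_iff not_less subsetI)
        have W: "W \<subseteq> {r<..}"
        proof
          fix y assume "y \<in> W"
          then have "max x y \<in> {r<..}" using x(1) VW(3) by auto
          then show "y \<in> {r<..}" using x(2) by auto
        qed
        have "f V' \<subseteq> {0}" if V': "open V'" "uminus ` V' \<subseteq> W" for V'
        proof -
          have "V' \<subseteq> {..<- real n}" using V' W r by force
          then have "f V' \<subseteq> f {..<- real n}" using V' by (intro frame_map_mono \<open>f \<in> frame_maps L\<close>) auto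
          then show ?thesis using B by auto
        qed
        then have "m W \<subseteq> {0}" unfolding m[OF VW(2)] by (intro kg_least w_ideal_zero) blast
        then show ?thesis by auto
      qed
      then show ?thesis
        unfolding M[OF open_greaterThan] by (intro kg_least w_ideal_zero) blast
    qed
    then show ?A by (auto simp: rl_const_apply)
  qed
  then show ?thesis
    using True by (simp add: bounded_part_def RL_unit_power) (simp add: RL_def m_def M_def)
qed

lemma pcomp_UNIV: "pcomp UNIV = {0}"
  using Int_pcomp[OF w_ideal_UNIV] by simp

lemma pcomp_zero: "pcomp {0} = UNIV"
proof -
  have "UNIV \<subseteq> pcomp {0}" by (subst subset_pcomp_iff) (simp_all add: w_ideal_UNIV w_ideal_zero)
  then show ?thesis by auto
qed

lemma frame_map_lower_ray_zero:
  assumes f: "f \<in> frame_maps L" and "\<And>r. r < s \<Longrightarrow> f {r<..} = UNIV"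
  shows "f {..<s} = {0}"
proof -
  have "f {..<s} \<subseteq> {0}"
    unfolding frame_map_lower_ray[OF f] using assms(2) by (intro kg_least UN_least w_ideal_zero) (simp add: pcomp_UNIV)
  then show ?thesis using w_idealD(1)[OF frame_mapsD(2)[OF f, of "{..<s}"]] by auto
qed

lemma upper_eq_zero:
  assumes "g \<le> mul m u" "of_int m \<le> r"
  shows "upper g r = {0}"
proof -
  have "upper g (of_int m) = ray g m 1" using upper_rational[of 1 g m] by simp
  also have "\<dots> \<subseteq> {0}" using assms(1) by (simp add: ray_subset_iff w_ideal_zero)
  finally have "upper g r \<subseteq> {0}" using upper_antimono[OF assms(2), of g] by auto
  then show ?thesis using w_idealD(1)[OF w_ideal_upper] by auto
qed

lemma upper_eq_UNIV:
  assumes "mul m u \<le> g" "r < of_int m"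
  shows "upper g r = UNIV"
proof -
  obtain p q where pq: "0 < q" "r < of_int p / of_nat q" "of_int p / of_nat q < (of_int m :: real)"
    using rational_between[OF assms(2)] .
  have "of_int p < (of_int m * of_nat q :: real)" using pq(1,3) by (simp add: field_simps)
  then have "p < m * int q" by (metis of_int_less_iff of_int_mult of_int_of_nat_eq)
  \<comment> \<open>Strictness leaves room for a rational \<open>p / q < m\<close>, and integrality
    makes \<open>m q - p\<close> at least 1, so \<open>u\<close> lies below the generator of that
    ray.\<close>
  then have "mul 1 u \<le> mul (m * int q - p) u" using unit_nonneg by (intro mul_mono_left) auto
  also have "\<dots> = mul (int q) (mul m u) - mul p u" by (simp add: algebra_simps)
  also have "\<dots> \<le> mul (int q) g - mul p u" using mul_mono[OF _ assms(1), of "int q"] by simp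
  also have "\<dots> \<le> pprt (mul (int q) g - mul p u)" by (rule le_pprt)
  finally have "u \<le> pprt (mul (int q) g - mul p u)" by simp
  then have "u \<in> ray g p (int q)" using w_ideal_le[OF w_ideal_ray ray_mem unit_nonneg] by simp
  then have "u \<in> upper g r" using ray_subset_upper[OF pq(1,2)] by auto
  then show ?thesis by (rule w_ideal_unit[OF w_ideal_upper _ unit_nonneg])
qed

lemma labs_le_bounds:
  assumes "labs g \<le> mul (int n) u"
  shows "g \<le> mul (int n) u" "mul (- int n) u \<le> g"
  using assms by (simp_all add: labs_le_iff) (metis minus_le_iff)

lemma madden_rep_bounded:
  assumes "g \<in> bounded_part G"
  shows "madden_rep G g \<in> bounded_part (RL L)"
proof -
  obtain n where n: "labs g \<le> mul (int n) u" using assms by (auto simp: mem_bounded_part)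
  have "upper g (real n) = {0}"
    by (rule upper_eq_zero[OF labs_le_bounds(1)[OF n]]) simp
  moreover have "madden_rep G g {..<- real n} = {0}"
    by (rule frame_map_lower_ray_zero[OF madden_rep_frame_map])
      (simp add: madden_rep_upper upper_eq_UNIV[OF labs_le_bounds(2)[OF n]])
  ultimately show ?thesis
    unfolding mem_bounded_part_RL by (auto simp: madden_rep_frame_map madden_rep_upper)
qed

lemma pointwise_sup_iff:
  "pointwise_sup G F f\<^sub>0 \<longleftrightarrow> (\<forall>r. upper f\<^sub>0 r = kg (\<Union>f\<in>F. upper f r))"
proof -
  have "\<Squnion>\<^bsub>L\<^esub> ((\<lambda>f. upper f r) ` F) = kg (\<Union>f\<in>F. upper f r)" for r
    by (rule Sup_L) auto
  then show ?thesis by (simp add: pointwise_sup_def madden_rep_upper)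
qed

subsection \<open>Pointwise completeness implies complementation\<close>

lemma kg_labs_image: "kg (labs ` S) = kg S"
proof
  show "kg (labs ` S) \<subseteq> kg S"
    by (intro kg_le_kg image_subsetI) (simp add: w_ideal_labs[OF w_ideal_kg] hull_inc)
  have "labs x \<in> kg (labs ` S)" if "x \<in> S" for x using that by (intro hull_inc) simp
  then show "kg S \<subseteq> kg (labs ` S)"
    by (intro kg_le_kg) (auto simp: w_ideal_labs[OF w_ideal_kg])
qed

text \<open>Each \<open>V n\<close> is rather below \<open>K\<close>, so by the Lindelof property
  \<open>u\<close> is generated by countably many elements of \<open>pcomp (V n)\<close> and
  \<open>K\<close>. Those from \<open>K\<close> generate a kernel containing \<open>V n\<close>, and
  the \<open>V n\<close> exhaust \<open>K\<close>.\<close>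

lemma countably_generated:
  fixes V :: "nat \<Rightarrow> 'a set"
  assumes K: "w_ideal u K" and V: "\<And>n. w_ideal u (V n)" and sub: "K \<subseteq> kg (\<Union>n. V n)"
    and cover: "\<And>n. kg (pcomp (V n) \<union> K) = UNIV"
  shows "\<exists>C. countable C \<and> (\<forall>k\<in>C. 0 \<le> k) \<and> kg C = K"
proof -
  have "\<forall>n. \<exists>C. countable C \<and> C \<subseteq> pcomp (V n) \<union> K \<and> u \<in> kg C"
  proof
    fix n
    have "u \<in> kg (pcomp (V n) \<union> K)" using cover by simp
    then show "\<exists>C. countable C \<and> C \<subseteq> pcomp (V n) \<union> K \<and> u \<in> kg C"
      by (rule kg_countable) blast
  qed
  then obtain C where C: "\<And>n. countable (C n)" "\<And>n. C n \<subseteq> pcomp (V n) \<union> K" "\<And>n. u \<in> kg (C n)"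
    by metis
  define D where "D = (\<Union>n. C n \<inter> K)"
  have V_sub: "V n \<subseteq> kg D" for n
  proof (rule subset_if_cover)
    have "C n \<subseteq> pcomp (V n) \<union> kg D"
      using C(2)[of n] by (auto simp: D_def intro: hull_inc)
    then have "kg (C n) \<subseteq> kg (pcomp (V n) \<union> kg D)" by (rule hull_mono)
    then show "kg (pcomp (V n) \<union> kg D) = UNIV" using C(3)[of n] by (intro kg_eq_UNIV) auto
    show "V n \<inter> pcomp (V n) \<subseteq> kg D" using Int_pcomp[OF V] w_idealD(1)[OF w_ideal_kg] by auto
  qed (auto simp: V)
  have "kg D = K"
  proof
    show "kg D \<subseteq> K" by (rule kg_least[OF _ K]) (auto simp: D_def)
    have "kg (\<Union>n. V n) \<subseteq> kg D" using V_sub by (intro kg_le_kg) auto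
    then show "K \<subseteq> kg D" using sub by auto
  qed
  moreover have "countable (labs ` D)" using C(1) by (auto simp: D_def)
  ultimately show ?thesis
    by (intro exI[of _ "labs ` D"]) (simp add: kg_labs_image)
qed

text \<open>The set \<open>W n\<close> separates \<open>V n\<close> from the complement of
  \<open>U\<close>; its image lies in the pseudocomplement of \<open>f (V n)\<close> and supplies
  the cover for \<open>countably_generated\<close>.\<close>

lemma frame_map_countably_generated:
  fixes V W :: "nat \<Rightarrow> real set"
  assumes f: "f \<in> frame_maps L" and "open U" "\<And>n. open (V n)" "\<And>n. open (W n)"
    and "U = (\<Union>n. V n)" "\<And>n. V n \<inter> W n = {}" "\<And>n. W n \<union> U = UNIV"
  shows "\<exists>C. countable C \<and> (\<forall>k\<in>C. 0 \<le> k) \<and> kg C = f U"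
proof (rule countably_generated[of "f U" "\<lambda>n. f (V n)"])
  show "f U \<subseteq> kg (\<Union>n. f (V n))"
    using frame_map_UN[OF f, of UNIV V] assms(3,5) by simp
  fix n
  have "f (W n) \<subseteq> pcomp (f (V n))"
    using assms(3,4,6) by (intro frame_map_subset_pcomp[OF f]) (simp_all add: Int_commute)
  then have "kg (f (W n) \<union> f U) \<subseteq> kg (pcomp (f (V n)) \<union> f U)" by (intro hull_mono) auto
  moreover have "kg (f (W n) \<union> f U) = UNIV"
    using assms by (intro frame_map_cover[OF f]) auto
  ultimately show "kg (pcomp (f (V n)) \<union> f U) = UNIV" by auto
qed (use assms frame_mapsD(2)[OF f] in auto)

lemma coz_countably_generated:
  assumes f: "f \<in> frame_maps L"
  shows "\<exists>C. countable C \<and> (\<forall>k\<in>C. 0 \<le> k) \<and> kg C = coz f"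
  unfolding coz_def
proof (rule frame_map_countably_generated[OF f, of "UNIV - {0}"
      "\<lambda>n. {x. inverse (real (Suc n)) < \<bar>x\<bar>}" "\<lambda>n. {x. \<bar>x\<bar> < inverse (real (Suc n))}"])
  show "open (UNIV - {0 :: real})" by (intro open_Diff) auto
  show "UNIV - {0 :: real} = (\<Union>n. {x. inverse (real (Suc n)) < \<bar>x\<bar>})"
  proof (intro equalityI subsetI)
    fix x :: real assume "x \<in> UNIV - {0}"
    then have "0 < \<bar>x\<bar>" by simp
    then show "x \<in> (\<Union>n. {x. inverse (real (Suc n)) < \<bar>x\<bar>})"
      using reals_Archimedean by fastforce
  qed (auto simp: not_less)
qed (auto intro!: open_Collect_less continuous_intros simp: f)

lemma upper_ray_countably_generated:
  assumes f: "f \<in> frame_maps L"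
  shows "\<exists>C. countable C \<and> (\<forall>k\<in>C. 0 \<le> k) \<and> kg C = f {c<..}"
proof (rule frame_map_countably_generated[OF f, of "{c<..}"
      "\<lambda>n. {c + inverse (real (Suc n))<..}" "\<lambda>n. {..<c + inverse (real (Suc n))}"])
  show "{c<..} = (\<Union>n. {c + inverse (real (Suc n))<..})"
  proof (intro equalityI subsetI)
    fix x assume "x \<in> {c<..}"
    then have "0 < x - c" by simp
    then obtain n where "inverse (real (Suc n)) < x - c" using reals_Archimedean by blast
    then show "x \<in> (\<Union>n. {c + inverse (real (Suc n))<..})" by (auto simp: algebra_simps)
  next
    fix x assume "x \<in> (\<Union>n. {c + inverse (real (Suc n))<..})"
    then obtain n where "c + inverse (real (Suc n)) < x" by auto
    moreover have "0 < inverse (real (Suc n))" by simp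
    ultimately show "x \<in> {c<..}" unfolding greaterThan_iff by linarith
  qed
  fix n
  have n: "0 < inverse (real (Suc n))" by simp
  show "{..<c + inverse (real (Suc n))} \<union> {c<..} = UNIV"
  proof (intro equalityI subsetI)
    fix x :: real
    have "x < c + inverse (real (Suc n)) \<or> c < x" using n by linarith
    then show "x \<in> {..<c + inverse (real (Suc n))} \<union> {c<..}" by auto
  qed simp
qed (auto simp: f)

text \<open>
  If the truncations \<open>n k \<and> 1\<close> of generators \<open>k\<close> of a kernel have a pointwise supremum, then the
  supremum is the characteristic function of the kernel: its rays at \<open>0\<close> and \<open>1/2\<close> both equal the
  kernel, which is therefore complemented.
\<close>

lemma complemented_if_sup:
  assumes nonneg: "\<And>k. k \<in> C \<Longrightarrow> 0 \<le> k"
    and sup: "pointwise_sup G {inf (mul (int n) k) u | n k. k \<in> C} f"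
  shows "complemented L (kg C)"
proof -
  let ?F = "{inf (mul (int n) k) u | n k. k \<in> C}"
  have sup: "upper f r = kg (\<Union>g\<in>?F. upper g r)" for r
    using sup by (simp add: pointwise_sup_iff)
  have ray0: "upper g 0 = kg {pprt g}" for g
    using upper_rational[of 1 g 0] by (simp add: ray_def)
  have ray2: "upper g (1 / 2) = ray g 1 2" for g
    using upper_rational[of 2 g 1] by simp
  have "upper f 0 \<subseteq> kg C"
    unfolding sup
  proof (intro kg_le_kg UN_least)
    fix g assume "g \<in> ?F"
    then obtain n k where g: "g = inf (mul (int n) k) u" "k \<in> C" by blast
    have "pprt g \<in> kg C"
    proof (rule w_ideal_le[OF w_ideal_kg])
      show "mul (int n) k \<in> kg C" using g(2) by (intro w_ideal_mul[OF w_ideal_kg] hull_inc)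
      show "pprt g \<le> mul (int n) k" using g nonneg by (simp add: pprt_le_iff mul_nonneg)
    qed simp
    then show "upper g 0 \<subseteq> kg C" by (simp add: ray0 kg_least)
  qed
  moreover have "pprt f \<in> upper f 0" by (simp add: ray0 hull_inc)
  ultimately have 1: "pprt (mul 2 f) \<in> kg (kg C \<union> pcomp (kg C))"
    using hull_subset[of "kg C \<union> pcomp (kg C)" "w_kernel G"] by (auto simp: pprt_mul_mem)
  let ?J = "upper f (1 / 2)"
  have "k \<in> ?J" if k: "k \<in> C" for k
  proof -
    \<comment> \<open>The unit rule undoes the truncation: the infimum of this element with
      \<open>u\<close> is the positive part of \<open>2 (inf (n k) u) - u\<close>, which lies in the
      ray of a truncation at 1/2. The archimedean rule then yields \<open>mul 2 k\<close>.\<close>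
    have "pprt (mul (int n) (mul 2 k) - u) \<in> ?J" for n
    proof (rule w_idealD(5)[OF w_ideal_upper zero_le_pprt])
      let ?g = "inf (mul (int n) k) u"
      have "mul 2 u - u = u" using mul.scale_left_distrib[of 1 1 u] by simp
      then have "mul 2 ?g - u = inf (mul (int n) (mul 2 k) - u) u"
        using add_inf_distrib_right[of "mul 2 (mul (int n) k)" "mul 2 u" "- u"]
        by (simp add: mul_inf mult.commute)
      then have "pprt (mul 2 ?g - mul 1 u) = inf (pprt (mul (int n) (mul 2 k) - u)) u"
        using unit_nonneg by (simp add: pprt_inf)
      moreover have "pprt (mul 2 ?g - mul 1 u) \<in> upper ?g (1 / 2)"
        unfolding ray2 by (rule ray_mem)
      moreover have "upper ?g (1 / 2) \<subseteq> ?J"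
        unfolding sup using k by (intro order_trans[OF _ hull_subset] UN_upper) blast
      ultimately show "inf (pprt (mul (int n) (mul 2 k) - u)) u \<in> ?J" by auto
    qed
    then have "mul 2 k \<in> ?J"
      by (rule w_idealD(4)[OF w_ideal_upper mul_nonneg[OF _ nonneg[OF k]] unit_nonneg, rotated]) simp
    moreover have "k \<le> mul 2 k" using mul_mono_left[of 1 2 k] nonneg[OF k] by simp
    ultimately show ?thesis by (rule w_ideal_le[OF w_ideal_upper _ nonneg[OF k]])
  qed
  then have "kg C \<subseteq> ray f 1 2" unfolding ray2[symmetric] by (intro kg_least) auto
  then have "pcomp (ray f 1 2) \<subseteq> pcomp (kg C)" by (rule pcomp_antimono)
  moreover have "pprt (mul 1 u - mul 2 f) \<in> pcomp (ray f 1 2)" by (rule ray_disjoint) simp_all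
  ultimately have 2: "pprt (mul 1 u - mul 2 f) \<in> kg (kg C \<union> pcomp (kg C))"
    by (intro hull_inc) auto
  \<comment> \<open>The two elements are the positive parts of \<open>2 f\<close> and
    \<open>u - 2 f\<close>, whose sum is \<open>u\<close>: the first lies in the kernel, the second
    in its pseudocomplement.\<close>
  show ?thesis
    unfolding complemented_iff[OF w_ideal_kg]
    by (rule kg_eq_UNIV, rule unit_mem_if_diff[OF w_ideal_kg _ 1 2, of 1]) simp_all
qed

lemma truncations_bounded:
  assumes "\<And>k. k \<in> C \<Longrightarrow> 0 \<le> k"
  shows "{inf (mul (int n) k) u | n k. k \<in> C} \<subseteq> bounded_part G"
proof
  fix g assume "g \<in> {inf (mul (int n) k) u | n k. k \<in> C}"
  then obtain n k where g: "g = inf (mul (int n) k) u" "k \<in> C" by blast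
  have "0 \<le> g" using g assms[of k] unit_nonneg by (simp add: mul_nonneg)
  then have "labs g \<le> mul (int 1) u" using g by simp
  then show "g \<in> bounded_part G" unfolding mem_bounded_part by blast
qed

lemma unit_bounded: "u \<in> bounded_part G"
  unfolding mem_bounded_part using unit_nonneg by (intro exI[of _ 1]) simp

lemma boolean_if_complete:
  assumes "cond_pointwise_complete G"
  shows "boolean_frame L"
  unfolding boolean_frame_def
proof
  fix K assume "K \<in> carrier L"
  then have K: "w_ideal u K" by (simp add: carrier_L)
  let ?C = "{k \<in> K. 0 \<le> k}"
  let ?F = "{inf (mul (int n) k) u | n k. k \<in> ?C}"
  have "\<exists>f\<in>bounded_part G. pointwise_sup G ?F f"
  proof (rule assms[unfolded cond_pointwise_complete_def, rule_format], intro conjI)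
    show "?F \<subseteq> bounded_part G" by (rule truncations_bounded) simp
    show "?F \<noteq> {}" using w_idealD(1)[OF K] by blast
    show "\<exists>b\<in>bounded_part G. \<forall>f\<in>?F. lle G f b" using unit_bounded by (intro bexI[of _ u]) auto
  qed
  then obtain f where "pointwise_sup G ?F f" by blast
  then have "complemented L (kg ?C)" by (intro complemented_if_sup) auto
  moreover have "kg ?C = K"
  proof
    show "kg ?C \<subseteq> K" by (rule kg_least[OF _ K]) auto
    have "labs ` K \<subseteq> ?C" using w_ideal_labs[OF K] by auto
    then have "kg (labs ` K) \<subseteq> kg ?C" by (rule hull_mono)
    then show "K \<subseteq> kg ?C" using kg_same[OF K] by (simp add: kg_labs_image)
  qed
  ultimately show "complemented L K" by simp
qed

lemma P_frame_if_sigma_complete: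
  assumes "cond_pointwise_sigma_complete G"
  shows "P_frame L"
  unfolding P_frame_def
proof
  fix h assume "h \<in> frame_maps L"
  then obtain D where D: "countable D" "\<forall>k\<in>D. 0 \<le> k" "kg D = coz h"
    using coz_countably_generated by blast
  \<comment> \<open>Adjoining 0 keeps the family of truncations nonempty when \<open>D\<close> is
    empty, and does not alter the kernel.\<close>
  let ?C = "insert 0 D"
  let ?F = "{inf (mul (int n) k) u | n k. k \<in> ?C}"
  have nonneg: "0 \<le> k" if "k \<in> ?C" for k using that D(2) by auto
  have "\<exists>f\<in>bounded_part G. pointwise_sup G ?F f"
  proof (rule assms[unfolded cond_pointwise_sigma_complete_def, rule_format], intro conjI)
    show "?F \<subseteq> bounded_part G" by (rule truncations_bounded[OF nonneg])
    show "?F \<noteq> {}" by blast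
    have "?F = (\<lambda>(n, k). inf (mul (int n) k) u) ` (UNIV \<times> ?C)" by auto
    then show "countable ?F" using D(1) by simp
    show "\<exists>b\<in>bounded_part G. \<forall>f\<in>?F. lle G f b" using unit_bounded by (intro bexI[of _ u]) auto
  qed
  then obtain f where "pointwise_sup G ?F f" by blast
  then have "complemented L (kg ?C)" using complemented_if_sup[of ?C f] nonneg by blast
  moreover have "kg ?C = kg D"
    by (intro equalityI kg_le_kg hull_mono) (auto simp: w_idealD(1)[OF w_ideal_kg] hull_inc)
  ultimately show "complemented L (coz h)" using D(3) by simp
qed

subsection \<open>Complementation implies pointwise completeness\<close>

lemma complemented_zero: "complemented L {0}"
  using kg_eq_UNIV[of "{0} \<union> pcomp {0}"] by (simp add: complemented_iff w_ideal_zero pcomp_zero hull_inc)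

text \<open>Distributing the meet of the two covers given by \<open>K\<close> and \<open>K'\<close>
  leaves pieces below \<open>K\<close>, below \<open>K'\<close>, or in
  \<open>pcomp K \<inter> pcomp K'\<close>; the last is disjoint from the join.\<close>

lemma complemented_kg_Un:
  assumes K: "w_ideal u K" "complemented L K" and K': "w_ideal u K'" "complemented L K'"
  shows "complemented L (kg (K \<union> K'))"
proof -
  let ?J = "kg (kg (K \<union> K') \<union> pcomp (kg (K \<union> K')))"
  have J: "kg (K \<union> K') \<subseteq> ?J" "pcomp (kg (K \<union> K')) \<subseteq> ?J" by (auto intro: hull_inc)
  have "pcomp K \<inter> pcomp K' \<subseteq> pcomp (kg (K \<union> K'))"
  proof
    fix g assume g: "g \<in> pcomp K \<inter> pcomp K'"
    then have "K \<union> K' \<subseteq> pcomp {g}" by (auto simp: pcomp_def inf_commute)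
    then have "kg (K \<union> K') \<subseteq> pcomp {g}" by (intro kg_least) simp_all
    then show "g \<in> pcomp (kg (K \<union> K'))" by (auto simp: pcomp_def inf_commute)
  qed
  then have 1: "pcomp K \<inter> pcomp K' \<subseteq> ?J" using J by auto
  have 2: "K \<subseteq> ?J" "K' \<subseteq> ?J" using J(1) hull_subset[of "K \<union> K'" "w_kernel G"] by auto
  have "kg (\<Union>{K, pcomp K}) \<inter> kg (\<Union>{K', pcomp K'}) \<subseteq> ?J"
    using 1 2 K K' by (intro kg_Int_kg_subset) auto
  then show ?thesis
    using K K' by (simp add: complemented_iff) auto
qed

lemma complemented_kg_finite:
  assumes "finite N" "\<And>n. n \<in> N \<Longrightarrow> w_ideal u (c n)" "\<And>n. n \<in> N \<Longrightarrow> complemented L (c n)"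
  shows "complemented L (kg (\<Union>n\<in>N. c n))"
  using assms
proof (induction N)
  case empty
  have "kg {} = {0}" using kg_least[OF _ w_ideal_zero, of "{}"] w_idealD(1)[OF w_ideal_kg, of "{}"] by auto
  then show ?case using complemented_zero by simp
next
  case (insert n N)
  have "kg (c n \<union> kg (\<Union>n\<in>N. c n)) = kg (\<Union>n\<in>insert n N. c n)"
  proof
    have "kg (\<Union>n\<in>N. c n) \<subseteq> kg (\<Union>n\<in>insert n N. c n)" by (rule hull_mono) auto
    then show "kg (c n \<union> kg (\<Union>n\<in>N. c n)) \<subseteq> kg (\<Union>n\<in>insert n N. c n)"
      by (intro kg_le_kg) (auto intro: hull_inc)
    show "kg (\<Union>n\<in>insert n N. c n) \<subseteq> kg (c n \<union> kg (\<Union>n\<in>N. c n))"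
      by (rule hull_mono) (auto intro: hull_inc)
  qed
  moreover have "complemented L (kg (c n \<union> kg (\<Union>n\<in>N. c n)))"
    using insert by (intro complemented_kg_Un) auto
  ultimately show ?case by simp
qed

text \<open>The join is the cozero element of the frame map with rays \<open>\<Squnion>{c n | 1/(n+1) > r}\<close>, \<open>r \<ge> 0\<close>.\<close>

lemma P_frame_complemented_UN:
  fixes c :: "nat \<Rightarrow> 'a set"
  assumes P: "P_frame L" and w_ideal: "\<And>n. w_ideal u (c n)" and c: "\<And>n. complemented L (c n)"
  shows "complemented L (kg (\<Union>n. c n))"
proof -
  define N where "N r = {n. r < inverse (real (Suc n))}" for r
  define A where "A r = (if r < 0 then UNIV else kg (\<Union>n\<in>N r. c n))" for r
  \<comment> \<open>For positive \<open>r\<close> only finitely many \<open>n\<close> satisfy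
    \<open>r < 1/(n+1)\<close>, so \<open>A r\<close> is a finite join of complemented elements;
    only the ray at 0 remains in doubt.\<close>
  have A_compl: "complemented L (A r)" if "r \<noteq> 0" for r
  proof (cases "r < 0")
    case True
    have "kg (UNIV \<union> pcomp UNIV) = UNIV" by simp
    then show ?thesis using True by (simp add: A_def complemented_iff w_ideal_UNIV)
  next
    case False
    then have r: "0 < r" using that by simp
    have "N r \<subseteq> {..nat \<lceil>inverse r\<rceil>}"
    proof
      fix n assume "n \<in> N r"
      then have "real (Suc n) < inverse r"
        using r less_imp_inverse_less[of r "inverse (real (Suc n))"] by (simp add: N_def del: of_nat_Suc)
      then show "n \<in> {..nat \<lceil>inverse r\<rceil>}" by simp linarith
    qed
    then have "finite (N r)" by (rule finite_subset) simp
    then show ?thesis using False w_ideal c by (simp add: A_def complemented_kg_finite)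
  qed
  have wkA: "w_ideal u (A r)" for r by (simp add: A_def w_ideal_UNIV)
  have A_mono: "A s \<subseteq> A r" if "r \<le> s" for r s
  proof -
    have "N s \<subseteq> N r" using that by (auto simp: N_def)
    then have "kg (\<Union>n\<in>N s. c n) \<subseteq> kg (\<Union>n\<in>N r. c n)" by (intro hull_mono UN_mono) auto
    then show ?thesis using that by (simp add: A_def)
  qed
  obtain f where f: "f \<in> frame_maps L" "\<And>r. f {r<..} = A r"
  proof (rule frame_map_exists[of A])
    show "A r \<subseteq> kg (\<Union>s\<in>{r<..}. A s)" for r
    proof (cases "r < 0")
      case True
      then have "A (r / 2) = UNIV" "r / 2 \<in> {r<..}" by (simp_all add: A_def)
      then have "(\<Union>s\<in>{r<..}. A s) = UNIV" by blast
      then show ?thesis by simp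
    next
      case False
      have "c n \<subseteq> (\<Union>s\<in>{r<..}. A s)" if n: "n \<in> N r" for n
      proof -
        obtain s where s: "r < s" "s < inverse (real (Suc n))"
          using dense[of r "inverse (real (Suc n))"] n unfolding N_def by blast
        then have "c n \<subseteq> kg (\<Union>n\<in>N s. c n)"
          by (intro order_trans[OF UN_upper hull_subset]) (simp add: N_def)
        then have "c n \<subseteq> A s" using False s(1) by (simp add: A_def)
        then show ?thesis using s by auto
      qed
      then show ?thesis using False by (simp add: A_def hull_mono UN_least)
    qed
    have "A (- 1) = UNIV" by (simp add: A_def)
    then have "(\<Union>r. A r) = UNIV" by blast
    then show "kg (\<Union>r. A r) = UNIV" by simp
    have "N 1 = {}" by (auto simp: N_def inverse_eq_divide)
    then have "A 1 \<subseteq> {0}" using kg_least[OF _ w_ideal_zero, of "{}"] by (simp add: A_def)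
    then have "pcomp {0} \<subseteq> pcomp (A 1)" by (rule pcomp_antimono)
    then have "(\<Union>r. pcomp (A r)) = UNIV" unfolding pcomp_zero by blast
    then show "kg (\<Union>r. pcomp (A r)) = UNIV" by simp
    show "kg (A r \<union> pcomp (A s)) = UNIV" if rs: "r < s" for r s
    proof -
      \<comment> \<open>Separation needs one complemented ray between \<open>r\<close> and
        \<open>s\<close>, inclusive; when \<open>r = 0\<close>, the ray at \<open>s\<close>
        serves.\<close>
      obtain t where t: "r \<le> t" "t \<le> s" "t \<noteq> 0"
        using rs that[of r] that[of s] by (cases "r = 0") auto
      have "kg (A t \<union> pcomp (A t)) \<subseteq> kg (A r \<union> pcomp (A s))"
        using A_mono[OF t(1)] pcomp_antimono[OF A_mono[OF t(2)]] by (intro hull_mono) auto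
      then show ?thesis using A_compl[OF t(3)] by (auto simp: complemented_iff wkA)
    qed
  qed (use wkA A_mono in auto)
  have "f {..<0} = {0}" using f by (intro frame_map_lower_ray_zero) (auto simp: A_def)
  moreover have "UNIV - {0 :: real} = {..<0} \<union> {0<..}" by auto
  ultimately have "coz f = kg ({0} \<union> A 0)"
    using frame_map_Un[OF f(1), of "{..<0}" "{0<..}"] f(2)[of 0] by (simp add: coz_def)
  also have "\<dots> = A 0" using kg_same[OF wkA, of 0] w_idealD(1)[OF wkA, of 0] by (simp add: insert_absorb)
  also have "\<dots> = kg (\<Union>n. c n)" by (simp add: A_def N_def)
  finally show ?thesis using P f(1) by (auto simp: P_frame_def)
qed

text \<open>Composing \<open>f\<close> with the continuous map that sends \<open>x\<close> to the
  larger of \<open>x - s\<close> and 0 exhibits the ray as a cozero element.\<close>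

lemma P_frame_upper_ray:
  assumes P: "P_frame L" and f: "f \<in> frame_maps L"
  shows "complemented L (f {s<..})"
proof -
  define g where "g = (\<lambda>U\<in>{U. open U}. f ((\<lambda>x. max (x - s) 0) -` U))"
  have vim: "open ((\<lambda>x. max (x - s) 0) -` U)" if "open U" for U
    using that by (intro open_vimage continuous_intros)
  have g: "g U = f ((\<lambda>x. max (x - s) 0) -` U)" if "open U" for U using that by (simp add: g_def)
  note D = frame_mapsD[OF f]
  have "g \<in> frame_maps L"
    unfolding frame_maps_iff
  proof (intro conjI allI impI)
    show "g \<in> extensional {U. open U}" by (simp add: g_def)
    fix \<U> :: "real set set" assume *: "\<forall>U\<in>\<U>. open U"
    have "f ((\<lambda>x. max (x - s) 0) -` \<Union>\<U>) = kg (\<Union>U\<in>\<U>. f ((\<lambda>x. max (x - s) 0) -` U))"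
      unfolding vimage_Union using * vim by (intro frame_map_UN[OF f]) auto
    also have "(\<Union>U\<in>\<U>. f ((\<lambda>x. max (x - s) 0) -` U)) = \<Union>(g ` \<U>)" using * by (simp add: g)
    finally show "g (\<Union>\<U>) = kg (\<Union>(g ` \<U>))" using * by (simp add: g open_Union)
  qed (auto simp: g D vim open_Int)
  moreover have "coz g = f {s<..}"
  proof -
    have "(\<lambda>x. max (x - s) 0) -` (UNIV - {0}) = {s<..}" by (auto simp: max_def split: if_splits)
    moreover have "open (UNIV - {0 :: real})" by (intro open_Diff) auto
    ultimately show ?thesis by (simp add: coz_def g)
  qed
  ultimately show ?thesis using P by (auto simp: P_frame_def)
qed

lemma upper_eq_frame_map: "upper g r = madden_rep G g {r<..}"
  by (simp add: madden_rep_upper)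

text \<open>The joins of rays inherit monotonicity and continuity from the members of
  \<open>F\<close>, and boundedness from one member and \<open>b\<close>; complementedness enters
  for the separation of rays.\<close>

lemma sup_exists:
  assumes onto: "madden_rep_onto_bounded G"
    and F: "F \<subseteq> bounded_part G" "F \<noteq> {}" and b: "b \<in> bounded_part G" "\<And>f. f \<in> F \<Longrightarrow> f \<le> b"
    and compl: "\<And>r. complemented L (kg (\<Union>f\<in>F. upper f r))"
  shows "\<exists>f\<^sub>0\<in>bounded_part G. pointwise_sup G F f\<^sub>0"
proof -
  define A where "A r = kg (\<Union>f\<in>F. upper f r)" for r
  have wkA: "w_ideal u (A r)" for r by (simp add: A_def)
  have A_mono: "A s \<subseteq> A r" if "r \<le> s" for r s
    unfolding A_def using upper_antimono[OF that] by (intro hull_mono UN_mono) auto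
  obtain f1 where f1: "f1 \<in> F" using F(2) by auto
  obtain m where m: "labs f1 \<le> mul (int m) u" using f1 F(1) mem_bounded_part by blast
  obtain n where n: "labs b \<le> mul (int n) u" using b(1) by (auto simp: mem_bounded_part)
  have A_UNIV: "A r = UNIV" if "r < - real m" for r
  proof -
    have "upper f1 r = UNIV" using that by (intro upper_eq_UNIV[OF labs_le_bounds(2)[OF m]]) simp
    then have "(\<Union>f\<in>F. upper f r) = UNIV" using f1 by blast
    then show ?thesis by (simp add: A_def)
  qed
  have A_zero: "A r = {0}" if "real n \<le> r" for r
  proof -
    have "upper f r = {0}" if "f \<in> F" for f
      using order_trans[OF b(2)[OF that] labs_le_bounds(1)[OF n]] \<open>real n \<le> r\<close>
      by (intro upper_eq_zero[of f "int n"]) simp_all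
    then have "(\<Union>f\<in>F. upper f r) = {0}" using f1 by blast
    then show ?thesis using kg_same[OF w_ideal_zero] by (simp add: A_def)
  qed
  obtain h where h: "h \<in> frame_maps L" "\<And>r. h {r<..} = A r"
  proof (rule frame_map_exists[of A])
    have "A (- real m - 1) = UNIV" by (rule A_UNIV) simp
    then have "(\<Union>r. A r) = UNIV" by blast
    then show "kg (\<Union>r. A r) = UNIV" by simp
    have "pcomp (A (real n)) = UNIV" by (simp add: A_zero pcomp_zero)
    then have "(\<Union>r. pcomp (A r)) = UNIV" by blast
    then show "kg (\<Union>r. pcomp (A r)) = UNIV" by simp
    show "A r \<subseteq> kg (\<Union>s\<in>{r<..}. A s)" for r
    proof -
      have "upper f r \<subseteq> kg (\<Union>s\<in>{r<..}. A s)" if "f \<in> F" for f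
      proof -
        have "upper f r = kg (\<Union>s\<in>{r<..}. upper f s)"
          using frame_map_ray[OF madden_rep_frame_map, of f r] by (simp add: madden_rep_upper)
        also have "\<dots> \<subseteq> kg (\<Union>s\<in>{r<..}. A s)"
        proof (intro hull_mono UN_mono order_refl)
          fix s show "upper f s \<subseteq> A s" using that by (auto simp: A_def intro: hull_inc)
        qed
        finally show ?thesis .
      qed
      then show ?thesis unfolding A_def[of r] by (intro kg_le_kg UN_least)
    qed
    show "kg (A r \<union> pcomp (A s)) = UNIV" if "r < s" for r s
    proof -
      have "kg (A s \<union> pcomp (A s)) \<subseteq> kg (A r \<union> pcomp (A s))"
        using A_mono[of r s] that by (intro hull_mono) auto
      moreover have "complemented L (A s)" using compl by (simp add: A_def)
      ultimately show ?thesis by (auto simp: complemented_iff wkA)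
    qed
  qed (use wkA A_mono in auto)
  have "h \<in> bounded_part (RL L)"
    unfolding mem_bounded_part_RL
  proof (intro conjI exI)
    show "h {real (max m n)<..} = {0}" by (simp add: h A_zero)
    show "h {..<- real (max m n)} = {0}"
    proof (rule frame_map_lower_ray_zero[OF h(1)])
      fix r assume "r < - real (max m n)"
      then show "h {r<..} = UNIV" unfolding h(2) by (intro A_UNIV) linarith
    qed
  qed (rule h(1))
  then obtain g where g: "g \<in> bounded_part G" "h = madden_rep G g"
    using onto by (auto simp: madden_rep_onto_bounded_def)
  have "upper g r = A r" for r using g(2) h(2) by (simp add: upper_eq_frame_map)
  then show ?thesis using g(1) by (auto simp: pointwise_sup_iff A_def)
qed

lemma complete_if_boolean:
  assumes "boolean_frame L" "madden_rep_onto_bounded G"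
  shows "cond_pointwise_complete G"
  unfolding cond_pointwise_complete_def
proof (intro allI impI)
  fix F assume F: "F \<subseteq> bounded_part G \<and> F \<noteq> {} \<and> (\<exists>b\<in>bounded_part G. \<forall>f\<in>F. lle G f b)"
  then obtain b where b: "b \<in> bounded_part G" "\<forall>f\<in>F. f \<le> b" by auto
  show "\<exists>f\<^sub>0\<in>bounded_part G. pointwise_sup G F f\<^sub>0"
  proof (rule sup_exists[OF assms(2) _ _ b(1)])
    show "F \<subseteq> bounded_part G" "F \<noteq> {}" using F by simp_all
    show "f \<le> b" if "f \<in> F" for f using b(2) that by (rule bspec)
    show "complemented L (kg (\<Union>f\<in>F. upper f r))" for r
      using assms(1) by (simp add: boolean_frame_def carrier_L)
  qed
qed

lemma sigma_complete_if_P_frame: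
  assumes P: "P_frame L" and onto: "madden_rep_onto_bounded G"
  shows "cond_pointwise_sigma_complete G"
  unfolding cond_pointwise_sigma_complete_def
proof (intro allI impI)
  fix F
  assume F: "F \<subseteq> bounded_part G \<and> F \<noteq> {} \<and> countable F \<and> (\<exists>b\<in>bounded_part G. \<forall>f\<in>F. lle G f b)"
  then obtain b where b: "b \<in> bounded_part G" "\<forall>f\<in>F. f \<le> b" by auto
  have compl: "complemented L (kg (\<Union>f\<in>F. upper f r))" for r
  proof -
    obtain e :: "nat \<Rightarrow> 'a" where e: "F = range e"
      using F range_from_nat_into[of F] by metis
    have "complemented L (kg (\<Union>n. upper (e n) r))"
      by (rule P_frame_complemented_UN[OF P])
        (simp_all add: upper_eq_frame_map P_frame_upper_ray[OF P] madden_rep_frame_map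
          frame_mapsD(2)[OF madden_rep_frame_map])
    then show ?thesis by (simp only: e image_image)
  qed
  show "\<exists>f\<^sub>0\<in>bounded_part G. pointwise_sup G F f\<^sub>0"
  proof (rule sup_exists[OF onto _ _ b(1)])
    show "F \<subseteq> bounded_part G" "F \<noteq> {}" using F by simp_all
    show "f \<le> b" if "f \<in> F" for f using b(2) that by (rule bspec)
  qed (rule compl)
qed

lemma small_unit_multiples_if_onto:
  assumes "madden_rep_onto_bounded G"
  shows "small_unit_multiples G"
  unfolding small_unit_multiples_def
proof (intro allI impI)
  fix \<epsilon> :: real assume "0 < \<epsilon>"
  then obtain r where r: "0 < r" "r < min \<epsilon> 1" using dense[of 0 "min \<epsilon> 1"] by auto
  have "rl_const L r \<in> bounded_part (RL L)"
    unfolding mem_bounded_part_RL using r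
    by (intro conjI exI[of _ 1] rl_const_frame_map) (auto simp: rl_const_apply)
  then have "rl_const L r \<in> madden_rep G ` bounded_part G"
    using assms by (simp add: madden_rep_onto_bounded_def)
  then show "\<exists>r>0. r < \<epsilon> \<and> rl_const L r \<in> madden_rep G ` carrier G"
    using r by (intro exI[of _ r]) auto
qed

subsection \<open>Surjectivity on the bounded part\<close>

text \<open>Rational rays are the convenient ones: there \<open>upper\<close> is a single principal
  kernel by \<open>upper_rational\<close>.\<close>

lemma frame_map_eqI_rational:
  assumes f: "f \<in> frame_maps L" and g: "g \<in> frame_maps L"
    and eq: "\<And>p q. 0 < q \<Longrightarrow> f {of_int p / of_nat q<..} = g {of_int p / of_nat q<..}"
  shows "f = g"
proof (rule frame_map_eqI[OF f g])
  fix r :: real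
  define I where "I = {(p, q). 0 < q \<and> r < of_int p / of_nat q}"
  have "{r<..} = (\<Union>i\<in>I. {of_int (fst i) / of_nat (snd i)<..})"
  proof (intro equalityI subsetI)
    fix x assume "x \<in> {r<..}"
    then have "r < x" by simp
    then obtain p q where "0 < q" "r < of_int p / of_nat q" "of_int p / of_nat q < x"
      by (rule rational_between)
    then show "x \<in> (\<Union>i\<in>I. {of_int (fst i) / of_nat (snd i)<..})"
      by (intro UN_I[of "(p, q)"]) (auto simp: I_def)
  qed (auto simp: I_def)
  moreover have "f (\<Union>i\<in>I. {of_int (fst i) / of_nat (snd i)<..}) = g (\<Union>i\<in>I. {of_int (fst i) / of_nat (snd i)<..})"
  proof -
    have "(\<Union>i\<in>I. f {of_int (fst i) / of_nat (snd i)<..}) = (\<Union>i\<in>I. g {of_int (fst i) / of_nat (snd i)<..})"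
      by (intro SUP_cong refl eq) (auto simp: I_def)
    then show ?thesis
      by (subst frame_map_UN[OF f], simp, subst frame_map_UN[OF g]) simp_all
  qed
  ultimately show "f {r<..} = g {r<..}" by simp
qed

text \<open>
  A positive element \<open>w\<close> acting as the constant \<open>t > 0\<close>. Rays at negative numbers are omitted, so
  that the property passes from \<open>w\<close> to its positive part.
\<close>

definition const_like :: "'a \<Rightarrow> real \<Rightarrow> bool" where
  "const_like w t \<longleftrightarrow> 0 \<le> w \<and>
     (\<forall>p q. 0 \<le> p \<longrightarrow> 0 < q \<longrightarrow> ray w p (int q) = (if of_int p / of_nat q < t then UNIV else {0}))"

text \<open>A ray of \<open>j w\<close> at \<open>p / q\<close> is the ray of \<open>w\<close> at
  \<open>p / (q j)\<close>. Passing to the positive part is invisible because \<open>p\<close> is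
  nonnegative.\<close>

lemma const_like_multiple:
  assumes w: "madden_rep G w = rl_const L r" and j: "0 < j"
  shows "const_like (pprt (mul (int j) w)) (real j * r)"
  unfolding const_like_def
proof (intro conjI allI impI)
  fix p :: int and q :: nat assume p: "0 \<le> p" and q: "0 < q"
  let ?w = "mul (int j) w"
  have "ray (pprt ?w) p (int q) = ray ?w p (int q)"
    using mul_nonneg[OF p unit_nonneg] pprt_pprt_diff[of "mul p u" "mul (int q) ?w"]
    by (simp add: ray_def flip: pprt_mul)
  also have "\<dots> = ray w p (int (q * j))" by (simp add: ray_def)
  also have "\<dots> = upper w (of_int p / of_nat (q * j))" using q j by (intro upper_rational[symmetric]) simp
  also have "\<dots> = (if of_int p / of_nat (q * j) < r then UNIV else {0})"
    by (simp only: upper_eq_frame_map w rl_const_apply open_greaterThan greaterThan_iff)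
  also have "of_int p / of_nat (q * j) < r \<longleftrightarrow> of_int p / of_nat q < real j * r"
    using q j by (simp add: field_simps)
  finally show "ray (pprt ?w) p (int q) = (if of_int p / of_nat q < real j * r then UNIV else {0})" .
qed simp

lemma const_like_le:
  assumes "const_like w t" "0 \<le> p" "0 < q" "t \<le> of_int p / of_nat q"
  shows "mul (int q) w \<le> mul p u"
proof -
  have "pprt (mul (int q) w - mul p u) \<in> {0}"
    using assms ray_mem[of "int q" w p] by (simp add: const_like_def)
  then show ?thesis by (simp flip: le_zero_iff_zero_pprt)
qed

text \<open>
  A bounded \<open>h\<close> is the pointwise supremum of the elements \<open>(n k \<and> w) - m\<close>, with \<open>w\<close> acting as the
  constant \<open>c + m\<close> and \<open>k\<close> ranging over generators of \<open>h(c, \<infinity>)\<close>: such an element is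
  \<open>(n k \<and> (c + m)) - m\<close>, which for large \<open>n\<close> is near \<open>c\<close> where \<open>k\<close> does not vanish.
\<close>

lemma onto_if_sigma_complete:
  assumes small: "small_unit_multiples G" and complete: "cond_pointwise_sigma_complete G"
  shows "madden_rep_onto_bounded G"
  unfolding madden_rep_onto_bounded_def
proof (intro equalityI subsetI)
  fix h assume "h \<in> madden_rep G ` bounded_part G"
  then show "h \<in> bounded_part (RL L)" using madden_rep_bounded by auto
next
  fix h assume "h \<in> bounded_part (RL L)"
  then obtain m :: nat where h: "h \<in> frame_maps L" and m: "h {real m<..} = {0}" "h {..<- real m} = {0}"
    by (auto simp: mem_bounded_part_RL)
  have h_mono: "h {s<..} \<subseteq> h {r<..}" if "r \<le> s" for r s
    using that by (intro frame_map_mono[OF h]) auto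
  have h_UNIV: "h {r<..} = UNIV" if "r < - real m" for r
  proof -
    have "{r<..} \<union> {..<- real m} = UNIV" using that by auto
    then have "kg (h {r<..} \<union> {0}) = UNIV" using frame_map_cover[OF h, of "{r<..}" "{..<- real m}"] m by simp
    moreover have "h {r<..} \<union> {0} = h {r<..}" using w_idealD(1)[OF frame_mapsD(2)[OF h]] by auto
    ultimately show ?thesis using kg_same[OF frame_mapsD(2)[OF h, of "{r<..}"]] by simp
  qed
  have "\<forall>i. \<exists>r w. 0 < r \<and> r < inverse (real (Suc i)) \<and> madden_rep G w = rl_const L r"
    using small[unfolded small_unit_multiples_def] by (force dest: spec[of _ "inverse (real (Suc _))"])
  then obtain \<rho> v where v: "\<And>i. 0 < \<rho> i" "\<And>i. \<rho> i < inverse (real (Suc i))"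
    "\<And>i. madden_rep G (v i) = rl_const L (\<rho> i)"
    by metis
  have "\<forall>c. \<exists>C. countable C \<and> (\<forall>k\<in>C. 0 \<le> k) \<and> kg C = h {c<..}"
    using upper_ray_countably_generated[OF h] by blast
  then obtain D where D: "\<And>c. countable (D c)" "\<And>c k. k \<in> D c \<Longrightarrow> 0 \<le> k" "\<And>c. kg (D c) = h {c<..}"
    by metis
  \<comment> \<open>For fixed \<open>i\<close> the levels form a grid of mesh
    \<open>\<rho> i\<close> above \<open>- m\<close>; the shift by \<open>m\<close> keeps the
    constants imitated by \<open>w i j\<close> positive, where \<open>const_like\<close>
    applies.\<close>
  define level where "level i j = real j * \<rho> i - real m" for i j
  define w where "w i j = pprt (mul (int j) (v i))" for i j :: nat
  have w: "const_like (w i j) (level i j + real m)" if "0 < j" for i j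
    using const_like_multiple[OF v(3) that, of i] by (simp add: w_def level_def)
  define T where "T n k i j = inf (mul (int n) k) (w i j) - mul (int m) u" for n k i j
  define I where "I = {(i, j). 0 < j \<and> level i j \<le> real m}"
  \<comment> \<open>The constant \<open>- m\<close> makes \<open>F\<close> nonempty and provides the
    full rays below \<open>- m\<close> that \<open>h\<close> has.\<close>
  define F where "F = insert (mul (- int m) u) (\<Union>(i, j)\<in>I. (\<lambda>(n, k). T n k i j) ` (UNIV \<times> D (level i j)))"
  have T_in: "T n k i j \<in> F" if "(i, j) \<in> I" "k \<in> D (level i j)" for n k i j
    unfolding F_def using that by force
  have F_cases: "g = mul (- int m) u \<or> (\<exists>n k i j. (i, j) \<in> I \<and> k \<in> D (level i j) \<and> g = T n k i j)"
    if "g \<in> F" for g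
    using that unfolding F_def by auto
  have T_bounds: "mul (- int m) u \<le> T n k i j" "T n k i j \<le> mul (int m) u"
    if "(i, j) \<in> I" "k \<in> D (level i j)" for n k i j
  proof -
    have j: "0 < j" "level i j \<le> real m" using that(1) by (auto simp: I_def)
    have "0 \<le> inf (mul (int n) k) (w i j)"
      using D(2)[OF that(2)] by (simp add: mul_nonneg w_def)
    then show "mul (- int m) u \<le> T n k i j" by (simp add: T_def)
    have "mul (int 1) (w i j) \<le> mul (int (2 * m)) u"
      using j by (intro const_like_le[OF w[OF j(1)]]) simp_all
    then have "w i j - mul (int m) u \<le> mul (int m) u"
      using mul.scale_left_distrib[of "int m" "int m" u] by (simp add: diff_le_eq)
    moreover have "T n k i j \<le> w i j - mul (int m) u" by (simp add: T_def)
    ultimately show "T n k i j \<le> mul (int m) u" by (rule order_trans[rotated])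
  qed
  have F_bounds: "mul (- int m) u \<le> g" "g \<le> mul (int m) u" if "g \<in> F" for g
  proof -
    have "mul (- int m) u \<le> mul (int m) u" by (rule mul_mono_left[OF _ unit_nonneg]) simp
    then show "mul (- int m) u \<le> g" "g \<le> mul (int m) u"
      using F_cases[OF that] T_bounds by auto
  qed
  have bounded: "g \<in> bounded_part G" if "mul (- int m) u \<le> g" "g \<le> mul (int m) u" for g
    unfolding mem_bounded_part using that by (intro exI[of _ m]) (simp add: labs_le_iff, metis minus_le_iff)
  have "\<exists>f\<in>bounded_part G. pointwise_sup G F f"
  proof (rule complete[unfolded cond_pointwise_sigma_complete_def, rule_format], intro conjI)
    show "F \<subseteq> bounded_part G" using F_bounds bounded by blast
    show "F \<noteq> {}" by (simp add: F_def)
    show "countable F" using D(1) by (auto simp: F_def)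
    have "mul (int m) u \<in> bounded_part G"
      by (rule bounded[OF mul_mono_left[OF _ unit_nonneg] order_refl]) simp
    then show "\<exists>b\<in>bounded_part G. \<forall>f\<in>F. lle G f b" using F_bounds(2) by auto
  qed
  then obtain f where f: "f \<in> bounded_part G" "\<And>r. upper f r = kg (\<Union>g\<in>F. upper g r)"
    by (auto simp: pointwise_sup_iff)
  have ray_T: "pprt (mul (int q) (T n k i j) - mul p u) =
      inf (pprt (mul (int q * int n) k - mul (p + int q * int m) u))
        (pprt (mul (int q) (w i j) - mul (p + int q * int m) u))" for n k i j p q
  proof -
    have "mul (int q) (T n k i j) - mul p u =
        inf (mul (int q * int n) k) (mul (int q) (w i j)) - mul (p + int q * int m) u"
      by (simp add: T_def mul_inf algebra_simps)
    also have "\<dots> = inf (mul (int q * int n) k - mul (p + int q * int m) u)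
        (mul (int q) (w i j) - mul (p + int q * int m) u)"
      using add_inf_distrib_right[of _ _ "- mul (p + int q * int m) u"] by (simp only: diff_conv_add_uminus)
    finally show ?thesis by (simp only: pprt_inf)
  qed
  have "madden_rep G f = h"
  proof (rule frame_map_eqI_rational[OF madden_rep_frame_map h])
    fix p :: int and q :: nat assume q: "0 < q"
    define r :: real where "r = of_int p / of_nat q"
    have upper_ray: "upper g r = ray g p (int q)" for g
      unfolding r_def by (rule upper_rational[OF q])
    have "upper f r = h {r<..}"
    proof (cases "r < - real m")
      case True
      have "upper (mul (- int m) u) r = UNIV" using True by (intro upper_eq_UNIV[OF order_refl]) simp
      moreover have "upper (mul (- int m) u) r \<subseteq> upper f r"
        unfolding f(2) by (intro order_trans[OF _ hull_subset] UN_upper) (simp add: F_def)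
      ultimately show ?thesis using h_UNIV[OF True] by auto
    next
      case False
      \<comment> \<open>For the unshifted truncation \<open>inf (n k) (w i j)\<close> the ray at
        \<open>r\<close> becomes the ray at \<open>r + m\<close>, which is nonnegative in this
        case.\<close>
      define p' where "p' = p + int q * int m"
      have p': "of_int p' / of_nat q = r + real m" using q by (simp add: p'_def r_def field_simps)
      then have "0 \<le> of_int p' / (of_nat q :: real)" using False by simp
      then have p'_nonneg: "0 \<le> p'" using q by (simp add: zero_le_divide_iff)
      have ray_w: "ray (w i j) p' (int q) = (if r < level i j then UNIV else {0})" if "0 < j" for i j
        using w[OF that, of i] p'_nonneg q by (simp add: const_like_def p')
      show ?thesis
      proof
        have "upper g r \<subseteq> h {r<..}" if gF: "g \<in> F" for g
        proof (cases "g = mul (- int m) u")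
          case True
          have "upper g r = {0}" unfolding True using False by (intro upper_eq_zero[OF order_refl]) simp
          then show ?thesis using w_idealD(1)[OF frame_mapsD(2)[OF h, of "{r<..}"]] by simp
        next
          case False
          then obtain n k i j where g: "(i, j) \<in> I" "k \<in> D (level i j)" "g = T n k i j"
            using F_cases[OF gF] by blast
          have j: "0 < j" using g(1) by (simp add: I_def)
          have "pprt (mul (int q) g - mul p u) \<in> h {r<..}"
          proof (cases "r < level i j")
            case True
            have "k \<in> h {level i j<..}" using g(2) D(3)[of "level i j"] hull_inc by metis
            then have "k \<in> h {r<..}" using h_mono[of r "level i j"] True by auto
            then have k: "mul (int (q * n)) k \<in> h {r<..}" by (intro w_ideal_mul[OF frame_mapsD(2)[OF h]]) simp
            have "mul (int q * int n) k - mul p' u \<le> mul (int q * int n) k"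
              using mul_nonneg[OF p'_nonneg unit_nonneg] by simp
            then have "pprt (mul (int q * int n) k - mul p' u) \<le> mul (int (q * n)) k"
              using D(2)[OF g(2)] by (simp add: pprt_le_iff mul_nonneg)
            then have "pprt (mul (int q) g - mul p u) \<le> mul (int (q * n)) k"
              unfolding g(3) ray_T p'_def[symmetric] by (rule le_infI1)
            then show ?thesis by (intro w_ideal_le[OF frame_mapsD(2)[OF h] k]) simp_all
          next
            case False
            have "pprt (mul (int q) (w i j) - mul p' u) \<in> {0}"
              using ray_mem[of "int q" "w i j" p'] False by (simp add: ray_w[OF j])
            then have "pprt (mul (int q) g - mul p u) = 0"
              unfolding g(3) ray_T p'_def[symmetric] by (simp add: inf_absorb2)
            then show ?thesis using w_idealD(1)[OF frame_mapsD(2)[OF h, of "{r<..}"]] by simp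
          qed
          then show ?thesis by (simp add: upper_ray ray_subset_iff frame_mapsD(2)[OF h])
        qed
        then show "upper f r \<subseteq> h {r<..}"
          unfolding f(2) by (intro kg_least UN_least frame_mapsD(2)[OF h]) auto
        have "h {s<..} \<subseteq> upper f r" if rs: "r < s" for s
        proof (cases "real m < s")
          case True
          then have "h {s<..} \<subseteq> {0}" using h_mono[of "real m" s] m(1) by simp
          then show ?thesis using w_idealD(1)[OF w_ideal_upper] by auto
        next
          case False
          obtain i where i: "inverse (real (Suc i)) < s - r"
            using rs reals_Archimedean[of "s - r"] by auto
          \<comment> \<open>The first grid level above \<open>r\<close>: it overshoots by at most
            \<open>\<rho> i\<close>, which is below \<open>s - r\<close>.\<close>
          obtain j where j: "0 < j" "r < level i j" "level i j < s"
          proof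
            define j where "j = nat (\<lfloor>(r + real m) / \<rho> i\<rfloor> + 1)"
            have "0 \<le> (r + real m) / \<rho> i" using \<open>\<not> r < - real m\<close> v(1)[of i] by simp
            then have j: "real j = of_int \<lfloor>(r + real m) / \<rho> i\<rfloor> + 1" "0 < j" by (simp_all add: j_def)
            then have "(r + real m) / \<rho> i < real j" "real j \<le> (r + real m) / \<rho> i + 1" by linarith+
            then have "r + real m < real j * \<rho> i" "real j * \<rho> i \<le> r + real m + \<rho> i"
              using v(1)[of i] by (simp_all add: field_simps)
            then show "0 < j" "r < level i j" "level i j < s"
              using j(2) v(2)[of i] i by (simp_all add: level_def)
          qed
          have I: "(i, j) \<in> I" using j False by (simp add: I_def)
          have "k \<in> upper f r" if k: "k \<in> D (level i j)" for k
          proof -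
            \<comment> \<open>As \<open>r\<close> lies below the level, the ray of
              \<open>w i j\<close> is the whole group and the meet with it disappears; letting
              \<open>n\<close> vary in the archimedean rule removes the constant as well.\<close>
            have "pprt (mul (int n) (mul (int q) k) - mul p' u) \<in> upper f r" for n
            proof -
              have "ray (w i j) p' (int q) = UNIV" using j by (simp add: ray_w)
              then have "kg {pprt (mul (int q * int n) k - mul p' u)} = ray (T n k i j) p (int q)"
                unfolding ray_def[of "T n k i j"] ray_T p'_def[symmetric]
                by (subst kg_inf) (simp_all add: ray_def)
              also have "\<dots> = upper (T n k i j) r" by (simp only: upper_ray)
              also have "\<dots> \<subseteq> upper f r"
                unfolding f(2) using T_in[OF I k]
                by (intro order_trans[OF _ hull_subset] UN_upper)
              finally have "pprt (mul (int q * int n) k - mul p' u) \<in> upper f r"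
                using hull_inc[of "pprt (mul (int q * int n) k - mul p' u)"] by blast
              then show ?thesis by (simp add: mult.commute)
            qed
            then have "mul (int q) k \<in> upper f r"
              by (rule w_idealD(4)[OF w_ideal_upper mul_nonneg[OF _ D(2)[OF k]] mul_nonneg[OF p'_nonneg unit_nonneg], rotated]) simp
            moreover have "k \<le> mul (int q) k"
              using mul_mono_left[of 1 "int q" k] D(2)[OF k] q by simp
            ultimately show ?thesis by (rule w_ideal_le[OF w_ideal_upper _ D(2)[OF k]])
          qed
          then have "kg (D (level i j)) \<subseteq> upper f r" by (intro kg_least) auto
          then show ?thesis using h_mono[of "level i j" s] j(3) D(3)[of "level i j"] by auto
        qed
        then have "kg (\<Union>s\<in>{r<..}. h {s<..}) \<subseteq> upper f r" by (intro kg_least) auto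
        then show "h {r<..} \<subseteq> upper f r" by (simp only: frame_map_ray[OF h, of r])
      qed
    qed
    then show "madden_rep G f {of_int p / of_nat q<..} = h {of_int p / of_nat q<..}"
      by (simp add: madden_rep_upper r_def)
  qed
  then show "h \<in> madden_rep G ` bounded_part G" using f(1) by blast
qed

lemma sigma_complete_if_complete:
  "cond_pointwise_complete G \<Longrightarrow> cond_pointwise_sigma_complete G"
  unfolding cond_pointwise_complete_def cond_pointwise_sigma_complete_def by blast

end

theorem theorem6p2p1:
  fixes u :: "'a::lattice_ab_group_add"
  defines "G \<equiv> lgroup_of u"
  defines "L \<equiv> madden_frame G"
  assumes "w_object G"
  shows
    "(small_unit_multiples G \<and> cond_pointwise_complete G
        \<longleftrightarrow> boolean_frame L \<and> madden_rep_onto_bounded G) \<and>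
     (small_unit_multiples G \<and> cond_pointwise_sigma_complete G
        \<longleftrightarrow> P_frame L \<and> madden_rep_onto_bounded G)"
proof -
  interpret w_group u by unfold_locales (use assms in simp)
  show ?thesis
    unfolding L_def G_def
    using boolean_if_complete P_frame_if_sigma_complete onto_if_sigma_complete
      sigma_complete_if_complete complete_if_boolean sigma_complete_if_P_frame
      small_unit_multiples_if_onto
    by blast
qed

end
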